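(* Let $-1<\nu,\gamma<1$ be fixed, suppose that $u\in H^{\mu}_{w_k}(0,T)$ with $\mu\ge 0$, and let $$\Psi_{k,M}(u)=\sum_{n=1}^{2^{k-1}}\sum_{m=0}^{M}u_{n,m}\psi_{n,m}(t)$$ be the best approximation of $u$ based on the Jacobi wavelets. Then $$\|u-\Psi_{k,M}(u)\|_{L^2_{w_k}(0,T)}\le C\,M^{-\mu}\,|u|_{H^{0;\mu;M;k}_{w_k}(0,T)}$$ and, for $1\le r\le\mu$, $$\|u-\Psi_{k,M}(u)\|_{H^{r}_{w_k}(0,T)}\le C\,M^{2r-\frac12-\mu}\,|u|_{H^{r;\mu;M;k}_{w_k}(0,T)},$$ where in both inequalities $C$ denotes a positive constant that is independent of $M$ and $k$ but depends on the length $T$.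
   Context: Jacobi polynomials: for $\nu,\gamma>-1$, $P_m^{(\nu,\gamma)}$ ($m=0,1,2,\dots$) denotes the Jacobi polynomial of degree $m$; these are orthogonal on $[-1,1]$ with respect to the weight $w(t)=w^{(\nu,\gamma)}(t)=(1-t)^\nu(1+t)^\gamma$. Put $h_m^{(\nu,\gamma)}=\int_{-1}^1 w(t)\,(P_m^{(\nu,\gamma)}(t))^2\,dt$. Weights: let $T>0$. For an integer $k\ge1$ (the level of resolution) and $n=1,\dots,2^{k-1}$ let $w_{n,k}(t)=w\left(\frac{2^k}{T}t-2n+1\right)$. The weight $w_k$ on $[0,T)$ is defined by $w_k(t)=w_{n,k}(t)$ for $\frac{n-1}{2^{k-1}}T\le t<\frac{n}{2^{k-1}}T$, $n=1,\dots,2^{k-1}$. Jacobi wavelets: for $k\ge1$, $n=1,\dots,2^{k-1}$, $m\ge0$, $$\psi_{n,m}(t)=2^{k/2}\sqrt{\tfrac{1}{h_m^{(\nu,\gamma)}T}}\;P_m^{(\nu,\gamma)}\left(\tfrac{2^k}{T}t-2n+1\right)\ \text{ if } \tfrac{n-1}{2^{k-1}}T\le t<\tfrac{n}{2^{k-1}}T,$$ and $\psi_{n,m}(t)=0$ otherwise. They are orthonormal with respect to $w_k$. Coefficients of the best approximation: $u_{n,m}=\int_0^T w_k(t)u(t)\psi_{n,m}(t)\,dt$. Norms: for a weight $w^*$ on $(a,b)$, $L^2_{w^*}(a,b)$ is the space of measurable functions whose square is Lebesgue integrable on $(a,b)$ relative to $w^*$, with $\|u\|_{L^2_{w^*}(a,b)}=\left(\int_a^b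 w^*(t)|u(t)|^2dt\right)^{1/2}$. For an integer $r\ge0$, $H^r_{w^*}(a,b)$ is the weighted Sobolev space relative to $w^*$, with norm $\|u\|_{H^r_{w^*}(a,b)}=\left(\sum_{j=0}^r\|u^{(j)}\|^2_{L^2_{w^*}(a,b)}\right)^{1/2}$, where $u^{(j)}$ is the $j$th derivative of $u$. Seminorm: for $u\in H^\mu_{w_k}(0,T)$, $0\le r\le\mu$, $M\ge0$ and $k\ge1$ (with $r,\mu,M,k$ integers), $$|u|_{H^{r;\mu;M;k}_{w_k}(0,T)}=\left(\sum_{j=\min\{\mu,M+1\}}^{\mu}(2^k)^{2r-2j}\,\|u^{(j)}\|^2_{L^2_{w_k}(0,T)}\right)^{1/2}.$$
   Formalization: For r ≥ 1 the H^r norm of u − Ψ is taken cell by cell (weak derivatives inside each cell), since Ψ jumps at cell endpoints and u − Ψ need not lie in H^r(0,T); it equals the usual norm whenever that exists. M ≥ 1 is assumed. *)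

theory Defs
  imports "HOL-Analysis.Analysis"
begin

section \<open>Jacobi polynomials\<close>

text \<open>The standard normalisation is used: the value at \<open>1\<close> is \<open>(m + \<nu>) gchoose m\<close>.\<close>

definition jacobi_P :: "real \<Rightarrow> real \<Rightarrow> nat \<Rightarrow> real \<Rightarrow> real" where
  "jacobi_P \<nu> \<gamma> m t =
     (\<Sum>s\<le>m. ((real m + \<nu>) gchoose (m - s)) * ((real m + \<gamma>) gchoose s)
              * ((t - 1) / 2) ^ s * ((t + 1) / 2) ^ (m - s))"

definition jacobi_weight :: "real \<Rightarrow> real \<Rightarrow> real \<Rightarrow> real" where
  "jacobi_weight \<nu> \<gamma> t = (1 - t) powr \<nu> * (1 + t) powr \<gamma>"

definition jacobi_h :: "real \<Rightarrow> real \<Rightarrow> nat \<Rightarrow> real" where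
  "jacobi_h \<nu> \<gamma> m = (LINT t:{-1..1}|lebesgue. jacobi_weight \<nu> \<gamma> t * (jacobi_P \<nu> \<gamma> m t)\<^sup>2)"


section \<open>Jacobi wavelets\<close>

definition cell :: "real \<Rightarrow> nat \<Rightarrow> nat \<Rightarrow> real set" where
  "cell T k n = {(real n - 1) / 2 ^ (k - 1) * T ..< real n / 2 ^ (k - 1) * T}"

definition cell_coord :: "real \<Rightarrow> nat \<Rightarrow> nat \<Rightarrow> real \<Rightarrow> real" where
  "cell_coord T k n t = 2 ^ k / T * t - 2 * real n + 1"

text \<open>The cells are disjoint, so at each point at most one summand is nonzero.\<close>

definition wavelet_weight :: "real \<Rightarrow> real \<Rightarrow> real \<Rightarrow> nat \<Rightarrow> real \<Rightarrow> real" where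
  "wavelet_weight \<nu> \<gamma> T k t =
     (\<Sum>n = 1..2 ^ (k - 1). if t \<in> cell T k n then jacobi_weight \<nu> \<gamma> (cell_coord T k n t) else 0)"

definition wavelet :: "real \<Rightarrow> real \<Rightarrow> real \<Rightarrow> nat \<Rightarrow> nat \<Rightarrow> nat \<Rightarrow> real \<Rightarrow> real" where
  "wavelet \<nu> \<gamma> T k n m t =
     (if t \<in> cell T k n
      then 2 powr (real k / 2) * sqrt (1 / (jacobi_h \<nu> \<gamma> m * T)) * jacobi_P \<nu> \<gamma> m (cell_coord T k n t)
      else 0)"

definition wavelet_coeff ::
    "real \<Rightarrow> real \<Rightarrow> real \<Rightarrow> nat \<Rightarrow> (real \<Rightarrow> real) \<Rightarrow> nat \<Rightarrow> nat \<Rightarrow> real" where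
  "wavelet_coeff \<nu> \<gamma> T k u n m =
     (LINT t:{0<..<T}|lebesgue. wavelet_weight \<nu> \<gamma> T k t * u t * wavelet \<nu> \<gamma> T k n m t)"

definition wavelet_approx ::
    "real \<Rightarrow> real \<Rightarrow> real \<Rightarrow> nat \<Rightarrow> nat \<Rightarrow> (real \<Rightarrow> real) \<Rightarrow> real \<Rightarrow> real" where
  "wavelet_approx \<nu> \<gamma> T k M u t =
     (\<Sum>n = 1..2 ^ (k - 1). \<Sum>m = 0..M. wavelet_coeff \<nu> \<gamma> T k u n m * wavelet \<nu> \<gamma> T k n m t)"


section \<open>Weak derivatives and weighted Sobolev spaces on open subsets of the line\<close>

definition test_function :: "real set \<Rightarrow> (real \<Rightarrow> real) \<Rightarrow> bool" where
  "test_function S \<phi> \<longleftrightarrow>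
     (\<forall>i t. (deriv ^^ i) \<phi> differentiable (at t)) \<and>
     (\<exists>K. compact K \<and> K \<subseteq> S \<and> (\<forall>t. t \<notin> K \<longrightarrow> \<phi> t = 0))"

definition locally_integrable :: "real set \<Rightarrow> (real \<Rightarrow> real) \<Rightarrow> bool" where
  "locally_integrable S u \<longleftrightarrow> (\<forall>K. compact K \<and> K \<subseteq> S \<longrightarrow> set_integrable lebesgue K u)"

definition has_weak_deriv :: "real set \<Rightarrow> nat \<Rightarrow> (real \<Rightarrow> real) \<Rightarrow> (real \<Rightarrow> real) \<Rightarrow> bool" where
  "has_weak_deriv S j u v \<longleftrightarrow>
     locally_integrable S u \<and> locally_integrable S v \<and>
     (\<forall>\<phi>. test_function S \<phi> \<longrightarrow>
        (LINT t:S|lebesgue. u t * (deriv ^^ j) \<phi> t) = (-1) ^ j * (LINT t:S|lebesgue. v t * \<phi> t))"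

text \<open>Weak derivatives are unique up to null sets, so the choice does not affect integrals.\<close>

definition weak_deriv :: "real set \<Rightarrow> nat \<Rightarrow> (real \<Rightarrow> real) \<Rightarrow> real \<Rightarrow> real" where
  "weak_deriv S j u = (SOME v. has_weak_deriv S j u v)"

definition L2_space :: "(real \<Rightarrow> real) \<Rightarrow> real set \<Rightarrow> (real \<Rightarrow> real) set" where
  "L2_space w S =
     {u. set_borel_measurable lebesgue S u \<and> set_integrable lebesgue S (\<lambda>t. w t * \<bar>u t\<bar>\<^sup>2)}"

definition L2_norm :: "(real \<Rightarrow> real) \<Rightarrow> real set \<Rightarrow> (real \<Rightarrow> real) \<Rightarrow> real" where
  "L2_norm w S u = sqrt (LINT t:S|lebesgue. w t * \<bar>u t\<bar>\<^sup>2)"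

definition sobolev_space :: "(real \<Rightarrow> real) \<Rightarrow> real set \<Rightarrow> nat \<Rightarrow> (real \<Rightarrow> real) set" where
  "sobolev_space w S r =
     {u. u \<in> L2_space w S \<and> (\<forall>j\<in>{1..r}. \<exists>v\<in>L2_space w S. has_weak_deriv S j u v)}"

definition sobolev_norm :: "(real \<Rightarrow> real) \<Rightarrow> real set \<Rightarrow> nat \<Rightarrow> (real \<Rightarrow> real) \<Rightarrow> real" where
  "sobolev_norm w S r u = sqrt (\<Sum>j = 0..r. (L2_norm w S (weak_deriv S j u))\<^sup>2)"

definition wavelet_seminorm ::
    "real \<Rightarrow> real \<Rightarrow> real \<Rightarrow> nat \<Rightarrow> nat \<Rightarrow> nat \<Rightarrow> nat \<Rightarrow> (real \<Rightarrow> real) \<Rightarrow> real" where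
  "wavelet_seminorm \<nu> \<gamma> T r \<mu> M k u =
     sqrt (\<Sum>j = min \<mu> (M + 1)..\<mu>. (2 ^ k) powi (2 * int r - 2 * int j)
             * (L2_norm (wavelet_weight \<nu> \<gamma> T k) {0<..<T} (weak_deriv {0<..<T} j u))\<^sup>2)"

text \<open>
  A truncated wavelet expansion is in general discontinuous at the endpoints of the cells, so for
  \<open>r \<ge> 1\<close> it has no weak derivatives in \<open>L\<^sup>2\<close> on the whole interval.  The Sobolev norm of
  the approximation error is therefore the piecewise (broken) one: derivatives are taken in the
  interior of each cell.  The removed endpoints are a null set, so for functions in the Sobolev
  space over \<open>{0<..<T}\<close> both norms agree.
\<close>

definition cell_interiors :: "real \<Rightarrow> nat \<Rightarrow> real set" where
  "cell_interiors T k = (\<Union>n\<in>{1..2 ^ (k - 1)}. interior (cell T k n))"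

end

theory Submission
  imports Defs
begin

text \<open>
  The affine map of a cell onto \<open>(-1, 1)\<close> turns the part of the wavelet expansion that lives on
  this cell into a truncated Jacobi expansion, that is, into the projection \<open>\<Pi>\<^sub>n\<close>, \<open>n = M + 1\<close>, onto the
  polynomials of degree below \<open>n\<close> that is orthogonal for the weight \<open>W\<^sub>a\<^sub>b(t) = (1 - t)\<^sup>a (1 + t)\<^sup>b\<close> with
  \<open>a = \<nu>\<close>, \<open>b = \<gamma>\<close>.  The \<open>j\<close>-th derivative is multiplied by the \<open>j\<close>-th power of the half width \<open>T / 2\<^sup>k\<close> of
  the cell; this is where the powers of \<open>2\<^sup>k\<close> in the seminorm and the dependence of \<open>C\<close> on \<open>T\<close> come
  from.  What remains is an estimate on \<open>(-1, 1)\<close>.  All norms are squared below, so exponents of the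
  degree appear doubled.

  Up to the weights, the adjoint of \<open>d/dt\<close>, as a map
  from the weight \<open>W\<^sub>a\<^sub>b\<close> to the weight \<open>W\<close> with both exponents raised by one, is a differential operator that maps
  polynomials to polynomials and raises the degree by one (\<open>jacobi_integral_by_parts\<close>).  Hence
  differentiation carries \<open>\<Pi>\<^sub>n f\<close> to the projection of \<open>f'\<close> of index \<open>n - 1\<close> for the raised weight
  (\<open>pderiv_jacobi_proj\<close>), and the Jacobi polynomials are eigenfunctions with eigenvalues
  \<open>m (m + a + b + 1)\<close> (\<open>jacobi_differential_equation\<close>).  A function orthogonal to all polynomials of
  degree below \<open>n\<close> therefore satisfies a Poincare inequality whose constant is of order \<open>1/n\<^sup>2\<close>
  (\<open>jacobi_poincare\<close>).  Applying it to \<open>s\<close> derivatives in turn gives the factor \<open>n\<close> to the power \<open>-2s\<close>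
  (\<open>jacobi_L2_rate\<close>); the raised weights are dominated by the original one.

  It remains to treat derivatives of the error.  For a fixed weight, \<open>(\<Pi>\<^sub>n f)'\<close> and \<open>\<Pi>\<^sub>n f'\<close> differ, but only by few
  components of highest degree with respect to the raised weight.  For these components
  passing back to the smaller weight costs one factor of \<open>n\<close> (\<open>jacobi_commutator_bound\<close>), and every further
  derivative costs \<open>n\<^sup>4\<close> by the Markov inequality (\<open>jacobi_Markov\<close>).  Induction on the order \<open>j \<ge> 1\<close> of the
  derivative gives the power \<open>4j - 1 - 2s\<close> of \<open>n\<close> (\<open>jacobi_derivative_rate\<close>).

  The minimum in the seminorm has the following reason.  With \<open>s = min \<mu> (M + 1)\<close> the estimate needs \<open>s \<le> n\<close> and uses the
  \<open>s\<close>-th derivative only.  If \<open>s < \<mu>\<close> then \<open>M\<close> is bounded by \<open>\<mu>\<close>, so that powers of \<open>M\<close> are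
  comparable to constants; derivatives of the error of order above \<open>M\<close> are those of \<open>u\<close> itself and
  occur in the seminorm.

  Since \<open>\<nu>, \<gamma> < 1\<close>, the reciprocal of the weight is integrable, so functions in the weighted
  \<open>L\<^sup>2\<close> space are integrable up to the endpoints of the cells.  By the lemma of du Bois-Reymond
  all derivatives of \<open>u\<close> of order below \<open>\<mu>\<close> are then represented by absolutely continuous functions on \<open>[0, T]\<close>
  (\<open>weak_derivs_absolutely_continuous\<close>).  They are bounded, and the raised weights vanish at the
  endpoints, so integration by parts produces no boundary terms.  In the opposite
  direction, chains of absolutely continuous functions on the cells yield weak derivatives on
  the union of their interiors (\<open>has_weak_deriv_piecewise\<close>), where the norms of the error are computed.
\<close>

section \<open>Square integrable functions\<close>

definition square_integrable :: "'a measure \<Rightarrow> ('a \<Rightarrow> real) \<Rightarrow> bool" where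
  "square_integrable M f \<longleftrightarrow> f \<in> borel_measurable M \<and> integrable M (\<lambda>x. (f x)\<^sup>2)"

definition sqnorm :: "'a measure \<Rightarrow> ('a \<Rightarrow> real) \<Rightarrow> real" where
  "sqnorm M f = (\<integral>x. (f x)\<^sup>2 \<partial>M)"

lemma sqnorm_nonneg: "sqnorm M f \<ge> 0"
  unfolding sqnorm_def by simp

lemma abs_mult_le_squares: "\<bar>x * y\<bar> \<le> x\<^sup>2 + (y::real)\<^sup>2"
proof -
  have "2 * \<bar>x * y\<bar> \<le> x\<^sup>2 + y\<^sup>2"
    using sum_squares_bound[of "\<bar>x\<bar>" "\<bar>y\<bar>"] by (simp add: abs_mult)
  then show ?thesis
    using abs_ge_zero[of "x * y"] by linarith
qed

lemma square_integrable_mult: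
  assumes "square_integrable M f" "square_integrable M g"
  shows "integrable M (\<lambda>x. f x * g x)"
proof (rule Bochner_Integration.integrable_bound)
  show "integrable M (\<lambda>x. (f x)\<^sup>2 + (g x)\<^sup>2)"
    using assms unfolding square_integrable_def by auto
  show "(\<lambda>x. f x * g x) \<in> borel_measurable M"
    using assms unfolding square_integrable_def by auto
  show "AE x in M. norm (f x * g x) \<le> norm ((f x)\<^sup>2 + (g x)\<^sup>2)"
    using abs_mult_le_squares by (auto intro!: AE_I2)
qed

lemma square_integrable_cmult:
  "square_integrable M f \<Longrightarrow> square_integrable M (\<lambda>x. c * f x)"
  unfolding square_integrable_def by (auto simp: power_mult_distrib)

lemma square_integrable_add:
  assumes "square_integrable M f" "square_integrable M g"
  shows "square_integrable M (\<lambda>x. f x + g x)"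
  using assms square_integrable_mult[OF assms]
  unfolding square_integrable_def by (auto simp: power2_sum mult.assoc)

lemma square_integrable_diff:
  assumes "square_integrable M f" "square_integrable M g"
  shows "square_integrable M (\<lambda>x. f x - g x)"
  using square_integrable_add[OF assms(1) square_integrable_cmult[OF assms(2), of "-1"]] by simp

lemma sqnorm_add_expand:
  assumes "square_integrable M f" "square_integrable M g"
  shows "sqnorm M (\<lambda>x. f x + g x) = sqnorm M f + sqnorm M g + 2 * (\<integral>x. f x * g x \<partial>M)"
proof -
  have "sqnorm M (\<lambda>x. f x + g x) = (\<integral>x. ((f x)\<^sup>2 + (g x)\<^sup>2) + 2 * (f x * g x) \<partial>M)"
    unfolding sqnorm_def by (simp add: power2_sum mult.assoc)
  also have "\<dots> = (\<integral>x. (f x)\<^sup>2 + (g x)\<^sup>2 \<partial>M) + (\<integral>x. 2 * (f x * g x) \<partial>M)"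
    using assms square_integrable_mult[OF assms]
    by (intro Bochner_Integration.integral_add) (auto simp: square_integrable_def)
  finally show ?thesis
    using assms by (simp add: sqnorm_def square_integrable_def)
qed

lemma sqnorm_cmult: "sqnorm M (\<lambda>x. c * f x) = c\<^sup>2 * sqnorm M f"
  unfolding sqnorm_def by (simp add: power_mult_distrib)

lemma sqnorm_diff_expand:
  assumes "square_integrable M f" "square_integrable M g"
  shows "sqnorm M (\<lambda>x. f x - g x) = sqnorm M f + sqnorm M g - 2 * (\<integral>x. f x * g x \<partial>M)"
  using sqnorm_add_expand[OF assms(1) square_integrable_cmult[OF assms(2), of "-1"]]
    sqnorm_cmult[of M "-1" g]
  by simp

lemma sqnorm_add_le:
  assumes "square_integrable M f" "square_integrable M g"
  shows "sqnorm M (\<lambda>x. f x + g x) \<le> 2 * sqnorm M f + 2 * sqnorm M g"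
  using sqnorm_add_expand[OF assms] sqnorm_diff_expand[OF assms]
    sqnorm_nonneg[of M "\<lambda>x. f x - g x"] by linarith

lemma sqnorm_diff_le:
  assumes "square_integrable M f" "square_integrable M g"
  shows "sqnorm M (\<lambda>x. f x - g x) \<le> 2 * sqnorm M f + 2 * sqnorm M g"
  using sqnorm_add_expand[OF assms] sqnorm_diff_expand[OF assms]
    sqnorm_nonneg[of M "\<lambda>x. f x + g x"] by linarith

lemma Cauchy_Schwarz_integral:
  assumes "square_integrable M f" "square_integrable M g"
  shows "(\<integral>x. f x * g x \<partial>M)\<^sup>2 \<le> sqnorm M f * sqnorm M g"
proof -
  define a b c where "a = sqnorm M f" and "b = (\<integral>x. f x * g x \<partial>M)" and "c = sqnorm M g"
  have nonneg: "0 \<le> a + t\<^sup>2 * c - 2 * t * b" for t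
    using sqnorm_diff_expand[OF assms(1) square_integrable_cmult[OF assms(2), of t]]
      sqnorm_cmult[of M t g] sqnorm_nonneg[of M "\<lambda>x. f x - t * g x"]
    by (simp add: a_def b_def c_def mult.left_commute[of _ t])
  have c0: "c \<ge> 0"
    unfolding c_def by (rule sqnorm_nonneg)
  show ?thesis
  proof (cases "c = 0")
    case True
    have "b = 0"
    proof (rule ccontr)
      assume "b \<noteq> 0"
      then show False
        using nonneg[of "(a + 1) / (2 * b)"] True by (simp add: field_simps)
    qed
    then show ?thesis
      using True by (simp add: a_def b_def c_def)
  next
    case False
    then have "c > 0"
      using c0 by simp
    have "0 \<le> c * (a + (b / c)\<^sup>2 * c - 2 * (b / c) * b)"
      using nonneg[of "b / c"] \<open>c > 0\<close> by simp
    also have "\<dots> = a * c - b\<^sup>2"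
      using \<open>c > 0\<close> by (simp add: field_simps power2_eq_square)
    finally show ?thesis
      by (simp add: a_def b_def c_def)
  qed
qed

lemma square_integrable_cong:
  assumes "\<And>x. x \<in> space M \<Longrightarrow> f x = g x"
  shows "square_integrable M f \<longleftrightarrow> square_integrable M g" "sqnorm M f = sqnorm M g"
  using assms unfolding square_integrable_def sqnorm_def
  by (auto cong: measurable_cong Bochner_Integration.integrable_cong Bochner_Integration.integral_cong)

section \<open>Orthogonal projection onto polynomials\<close>

text \<open>
  The strict bound makes the space of index \<open>0\<close> trivial, so the index \<open>n - 1\<close> that arises from
  differentiation is meaningful whenever \<open>n \<ge> 1\<close>.
\<close>

definition polys_below :: "nat \<Rightarrow> real poly set" where
  "polys_below n = {p. \<forall>i\<ge>n. coeff p i = 0}"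

lemma polys_below_iff: "p \<in> polys_below n \<longleftrightarrow> p = 0 \<or> degree p < n"
  unfolding polys_below_def
  by (auto simp: coeff_eq_0) (metis leading_coeff_0_iff not_le)

lemma polys_below_0: "p \<in> polys_below 0 \<longleftrightarrow> p = 0"
  by (simp add: polys_below_iff)

lemma polys_below_Suc: "p \<in> polys_below (Suc n) \<longleftrightarrow> degree p \<le> n"
  by (auto simp: polys_below_iff)

lemma polys_below_mono: "p \<in> polys_below m \<Longrightarrow> m \<le> n \<Longrightarrow> p \<in> polys_below n"
  by (auto simp: polys_below_def)

lemma polys_below_add: "p \<in> polys_below n \<Longrightarrow> q \<in> polys_below n \<Longrightarrow> p + q \<in> polys_below n"
  and polys_below_diff: "p \<in> polys_below n \<Longrightarrow> q \<in> polys_below n \<Longrightarrow> p - q \<in> polys_below n"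
  and polys_below_smult: "p \<in> polys_below n \<Longrightarrow> smult c p \<in> polys_below n"
  by (auto simp: polys_below_def)

lemma polys_below_sum: "(\<And>i. i \<in> A \<Longrightarrow> f i \<in> polys_below n) \<Longrightarrow> sum f A \<in> polys_below n"
  by (auto simp: polys_below_def coeff_sum)

lemma polys_below_pderiv: "p \<in> polys_below n \<Longrightarrow> pderiv p \<in> polys_below (n - 1)"
  by (auto simp: polys_below_def coeff_pderiv)

lemma polys_below_mult:
  assumes "p \<in> polys_below n" "degree q \<le> d"
  shows "q * p \<in> polys_below (n + d)"
proof (cases "p = 0 \<or> q = 0")
  case False
  then show ?thesis
    using assms by (auto simp: polys_below_iff degree_mult_eq)
qed (auto simp: polys_below_def)

text \<open>
  Jacobi weights with all exponents above \<open>-1\<close> are treated at once, because the exponents are raised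
  and lowered in the course of the argument.
\<close>

locale orthogonal_polynomials =
  fixes M :: "real measure" and P :: "nat \<Rightarrow> real poly"
  assumes integrable_poly: "integrable M (poly p)"
    and P_nonzero: "P m \<noteq> 0"
    and degree_P: "degree (P m) = m"
    and orthogonal: "m \<noteq> n \<Longrightarrow> (\<integral>x. poly (P m) x * poly (P n) x \<partial>M) = 0"
    and sqnorm_poly_pos: "p \<noteq> 0 \<Longrightarrow> 0 < sqnorm M (poly p)"
begin

lemma square_integrable_poly: "square_integrable M (poly p)"
proof -
  have "(\<lambda>x. (poly p x)\<^sup>2) = poly (p\<^sup>2)"
    by auto
  then show ?thesis
    unfolding square_integrable_def using integrable_poly[of p] integrable_poly[of "p\<^sup>2"] by simp
qed

lemma integrable_eq_poly:
  assumes "\<And>x. f x = poly p x"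
  shows "integrable M f"
proof -
  have "f = poly p"
    using assms by auto
  then show ?thesis
    using integrable_poly by simp
qed

lemma integrable_mult_poly: "square_integrable M f \<Longrightarrow> integrable M (\<lambda>x. f x * poly p x)"
  by (intro square_integrable_mult square_integrable_poly)

lemma integral_mult_poly_lincomb:
  assumes "square_integrable M f" "finite A"
  shows "(\<integral>x. f x * poly (\<Sum>i\<in>A. smult (c i) (p i)) x \<partial>M) = (\<Sum>i\<in>A. c i * (\<integral>x. f x * poly (p i) x \<partial>M))"
proof -
  have "(\<integral>x. f x * poly (\<Sum>i\<in>A. smult (c i) (p i)) x \<partial>M)
      = (\<integral>x. (\<Sum>i\<in>A. c i * (f x * poly (p i) x)) \<partial>M)"
    by (intro Bochner_Integration.integral_cong) (auto simp: poly_sum sum_distrib_left mult_ac)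
  also have "\<dots> = (\<Sum>i\<in>A. \<integral>x. c i * (f x * poly (p i) x) \<partial>M)"
    using integrable_mult_poly[OF assms(1)] by (intro Bochner_Integration.integral_sum) auto
  finally show ?thesis
    by simp
qed

lemma polys_below_expansion:
  assumes "p \<in> polys_below n"
  shows "\<exists>c. p = (\<Sum>m<n. smult (c m) (P m))"
  using assms
proof (induction n arbitrary: p)
  case 0
  then show ?case
    by (simp add: polys_below_0)
next
  case (Suc n)
  define l where "l = coeff p n / coeff (P n) n"
  have lead: "coeff (P n) n \<noteq> 0"
    using P_nonzero[of n] degree_P[of n] by (metis leading_coeff_0_iff)
  have "p - smult l (P n) \<in> polys_below n"
    unfolding polys_below_def
  proof (intro CollectI allI impI)
    fix i assume "i \<ge> n"
    show "coeff (p - smult l (P n)) i = 0"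
    proof (cases "i = n")
      case True
      then show ?thesis
        using lead by (simp add: l_def)
    next
      case False
      then show ?thesis
        using \<open>i \<ge> n\<close> Suc.prems degree_P[of n] by (auto simp: polys_below_def coeff_eq_0)
    qed
  qed
  from Suc.IH[OF this] obtain c where c: "p - smult l (P n) = (\<Sum>m<n. smult (c m) (P m))"
    by blast
  have "p = (\<Sum>m<Suc n. smult ((c(n := l)) m) (P m))"
    using c by (simp add: algebra_simps)
  then show ?case
    by blast
qed

lemma orthogonal_polys_below:
  assumes "p \<in> polys_below m"
  shows "(\<integral>x. poly (P m) x * poly p x \<partial>M) = 0"
proof -
  obtain c where c: "p = (\<Sum>i<m. smult (c i) (P i))"
    using polys_below_expansion[OF assms] by blast
  show ?thesis
    unfolding c by (subst integral_mult_poly_lincomb) (auto intro: square_integrable_poly simp: orthogonal)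
qed

lemma sqnorm_P_pos: "0 < sqnorm M (poly (P m))"
  by (rule sqnorm_poly_pos[OF P_nonzero])

definition proj :: "nat \<Rightarrow> (real \<Rightarrow> real) \<Rightarrow> real poly" where
  "proj n f = (\<Sum>m<n. smult ((\<integral>x. f x * poly (P m) x \<partial>M) / sqnorm M (poly (P m))) (P m))"

lemma proj_in_polys_below: "proj n f \<in> polys_below n"
proof -
  have "P m \<in> polys_below n" if "m < n" for m
    using that by (simp add: polys_below_iff degree_P)
  then show ?thesis
    unfolding proj_def by (auto intro!: polys_below_sum polys_below_smult)
qed

lemma integral_P_lincomb:
  assumes "finite A"
  shows "(\<integral>x. poly (P m) x * poly (\<Sum>i\<in>A. smult (c i) (P i)) x \<partial>M)
       = (if m \<in> A then c m * sqnorm M (poly (P m)) else 0)"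
proof -
  have eq: "(\<integral>x. poly (P m) x * poly (P i) x \<partial>M) = (if i = m then sqnorm M (poly (P m)) else 0)" for i
    by (auto simp: orthogonal sqnorm_def power2_eq_square)
  show ?thesis
    using assms by (simp add: integral_mult_poly_lincomb square_integrable_poly eq if_distrib cong: if_cong)
qed

lemma proj_orthogonal:
  assumes f: "square_integrable M f" and q: "q \<in> polys_below n"
  shows "(\<integral>x. (f x - poly (proj n f) x) * poly q x \<partial>M) = 0"
proof -
  have P: "(\<integral>x. (f x - poly (proj n f) x) * poly (P m) x \<partial>M) = 0" if "m < n" for m
  proof -
    have "(\<integral>x. (f x - poly (proj n f) x) * poly (P m) x \<partial>M)
        = (\<integral>x. f x * poly (P m) x \<partial>M) - (\<integral>x. poly (P m) x * poly (proj n f) x \<partial>M)"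
      using integrable_mult_poly[OF f] integrable_mult_poly[OF square_integrable_poly]
      by (subst Bochner_Integration.integral_diff[symmetric]) (auto simp: algebra_simps)
    also have "(\<integral>x. poly (P m) x * poly (proj n f) x \<partial>M) = (\<integral>x. f x * poly (P m) x \<partial>M)"
      unfolding proj_def using that sqnorm_P_pos[of m] by (subst integral_P_lincomb) auto
    finally show ?thesis
      by simp
  qed
  obtain c where c: "q = (\<Sum>i<n. smult (c i) (P i))"
    using polys_below_expansion[OF q] by blast
  show ?thesis
    unfolding c
    by (subst integral_mult_poly_lincomb)
      (auto intro: square_integrable_diff f square_integrable_poly simp: P)
qed

text \<open>
  All identities between projections, in particular their behaviour under differentiation, are obtained
  by checking this orthogonality.
\<close>

lemma proj_unique:
  assumes f: "square_integrable M f" and p: "p \<in> polys_below n"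
    and ortho: "\<And>q. q \<in> polys_below n \<Longrightarrow> (\<integral>x. (f x - poly p x) * poly q x \<partial>M) = 0"
  shows "proj n f = p"
proof (rule ccontr)
  assume "proj n f \<noteq> p"
  define d where "d = p - proj n f"
  have d: "d \<in> polys_below n" "d \<noteq> 0"
    using p proj_in_polys_below \<open>proj n f \<noteq> p\<close> by (auto simp: d_def intro: polys_below_diff)
  have "sqnorm M (poly d)
      = (\<integral>x. (f x - poly (proj n f) x) * poly d x - (f x - poly p x) * poly d x \<partial>M)"
    unfolding sqnorm_def d_def by (intro Bochner_Integration.integral_cong) (auto simp: power2_eq_square algebra_simps)
  also have "\<dots> = (\<integral>x. (f x - poly (proj n f) x) * poly d x \<partial>M) - (\<integral>x. (f x - poly p x) * poly d x \<partial>M)"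
    by (intro Bochner_Integration.integral_diff integrable_mult_poly square_integrable_diff f square_integrable_poly)
  also have "\<dots> = 0"
    using proj_orthogonal[OF f d(1)] ortho[OF d(1)] by simp
  finally show False
    using sqnorm_poly_pos[OF d(2)] by simp
qed

lemma proj_diff_poly:
  assumes "square_integrable M f" "p \<in> polys_below n"
  shows "proj n (\<lambda>x. f x - poly p x) = proj n f - p"
proof (rule proj_unique)
  show "square_integrable M (\<lambda>x. f x - poly p x)"
    by (intro square_integrable_diff assms square_integrable_poly)
  show "proj n f - p \<in> polys_below n"
    by (intro polys_below_diff proj_in_polys_below assms)
  fix q assume "q \<in> polys_below n"
  then show "(\<integral>x. (f x - poly p x - poly (proj n f - p) x) * poly q x \<partial>M) = 0"
    using proj_orthogonal[OF assms(1)] by simp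
qed

lemma proj_best_approximation:
  assumes f: "square_integrable M f" and q: "q \<in> polys_below n"
  shows "sqnorm M (\<lambda>x. f x - poly (proj n f) x) \<le> sqnorm M (\<lambda>x. f x - poly q x)"
proof -
  define r where "r = proj n f - q"
  have r: "r \<in> polys_below n"
    unfolding r_def by (intro polys_below_diff proj_in_polys_below q)
  have eq: "(\<lambda>x. f x - poly q x) = (\<lambda>x. (f x - poly (proj n f) x) + poly r x)"
    by (auto simp: r_def)
  show ?thesis
    unfolding eq using sqnorm_nonneg[of M "poly r"] proj_orthogonal[OF f r]
    by (subst sqnorm_add_expand) (auto intro: square_integrable_diff f square_integrable_poly)
qed

lemma sqnorm_diff_proj_le:
  "square_integrable M f \<Longrightarrow> sqnorm M (\<lambda>x. f x - poly (proj n f) x) \<le> sqnorm M f"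
  using proj_best_approximation[of f 0 n] by (simp add: polys_below_def)

lemma sqnorm_proj_le:
  assumes f: "square_integrable M f"
  shows "sqnorm M (poly (proj n f)) \<le> sqnorm M f"
proof -
  have eq: "f = (\<lambda>x. (f x - poly (proj n f) x) + poly (proj n f) x)"
    by auto
  have "sqnorm M f = sqnorm M (\<lambda>x. f x - poly (proj n f) x) + sqnorm M (poly (proj n f))"
    by (subst eq, subst sqnorm_add_expand)
      (auto intro: square_integrable_diff f square_integrable_poly
        simp: proj_orthogonal[OF f proj_in_polys_below])
  then show ?thesis
    using sqnorm_nonneg[of M "\<lambda>x. f x - poly (proj n f) x"] by linarith
qed

lemma sqnorm_poly_add_le:
  "sqnorm M (poly (p + q)) \<le> 2 * sqnorm M (poly p) + 2 * sqnorm M (poly q)"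
  and sqnorm_poly_diff_le:
  "sqnorm M (poly (p - q)) \<le> 2 * sqnorm M (poly p) + 2 * sqnorm M (poly q)"
proof -
  have "poly (p + q) = (\<lambda>x. poly p x + poly q x)" "poly (p - q) = (\<lambda>x. poly p x - poly q x)"
    by auto
  then show "sqnorm M (poly (p + q)) \<le> 2 * sqnorm M (poly p) + 2 * sqnorm M (poly q)"
    "sqnorm M (poly (p - q)) \<le> 2 * sqnorm M (poly p) + 2 * sqnorm M (poly q)"
    by (auto intro: sqnorm_add_le sqnorm_diff_le square_integrable_poly)
qed

lemma proj_cong_AE:
  assumes "square_integrable M f" "square_integrable M g" "AE x in M. f x = g x"
  shows "proj n f = proj n g"
proof -
  have "(\<integral>x. f x * poly p x \<partial>M) = (\<integral>x. g x * poly p x \<partial>M)" for p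
  proof (rule integral_cong_AE)
    show "AE x in M. f x * poly p x = g x * poly p x"
      using assms(3) by eventually_elim simp
  qed (rule borel_measurable_integrable[OF integrable_mult_poly[OF assms(1)]]
      borel_measurable_integrable[OF integrable_mult_poly[OF assms(2)]])+
  then show ?thesis
    by (simp add: proj_def)
qed

end

section \<open>Absolutely continuous functions and integration by parts\<close>

text \<open>
  Absolute continuity on \<open>[a, b]\<close> with almost everywhere derivative \<open>g\<close>, expressed by the fundamental theorem
  of calculus.  In this form \<open>g\<close> may be changed on null sets, and no differentiability of \<open>f\<close> at points is needed.
\<close>

definition ac_deriv :: "real \<Rightarrow> real \<Rightarrow> (real \<Rightarrow> real) \<Rightarrow> (real \<Rightarrow> real) \<Rightarrow> bool" where
  "ac_deriv a b f g \<longleftrightarrow>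
     g absolutely_integrable_on {a..b} \<and> (\<forall>x\<in>{a..b}. f x = f a + integral {a..x} g)"

lemma ac_deriv_integrable: "ac_deriv a b f g \<Longrightarrow> g absolutely_integrable_on {a..b}"
  unfolding ac_deriv_def by blast

lemma ac_deriv_eq: "ac_deriv a b f g \<Longrightarrow> a \<le> x \<Longrightarrow> x \<le> b \<Longrightarrow> f x = f a + integral {a..x} g"
  unfolding ac_deriv_def by (blast intro: atLeastAtMost_iff[THEN iffD2])

lemma ac_deriv_increment:
  assumes "ac_deriv a b f g" "a \<le> x" "x \<le> y" "y \<le> b"
  shows "f y - f x = integral {x..y} g"
proof -
  have "g integrable_on {a..b}"
    using ac_deriv_integrable[OF assms(1)] by (simp add: absolutely_integrable_on_def)
  then have "g integrable_on {a..y}"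
    using integrable_on_subinterval[of g "{a..b}" a y] assms by auto
  then have "integral {a..x} g + integral {x..y} g = integral {a..y} g"
    using assms by (intro Henstock_Kurzweil_Integration.integral_combine) auto
  moreover have "f x = f a + integral {a..x} g" "f y = f a + integral {a..y} g"
    using assms by (auto intro!: ac_deriv_eq[OF assms(1)])
  ultimately show ?thesis
    by linarith
qed

lemma ac_deriv_continuous_on:
  assumes "ac_deriv a b f g"
  shows "continuous_on {a..b} f"
proof -
  have "continuous_on {a..b} (\<lambda>x. f a + integral {a..x} g)"
    using ac_deriv_integrable[OF assms] by (intro continuous_intros indefinite_integral_continuous_1)
      (simp add: absolutely_integrable_on_def)
  then show ?thesis
    by (rule continuous_on_eq) (rule ac_deriv_eq[OF assms, symmetric], auto)
qed

lemma ac_derivI: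
  assumes "a \<le> b" "continuous_on {a..b} f"
    and "\<And>x. x \<in> {a<..<b} \<Longrightarrow> (f has_real_derivative g x) (at x)"
    and "g absolutely_integrable_on {a..b}"
  shows "ac_deriv a b f g"
  unfolding ac_deriv_def
proof (intro conjI ballI)
  fix x assume x: "x \<in> {a..b}"
  have "(g has_integral (f x - f a)) {a..x}"
    using x assms(3) by (intro fundamental_theorem_of_calculus_interior)
      (auto intro: continuous_on_subset[OF assms(2)] simp flip: has_real_derivative_iff_has_vector_derivative)
  then show "f x = f a + integral {a..x} g"
    by (simp add: integral_unique)
qed (rule assms)

lemma ac_deriv_subinterval:
  assumes "ac_deriv a b f g" "a \<le> c" "d \<le> b"
  shows "ac_deriv c d f g"
  unfolding ac_deriv_def
proof (intro conjI ballI)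
  show "g absolutely_integrable_on {c..d}"
    by (rule set_integrable_subset[OF ac_deriv_integrable[OF assms(1)]]) (use assms in auto)
  fix x assume "x \<in> {c..d}"
  then have "f x - f c = integral {c..x} g"
    using assms(2,3) by (intro ac_deriv_increment[OF assms(1)]) auto
  then show "f x = f c + integral {c..x} g"
    by linarith
qed

lemma ac_deriv_diff:
  assumes "ac_deriv a b f g" "ac_deriv a b f' g'"
  shows "ac_deriv a b (\<lambda>x. f x - f' x) (\<lambda>x. g x - g' x)"
  unfolding ac_deriv_def
proof (intro conjI ballI)
  show "(\<lambda>x. g x - g' x) absolutely_integrable_on {a..b}"
    using assms by (intro set_integral_diff ac_deriv_integrable)
  fix x assume x: "x \<in> {a..b}"
  have i: "g integrable_on {a..x}" "g' integrable_on {a..x}"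
    using x ac_deriv_integrable[OF ac_deriv_subinterval[OF assms(1), of a x]]
      ac_deriv_integrable[OF ac_deriv_subinterval[OF assms(2), of a x]]
    by (auto simp: absolutely_integrable_on_def)
  have "f x = f a + integral {a..x} g" "f' x = f' a + integral {a..x} g'"
    using x by (auto intro!: ac_deriv_eq assms)
  then show "f x - f' x = f a - f' a + integral {a..x} (\<lambda>x. g x - g' x)"
    using Henstock_Kurzweil_Integration.integral_diff[OF i] by linarith
qed

lemma ac_deriv_cmult:
  assumes "ac_deriv a b f g"
  shows "ac_deriv a b (\<lambda>x. c * f x) (\<lambda>x. c * g x)"
  unfolding ac_deriv_def
proof (intro conjI ballI)
  show "(\<lambda>x. c * g x) absolutely_integrable_on {a..b}"
    using ac_deriv_integrable[OF assms] by simp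
  fix x assume "x \<in> {a..b}"
  then have "f x = f a + integral {a..x} g"
    by (intro ac_deriv_eq[OF assms]) auto
  then have "c * f x = c * (f a + integral {a..x} g)"
    by (rule arg_cong)
  then show "c * f x = c * f a + integral {a..x} (\<lambda>x. c * g x)"
    by (simp add: distrib_left)
qed

lemma absolutely_integrable_mult_continuous:
  fixes f g :: "real \<Rightarrow> real"
  assumes f: "continuous_on {a..b} f" and g: "g absolutely_integrable_on {a..b}"
  shows "(\<lambda>x. f x * g x) absolutely_integrable_on {a..b}"
proof (rule absolutely_integrable_bounded_measurable_product_real)
  show "f \<in> borel_measurable (lebesgue_on {a..b})"
    using f by (intro continuous_imp_measurable_on_sets_lebesgue) auto
  show "bounded (f ` {a..b})"
    using f compact_continuous_image compact_imp_bounded by blast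
qed (use g in auto)

text \<open>
  Fubini's theorem for \<open>g x * \<psi> y\<close> on the triangle \<open>x \<le> y\<close>: the two iterated integrals are
  \<open>\<integral> (f - f a) \<psi>\<close> and \<open>\<integral> g (\<phi> b - \<phi>)\<close>.
\<close>

lemma ac_deriv_by_parts:
  assumes ab: "a \<le> b" and f: "ac_deriv a b f g" and \<phi>: "ac_deriv a b \<phi> \<psi>"
  shows "integral {a..b} (\<lambda>x. f x * \<psi> x) + integral {a..b} (\<lambda>x. g x * \<phi> x) = f b * \<phi> b - f a * \<phi> a"
proof -
  define M where "M = lebesgue_on {a..b}"
  interpret finite_measure M
    unfolding M_def by (intro finite_measure_lebesgue_on) auto
  interpret pair_sigma_finite M M ..
  have sp: "space M = {a..b}"
    by (simp add: M_def)
  have g[measurable]: "integrable M g" and \<psi>[measurable]: "integrable M \<psi>"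
    using ac_deriv_integrable[OF f] ac_deriv_integrable[OF \<phi>]
    by (auto simp: M_def intro: absolutely_integrable_imp_integrable)
  have [measurable]: "g \<in> borel_measurable M" "\<psi> \<in> borel_measurable M"
    using g \<psi> by auto
  have id[measurable]: "(\<lambda>x. x) \<in> borel_measurable M"
    unfolding M_def by (intro continuous_imp_measurable_on_sets_lebesgue continuous_intros) auto
  have LI: "integral\<^sup>L M h = integral {a..b} h" if "integrable M h" for h :: "real \<Rightarrow> real"
    using that unfolding M_def by (intro lebesgue_integral_eq_integral) auto
  define K where "K x y = (if x \<le> y then g x * \<psi> y else 0)" for x y
  have "integrable (M \<Otimes>\<^sub>M M) (\<lambda>(x,y). g x * \<psi> y)"
  proof (rule Fubini_integrable)
    show "(\<lambda>(x,y). g x * \<psi> y) \<in> borel_measurable (M \<Otimes>\<^sub>M M)"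
      by measurable
    show "integrable M (\<lambda>x. LINT y|M. norm (case (x, y) of (x, y) \<Rightarrow> g x * \<psi> y))"
      using g by (simp add: abs_mult)
  qed (use \<psi> in auto)
  then have K: "integrable (M \<Otimes>\<^sub>M M) (case_prod K)"
    by (rule Bochner_Integration.integrable_bound) (auto simp: K_def split_beta')
  have *: "(LINT y|M. LINT x|M. K x y) = (LINT x|M. LINT y|M. K x y)"
    by (rule Fubini_integral[OF K])
  have inner1: "(LINT x|M. K x y) = (f y - f a) * \<psi> y" if y: "y \<in> space M" for y
  proof -
    have "integrable M (\<lambda>x. if x \<le> y then g x else 0)"
      using g by (rule Bochner_Integration.integrable_bound) auto
    then have "(LINT x|M. (if x \<le> y then g x else 0)) = integral {a..b} (\<lambda>x. if x \<in> {..y} then g x else 0)"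
      by (simp add: LI)
    also have "\<dots> = integral ({..y} \<inter> {a..b}) g"
      by (rule integral_restrict_Int)
    also have "{..y} \<inter> {a..b} = {a..y}"
      using y sp by auto
    also have "integral {a..y} g = f y - f a"
      using ac_deriv_eq[OF f, of y] y sp by simp
    finally have "(LINT x|M. (if x \<le> y then g x else 0)) = f y - f a" .
    moreover have "(LINT x|M. K x y) = (LINT x|M. (if x \<le> y then g x else 0) * \<psi> y)"
      by (intro Bochner_Integration.integral_cong) (auto simp: K_def)
    ultimately show ?thesis
      by simp
  qed
  have inner2: "(LINT y|M. K x y) = g x * (\<phi> b - \<phi> x)" if x: "x \<in> space M" for x
  proof -
    have "integrable M (\<lambda>y. if x \<le> y then \<psi> y else 0)"
      using \<psi> by (rule Bochner_Integration.integrable_bound) auto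
    then have "(LINT y|M. (if x \<le> y then \<psi> y else 0)) = integral {a..b} (\<lambda>y. if y \<in> {x..} then \<psi> y else 0)"
      by (simp add: LI)
    also have "\<dots> = integral ({x..} \<inter> {a..b}) \<psi>"
      by (rule integral_restrict_Int)
    also have "{x..} \<inter> {a..b} = {x..b}"
      using x sp by auto
    also have "integral {x..b} \<psi> = \<phi> b - \<phi> x"
      using ac_deriv_increment[OF \<phi>, of x b] x sp by simp
    finally have "(LINT y|M. (if x \<le> y then \<psi> y else 0)) = \<phi> b - \<phi> x" .
    moreover have "(LINT y|M. K x y) = (LINT y|M. g x * (if x \<le> y then \<psi> y else 0))"
      by (intro Bochner_Integration.integral_cong) (auto simp: K_def)
    ultimately show ?thesis
      by simp
  qed
  have f\<psi>: "integrable M (\<lambda>x. f x * \<psi> x)"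
    unfolding M_def using ac_deriv_continuous_on[OF f] ac_deriv_integrable[OF \<phi>]
    by (intro absolutely_integrable_imp_integrable absolutely_integrable_mult_continuous) auto
  have \<phi>g: "integrable M (\<lambda>x. \<phi> x * g x)"
    unfolding M_def using ac_deriv_continuous_on[OF \<phi>] ac_deriv_integrable[OF f]
    by (intro absolutely_integrable_imp_integrable absolutely_integrable_mult_continuous) auto
  have "(LINT y|M. (f y - f a) * \<psi> y) = (LINT x|M. g x * (\<phi> b - \<phi> x))"
    using * inner1 inner2 by (simp cong: Bochner_Integration.integral_cong)
  moreover have "(LINT y|M. (f y - f a) * \<psi> y) = (LINT y|M. f y * \<psi> y) - f a * (LINT y|M. \<psi> y)"
    using f\<psi> \<psi> by (simp add: left_diff_distrib)
  moreover have "(LINT x|M. g x * (\<phi> b - \<phi> x)) = \<phi> b * (LINT x|M. g x) - (LINT x|M. \<phi> x * g x)"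
    using \<phi>g g by (simp add: right_diff_distrib mult.commute)
  moreover have "(LINT y|M. \<psi> y) = \<phi> b - \<phi> a" "(LINT y|M. g y) = f b - f a"
    using ac_deriv_eq[OF f, of b] ac_deriv_eq[OF \<phi>, of b] ab g \<psi> by (simp_all add: LI)
  ultimately show ?thesis
    using f\<psi> \<phi>g by (simp add: LI algebra_simps)
qed

section \<open>Jacobi weights\<close>

lemma jacobi_weight_nonneg: "jacobi_weight a b t \<ge> 0"
  by (simp add: jacobi_weight_def)

lemma jacobi_weight_pos: "t \<in> {-1<..<1} \<Longrightarrow> jacobi_weight a b t > 0"
  by (simp add: jacobi_weight_def)

lemma jacobi_weight_Suc:
  "t \<in> {-1..1} \<Longrightarrow> jacobi_weight (a + 1) (b + 1) t = (1 - t\<^sup>2) * jacobi_weight a b t"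
  by (cases "t = 1 \<or> t = -1")
    (auto simp: jacobi_weight_def powr_add power2_eq_square algebra_simps)

lemma borel_measurable_lebesgue_on:
  "f \<in> borel_measurable borel \<Longrightarrow> (f :: real \<Rightarrow> real) \<in> borel_measurable (lebesgue_on S)"
  by (intro measurable_restrict_space1 measurable_completion) auto

lemma jacobi_weight_borel [measurable]: "jacobi_weight a b \<in> borel_measurable borel"
  unfolding jacobi_weight_def by measurable

text \<open>
  An affine substitution turns the weight into the integrand of the Beta function.
\<close>

lemma absolutely_integrable_jacobi_weight:
  assumes "a > -1" "b > -1"
  shows "jacobi_weight a b absolutely_integrable_on {-1..1}"
proof (rule nonnegative_absolutely_integrable_1)
  have "((\<lambda>t. t powr ((b + 1) - 1) * (1 - t) powr ((a + 1) - 1)) has_integral Beta (b + 1) (a + 1)) (cbox 0 1)"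
    using has_integral_Beta_real[of "b + 1" "a + 1"] assms by simp
  from has_integral_affinity'[OF this, of "1/2" "1/2"]
  have "(\<lambda>t. ((t + 1) / 2) powr b * (1 - (t + 1) / 2) powr a) integrable_on {-1..1}"
    by (auto simp: integrable_on_def field_simps)
  then have "(\<lambda>t. 2 powr a * 2 powr b * (((t + 1) / 2) powr b * (1 - (t + 1) / 2) powr a)) integrable_on {-1..1}"
    by (intro integrable_on_mult_right)
  moreover have "2 powr a * 2 powr b * (((t + 1) / 2) powr b * (1 - (t + 1) / 2) powr a) = jacobi_weight a b t"
    if "t \<in> {-1..1}" for t
  proof -
    have "1 - (t + 1) / 2 = (1 - t) / 2"
      by (simp add: field_simps)
    then show ?thesis
      using that unfolding jacobi_weight_def by (simp only:) (simp add: powr_divide add.commute)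
  qed
  ultimately show "jacobi_weight a b integrable_on {-1..1}"
    by (rule integrable_eq)
qed (rule jacobi_weight_nonneg)

definition jacobi_measure :: "real \<Rightarrow> real \<Rightarrow> real measure" where
  "jacobi_measure a b = density (lebesgue_on {-1<..<1}) (\<lambda>t. ennreal (jacobi_weight a b t))"

lemma sets_jacobi_measure [measurable_cong]: "sets (jacobi_measure a b) = sets (lebesgue_on {-1<..<1})"
  and space_jacobi_measure: "space (jacobi_measure a b) = {-1<..<1}"
  by (simp_all add: jacobi_measure_def)

lemma measurable_jacobi_measure:
  "f \<in> borel_measurable (jacobi_measure a b) \<longleftrightarrow> f \<in> borel_measurable (lebesgue_on {-1<..<1})"
  by (simp cong: measurable_cong_sets add: sets_jacobi_measure)

lemma
  assumes f: "f \<in> borel_measurable (lebesgue_on {-1<..<1})"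
  shows integrable_jacobi_measure:
      "integrable (jacobi_measure a b) f \<longleftrightarrow> integrable (lebesgue_on {-1<..<1}) (\<lambda>t. jacobi_weight a b t * f t)"
    and integral_jacobi_measure:
      "integral\<^sup>L (jacobi_measure a b) f = (\<integral>t. jacobi_weight a b t * f t \<partial>lebesgue_on {-1<..<1})"
  unfolding jacobi_measure_def
  using f borel_measurable_lebesgue_on[OF jacobi_weight_borel]
  by (simp_all add: integrable_density integral_density jacobi_weight_nonneg)

lemma absolutely_integrable_iff_lebesgue_on:
  "S \<in> sets lebesgue \<Longrightarrow> (f :: real \<Rightarrow> real) absolutely_integrable_on S \<longleftrightarrow> integrable (lebesgue_on S) f"
  by (simp add: integrable_restrict_space set_integrable_def)

lemma integral_lebesgue_on_Ioo:
  fixes f :: "real \<Rightarrow> real"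
  assumes "f absolutely_integrable_on {a..b}"
  shows "integrable (lebesgue_on {a<..<b}) f" "integral\<^sup>L (lebesgue_on {a<..<b}) f = integral {a..b} f"
proof -
  have i: "integrable (lebesgue_on {a<..<b}) f"
    using assms by (simp add: absolutely_integrable_on_Icc_iff_Ioo absolutely_integrable_iff_lebesgue_on)
  then show "integrable (lebesgue_on {a<..<b}) f" .
  have "integral\<^sup>L (lebesgue_on {a<..<b}) f = integral {a<..<b} f"
    using i by (intro lebesgue_integral_eq_integral) auto
  then show "integral\<^sup>L (lebesgue_on {a<..<b}) f = integral {a..b} f"
    by (simp add: integral_open_interval_real)
qed

lemma AE_jacobi_measure:
  "(AE t in jacobi_measure a b. Q t) \<longleftrightarrow> (AE t in lebesgue_on {-1<..<1}. Q t)"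
proof -
  have "(\<lambda>t. ennreal (jacobi_weight a b t)) \<in> borel_measurable (lebesgue_on {-1<..<1})"
    using borel_measurable_lebesgue_on[OF jacobi_weight_borel] by (rule measurable_compose) simp
  then show ?thesis
    unfolding jacobi_measure_def by (subst AE_density) (auto simp: jacobi_weight_pos intro!: AE_cong)
qed

lemma finite_measure_jacobi:
  assumes "a > -1" "b > -1"
  shows "finite_measure (jacobi_measure a b)"
proof (rule finite_measureI)
  have "integrable (jacobi_measure a b) (\<lambda>t. 1 :: real)"
    using integral_lebesgue_on_Ioo(1)[OF absolutely_integrable_jacobi_weight[OF assms]]
    by (simp add: integrable_jacobi_measure)
  then show "emeasure (jacobi_measure a b) (space (jacobi_measure a b)) \<noteq> \<infinity>"
    by (simp add: integrable_iff_bounded less_top)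
qed

lemma integrable_jacobi_bounded:
  fixes f :: "real \<Rightarrow> real"
  assumes "a > -1" "b > -1" "f \<in> borel_measurable (lebesgue_on {-1<..<1})"
    and "\<And>t. t \<in> {-1<..<1} \<Longrightarrow> \<bar>f t\<bar> \<le> B"
  shows "integrable (jacobi_measure a b) f"
proof -
  interpret finite_measure "jacobi_measure a b"
    by (rule finite_measure_jacobi[OF assms(1,2)])
  show ?thesis
    using assms(3,4)
    by (intro integrable_const_bound[where B = B])
      (auto simp: measurable_jacobi_measure space_jacobi_measure intro!: AE_I2)
qed

lemma measurable_continuous_Icc:
  "continuous_on {-1..1} (f :: real \<Rightarrow> real) \<Longrightarrow> f \<in> borel_measurable (lebesgue_on {-1<..<1})"
  by (rule continuous_imp_measurable_on_sets_lebesgue) (auto intro: continuous_on_subset)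

lemma square_integrable_jacobi_continuous:
  assumes "a > -1" "b > -1" "continuous_on {-1..1} f"
  shows "square_integrable (jacobi_measure a b) f"
  unfolding square_integrable_def
proof
  show "f \<in> borel_measurable (jacobi_measure a b)"
    using assms(3) by (simp add: measurable_jacobi_measure measurable_continuous_Icc)
  have c: "continuous_on {-1..1} (\<lambda>t. (f t)\<^sup>2)"
    by (intro continuous_intros assms)
  then have "compact ((\<lambda>t. (f t)\<^sup>2) ` {-1..1})"
    by (intro compact_continuous_image) auto
  then obtain B where "\<And>t. t \<in> {-1..1} \<Longrightarrow> \<bar>(f t)\<^sup>2\<bar> \<le> B"
    using compact_imp_bounded[THEN bounded_iff[THEN iffD1]] by fastforce
  then show "integrable (jacobi_measure a b) (\<lambda>t. (f t)\<^sup>2)"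
    using c assms(1,2) by (intro integrable_jacobi_bounded[where B = B] measurable_continuous_Icc) auto
qed

lemma integral_jacobi_Suc:
  assumes "f \<in> borel_measurable (lebesgue_on {-1<..<1})"
  shows "integral\<^sup>L (jacobi_measure (a + 1) (b + 1)) f = (\<integral>t. (1 - t\<^sup>2) * f t \<partial>jacobi_measure a b)"
proof -
  have "(\<lambda>t. (1 - t\<^sup>2) * f t) \<in> borel_measurable (lebesgue_on {-1<..<1})"
    by (rule borel_measurable_times[OF borel_measurable_lebesgue_on assms]) simp
  then show ?thesis
    using assms by (auto simp: integral_jacobi_measure jacobi_weight_Suc mult_ac intro!: Bochner_Integration.integral_cong)
qed

lemma square_integrable_jacobi_Suc:
  assumes "square_integrable (jacobi_measure a b) f"
  shows "square_integrable (jacobi_measure (a + 1) (b + 1)) f"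
    and "sqnorm (jacobi_measure (a + 1) (b + 1)) f \<le> sqnorm (jacobi_measure a b) f"
proof -
  have f: "f \<in> borel_measurable (lebesgue_on {-1<..<1})"
    using assms by (simp add: square_integrable_def measurable_jacobi_measure)
  then have f2: "(\<lambda>t. (f t)\<^sup>2) \<in> borel_measurable (lebesgue_on {-1<..<1})"
    by measurable
  have i: "integrable (jacobi_measure a b) (\<lambda>t. (f t)\<^sup>2)"
    using assms by (simp add: square_integrable_def)
  have [measurable]: "(\<lambda>t. 1 - t\<^sup>2 :: real) \<in> borel_measurable (lebesgue_on {-1<..<1})"
    by (intro borel_measurable_lebesgue_on) auto
  have 01: "0 \<le> 1 - t\<^sup>2" "1 - t\<^sup>2 \<le> 1" if "t \<in> {-1<..<1}" for t :: real
    using that by (auto simp: abs_square_le_1 abs_le_iff)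
  have *: "integrable (jacobi_measure a b) (\<lambda>t. (1 - t\<^sup>2) * (f t)\<^sup>2)"
    using i by (rule Bochner_Integration.integrable_bound)
      (use f 01 in \<open>auto simp: measurable_jacobi_measure space_jacobi_measure abs_mult
        intro!: AE_I2 mult_left_le_one_le\<close>)
  have eq: "jacobi_weight (a + 1) (b + 1) t * (f t)\<^sup>2 = jacobi_weight a b t * ((1 - t\<^sup>2) * (f t)\<^sup>2)"
    if "t \<in> {-1<..<1}" for t
    using that by (simp add: jacobi_weight_Suc)
  have "integrable (lebesgue_on {-1<..<1}) (\<lambda>t. jacobi_weight (a + 1) (b + 1) t * (f t)\<^sup>2)
      \<longleftrightarrow> integrable (lebesgue_on {-1<..<1}) (\<lambda>t. jacobi_weight a b t * ((1 - t\<^sup>2) * (f t)\<^sup>2))"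
    by (rule Bochner_Integration.integrable_cong) (auto simp: eq)
  also have "\<dots>"
    using * f by (subst (asm) integrable_jacobi_measure) auto
  finally show "square_integrable (jacobi_measure (a + 1) (b + 1)) f"
    using f f2 by (simp add: square_integrable_def measurable_jacobi_measure integrable_jacobi_measure)
  show "sqnorm (jacobi_measure (a + 1) (b + 1)) f \<le> sqnorm (jacobi_measure a b) f"
    unfolding sqnorm_def integral_jacobi_Suc[OF f2]
    using 01 by (intro integral_mono * i) (auto simp: space_jacobi_measure intro!: mult_left_le_one_le)
qed

section \<open>Orthogonality of Jacobi polynomials\<close>

text \<open>
  The derivative of \<open>W q\<close>, where both exponents of the weight \<open>W\<close> are raised by one, is the original
  weight times this polynomial.  Its negative is therefore the adjoint of \<open>d/dt\<close> between the two weighted spaces.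
\<close>

definition jacobi_adjoint :: "real \<Rightarrow> real \<Rightarrow> real poly \<Rightarrow> real poly" where
  "jacobi_adjoint a b q = [:1, 0, -1:] * pderiv q + [:b - a, -(a + b + 2):] * q"

lemma poly_jacobi_adjoint:
  "poly (jacobi_adjoint a b q) t
     = (1 - t\<^sup>2) * poly (pderiv q) t + ((b + 1) * (1 - t) - (a + 1) * (1 + t)) * poly q t"
  by (simp add: jacobi_adjoint_def power2_eq_square algebra_simps)

text \<open>
  The factor \<open>n + a + b + 2\<close> is positive for exponents above \<open>-1\<close>.  It yields the exact degree of the
  Jacobi polynomials and, later, their eigenvalues.
\<close>

lemma coeff_jacobi_adjoint:
  assumes "q \<in> polys_below (Suc n)"
  shows "coeff (jacobi_adjoint a b q) (Suc n) = - (real n + a + b + 2) * coeff q n"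
    and "jacobi_adjoint a b q \<in> polys_below (Suc (Suc n))"
proof -
  have c: "coeff q (Suc n) = 0" "coeff q (Suc (Suc n)) = 0"
    using assms by (auto simp: polys_below_def)
  then show "coeff (jacobi_adjoint a b q) (Suc n) = - (real n + a + b + 2) * coeff q n"
    by (cases n) (simp_all add: jacobi_adjoint_def coeff_pCons coeff_pderiv algebra_simps)
  have "[:b - a, -(a + b + 2):] * q \<in> polys_below (Suc n + 1)"
    using assms by (intro polys_below_mult) auto
  moreover have "[:1, 0, -1:] * pderiv q \<in> polys_below (n + 2)"
    using polys_below_pderiv[OF assms] by (intro polys_below_mult) auto
  ultimately show "jacobi_adjoint a b q \<in> polys_below (Suc (Suc n))"
    unfolding jacobi_adjoint_def by (intro polys_below_add) auto
qed

lemma jacobi_weighted_poly_deriv: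
  assumes t: "t \<in> {-1<..<1}"
  shows "((\<lambda>t. jacobi_weight (a + 1) (b + 1) t * poly q t) has_real_derivative
            jacobi_weight a b t * poly (jacobi_adjoint a b q) t) (at t)"
proof -
  have t': "1 - t > 0" "1 + t > 0"
    using t by auto
  have "((\<lambda>t. (1 - t) powr (a + 1) * (1 + t) powr (b + 1) * poly q t) has_real_derivative
      (- ((a + 1) * (1 - t) powr a) * (1 + t) powr (b + 1)
        + (b + 1) * (1 + t) powr b * (1 - t) powr (a + 1)) * poly q t
      + poly (pderiv q) t * ((1 - t) powr (a + 1) * (1 + t) powr (b + 1))) (at t)"
    using t' by (auto intro!: derivative_eq_intros poly_DERIV simp: algebra_simps)
  moreover have "(- ((a + 1) * (1 - t) powr a) * (1 + t) powr (b + 1)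
        + (b + 1) * (1 + t) powr b * (1 - t) powr (a + 1)) * poly q t
      + poly (pderiv q) t * ((1 - t) powr (a + 1) * (1 + t) powr (b + 1))
      = jacobi_weight a b t * poly (jacobi_adjoint a b q) t"
    using t' by (simp add: poly_jacobi_adjoint jacobi_weight_def powr_add power2_eq_square algebra_simps)
  ultimately show ?thesis
    unfolding jacobi_weight_def by simp
qed

text \<open>
  The boundary terms vanish because \<open>f\<close> is bounded and the raised exponents are positive.
\<close>

lemma jacobi_integral_by_parts:
  assumes ab: "a > -1" "b > -1" and f: "ac_deriv (-1) 1 f g"
  shows "(\<integral>t. g t * poly q t \<partial>jacobi_measure (a + 1) (b + 1))
       = - (\<integral>t. f t * poly (jacobi_adjoint a b q) t \<partial>jacobi_measure a b)"
proof -
  let ?W = "\<lambda>t. jacobi_weight (a + 1) (b + 1) t * poly q t"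
  let ?W' = "\<lambda>t. jacobi_weight a b t * poly (jacobi_adjoint a b q) t"
  have cf: "continuous_on {-1..1} f"
    by (rule ac_deriv_continuous_on[OF f])
  have cW: "continuous_on {-1..1} ?W"
    unfolding jacobi_weight_def using ab by (intro continuous_intros continuous_on_powr') auto
  have W'i: "?W' absolutely_integrable_on {-1..1}"
    using absolutely_integrable_mult_continuous[OF _ absolutely_integrable_jacobi_weight[OF ab],
        of "poly (jacobi_adjoint a b q)"]
    by (simp add: mult.commute continuous_on_poly)
  have W: "ac_deriv (-1) 1 ?W ?W'"
    using cW jacobi_weighted_poly_deriv W'i by (intro ac_derivI) auto
  have gi: "g absolutely_integrable_on {-1..1}"
    by (rule ac_deriv_integrable[OF f])
  have gm: "g \<in> borel_measurable (lebesgue_on {-1<..<1})"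
    using integral_lebesgue_on_Ioo(1)[OF gi] by auto
  have pm: "poly p \<in> borel_measurable (lebesgue_on {-1<..<1})" for p :: "real poly"
    by (intro measurable_continuous_Icc continuous_intros)
  have "(\<integral>t. g t * poly q t \<partial>jacobi_measure (a + 1) (b + 1)) = integral {-1..1} (\<lambda>t. ?W t * g t)"
    using gm pm integral_lebesgue_on_Ioo(2)[OF absolutely_integrable_mult_continuous[OF cW gi]]
    by (simp add: integral_jacobi_measure mult_ac)
  moreover have "(\<integral>t. f t * poly (jacobi_adjoint a b q) t \<partial>jacobi_measure a b)
      = integral {-1..1} (\<lambda>t. f t * ?W' t)"
    using measurable_continuous_Icc[OF cf] pm
      integral_lebesgue_on_Ioo(2)[OF absolutely_integrable_mult_continuous[OF cf W'i]]
    by (simp add: integral_jacobi_measure mult_ac)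
  moreover have "jacobi_weight (a + 1) (b + 1) 1 = 0" "jacobi_weight (a + 1) (b + 1) (-1) = 0"
    using ab by (auto simp: jacobi_weight_def)
  then have "integral {-1..1} (\<lambda>t. f t * ?W' t) + integral {-1..1} (\<lambda>t. ?W t * g t) = 0"
    using ac_deriv_by_parts[OF _ f W] by (simp add: mult_ac)
  ultimately show ?thesis
    by linarith
qed

lemma ac_deriv_poly: "ac_deriv (-1) 1 (poly p) (poly (pderiv p))"
  by (rule ac_derivI)
    (auto intro!: continuous_intros absolutely_integrable_continuous_real poly_DERIV)

definition jacobi_poly :: "real \<Rightarrow> real \<Rightarrow> nat \<Rightarrow> real poly" where
  "jacobi_poly a b m = (\<Sum>s\<le>m. smult (((real m + a) gchoose (m - s)) * ((real m + b) gchoose s))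
      ([:-1/2, 1/2:] ^ s * [:1/2, 1/2:] ^ (m - s)))"

lemma poly_jacobi_poly: "poly (jacobi_poly a b m) t = jacobi_P a b m t"
proof -
  have "poly [:-1/2, 1/2:] t = (t - 1) / 2" "poly [:1/2, 1/2:] t = (t + 1) / 2"
    by (auto simp: field_simps)
  then show ?thesis
    unfolding jacobi_poly_def jacobi_P_def
    by (simp only: poly_sum poly_smult poly_mult poly_power mult.assoc)
qed

lemma jacobi_adjoint_add: "jacobi_adjoint a b (p + q) = jacobi_adjoint a b p + jacobi_adjoint a b q"
  unfolding jacobi_adjoint_def pderiv_add distrib_left by (simp only: ac_simps)

lemma jacobi_adjoint_smult: "jacobi_adjoint a b (smult c p) = smult c (jacobi_adjoint a b p)"
  unfolding jacobi_adjoint_def pderiv_smult mult_smult_right smult_add_right ..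

lemma jacobi_adjoint_sum:
  "jacobi_adjoint a b (\<Sum>i\<in>A. smult (c i) (p i)) = (\<Sum>i\<in>A. smult (c i) (jacobi_adjoint a b (p i)))"
proof (induction A rule: infinite_finite_induct)
  case (insert i A)
  then show ?case
    by (simp add: jacobi_adjoint_add jacobi_adjoint_smult)
qed (simp_all add: jacobi_adjoint_def)

lemma smult_sum_right: "smult c (\<Sum>i\<in>A. p i) = (\<Sum>i\<in>A. smult c (p i))"
  by (induction A rule: infinite_finite_induct) (simp_all add: smult_add_right)

text \<open>
  In terms of \<open>X = (t - 1) / 2\<close> and \<open>Y = (t + 1) / 2\<close> one has \<open>1 - t\<^sup>2 = - 4 X Y\<close>, \<open>Y - X = 1\<close> and \<open>X + Y = t\<close>.
  This makes the operator homogeneous, so that it acts on the monomials of the explicit formula for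
  Jacobi polynomials by shifting them.
\<close>

lemma jacobi_adjoint_monomial:
  fixes X Y :: "real poly"
  defines "X \<equiv> [:-1/2, 1/2:]" and "Y \<equiv> [:1/2, 1/2:]"
  shows "jacobi_adjoint a b (X ^ i * Y ^ j)
     = smult (-2) (smult (real i + a + 1) (X ^ i * Y ^ Suc j) + smult (real j + b + 1) (X ^ Suc i * Y ^ j))"
proof -
  have dX: "pderiv X = [:1/2:]" and dY: "pderiv Y = [:1/2:]"
    by (simp_all add: X_def Y_def pderiv_pCons)
  have XY: "[:1, 0, -1:] = smult (-4) (X * Y)" "[:b - a, -(a + b + 2):] = smult (-2) (smult (a + 1) Y + smult (b + 1) X)"
    by (simp_all add: X_def Y_def field_simps)
  have pX: "X * pderiv (X ^ i) = smult (real i / 2) (X ^ i)"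
  proof (cases i)
    case (Suc n)
    show ?thesis
      unfolding Suc pderiv_power dX by (simp add: mult_ac del: of_nat_Suc)
  qed simp
  have pY: "Y * pderiv (Y ^ j) = smult (real j / 2) (Y ^ j)"
  proof (cases j)
    case (Suc n)
    show ?thesis
      unfolding Suc pderiv_power dY by (simp add: mult_ac del: of_nat_Suc)
  qed simp
  have "[:1, 0, -1:] * pderiv (X ^ i * Y ^ j)
      = smult (-4) ((X * pderiv (X ^ i)) * (Y * Y ^ j) + (X * X ^ i) * (Y * pderiv (Y ^ j)))"
    unfolding XY pderiv_mult by (simp add: algebra_simps smult_add_right)
  also have "\<dots> = smult (-2) (smult (real i) (X ^ i * Y ^ Suc j) + smult (real j) (X ^ Suc i * Y ^ j))"
    unfolding pX pY by (simp add: smult_add_right)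
  finally have "[:1, 0, -1:] * pderiv (X ^ i * Y ^ j)
      = smult (-2) (smult (real i) (X ^ i * Y ^ Suc j) + smult (real j) (X ^ Suc i * Y ^ j))" .
  then show ?thesis
    unfolding jacobi_adjoint_def XY(2) by (simp add: smult_add_left smult_add_right algebra_simps)
qed

text \<open>
  One step of the Rodrigues formula.  After the shift, the two contributions to a monomial carry the
  factors \<open>Suc n - s\<close> and \<open>s\<close> times the same product of binomial coefficients, so they add up to \<open>Suc n\<close> times it.
\<close>

lemma jacobi_adjoint_jacobi_poly:
  "jacobi_adjoint a b (jacobi_poly (a + 1) (b + 1) n) = smult (-2 * real (Suc n)) (jacobi_poly a b (Suc n))"
proof -
  define X Y :: "real poly" where "X = [:-1/2, 1/2:]" and "Y = [:1/2, 1/2:]"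
  define A B where "A = real n + 1 + a" and "B = real n + 1 + b"
  define f where "f s = (A gchoose (Suc n - s)) * (B gchoose s)" for s
  define e where "e s = X ^ s * Y ^ (Suc n - s)" for s
  define g where "g s = (A gchoose (n - s)) * (B gchoose s)" for s
  have g1: "(real s + a + 1) * g s = real (Suc n - s) * f s" if "s \<le> n" for s
  proof -
    have "A * (A gchoose (n - s)) = real (n - s) * (A gchoose (n - s)) + real (Suc (n - s)) * (A gchoose (Suc (n - s)))"
      by (rule gbinomial_mult_1)
    then have "(real s + a + 1) * (A gchoose (n - s)) = real (Suc n - s) * (A gchoose (Suc n - s))"
      using that by (simp add: A_def Suc_diff_le of_nat_diff algebra_simps)
    then show ?thesis
      by (simp add: f_def g_def)
  qed
  have g2: "(real (n - s) + b + 1) * g s = real (Suc s) * f (Suc s)" if "s \<le> n" for s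
  proof -
    have "B * (B gchoose s) = real s * (B gchoose s) + real (Suc s) * (B gchoose (Suc s))"
      by (rule gbinomial_mult_1)
    then have "(real (n - s) + b + 1) * (B gchoose s) = real (Suc s) * (B gchoose (Suc s))"
      using that by (simp add: B_def of_nat_diff algebra_simps)
    then show ?thesis
      by (simp add: f_def g_def)
  qed
  have "jacobi_adjoint a b (jacobi_poly (a + 1) (b + 1) n)
      = (\<Sum>s\<le>n. smult (g s) (jacobi_adjoint a b (X ^ s * Y ^ (n - s))))"
    unfolding jacobi_poly_def by (simp add: jacobi_adjoint_sum g_def A_def B_def X_def Y_def add_ac)
  also have "\<dots> = (\<Sum>s\<le>n. smult (-2) (smult ((real s + a + 1) * g s) (e s)
                                   + smult ((real (n - s) + b + 1) * g s) (e (Suc s))))"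
    unfolding X_def Y_def jacobi_adjoint_monomial
    by (intro sum.cong) (auto simp: e_def X_def Y_def Suc_diff_le smult_add_right mult_ac)
  also have "\<dots> = smult (-2) ((\<Sum>s\<le>n. smult (real (Suc n - s) * f s) (e s))
                         + (\<Sum>s\<le>n. smult (real (Suc s) * f (Suc s)) (e (Suc s))))"
    unfolding sum.distrib[symmetric] smult_sum_right
    by (intro sum.cong refl) (simp only: g1 g2 atMost_iff)
  also have "(\<Sum>s\<le>n. smult (real (Suc n - s) * f s) (e s)) = (\<Sum>s\<le>Suc n. smult (real (Suc n - s) * f s) (e s))"
    by simp
  also have "(\<Sum>s\<le>n. smult (real (Suc s) * f (Suc s)) (e (Suc s))) = (\<Sum>s\<le>Suc n. smult (real s * f s) (e s))"
    by (subst sum.atMost_Suc_shift) simp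
  also have "(\<Sum>s\<le>Suc n. smult (real (Suc n - s) * f s) (e s)) + (\<Sum>s\<le>Suc n. smult (real s * f s) (e s))
      = (\<Sum>s\<le>Suc n. smult (real (Suc n) * f s) (e s))"
    unfolding sum.distrib[symmetric]
    by (intro sum.cong) (auto simp: of_nat_diff smult_add_left[symmetric] algebra_simps simp del: of_nat_Suc)
  also have "\<dots> = smult (real (Suc n)) (jacobi_poly a b (Suc n))"
    unfolding jacobi_poly_def smult_sum_right
    by (intro sum.cong) (auto simp: f_def e_def A_def B_def X_def Y_def add_ac)
  finally show ?thesis
    by (simp del: of_nat_Suc)
qed

lemma jacobi_poly_Suc:
  "jacobi_poly a b (Suc n) = smult (-1 / (2 * real (Suc n))) (jacobi_adjoint a b (jacobi_poly (a + 1) (b + 1) n))"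
  unfolding jacobi_adjoint_jacobi_poly by (simp del: of_nat_Suc)

lemma jacobi_poly_degree_aux:
  assumes "a > -1" "b > -1"
  shows "jacobi_poly a b m \<in> polys_below (Suc m) \<and> coeff (jacobi_poly a b m) m \<noteq> 0"
  using assms
proof (induction m arbitrary: a b)
  case 0
  then show ?case
    by (simp add: jacobi_poly_def polys_below_iff)
next
  case (Suc n)
  then have IH: "jacobi_poly (a + 1) (b + 1) n \<in> polys_below (Suc n)"
      "coeff (jacobi_poly (a + 1) (b + 1) n) n \<noteq> 0"
    by auto
  show ?case
    unfolding jacobi_poly_Suc
    by (intro conjI polys_below_smult coeff_jacobi_adjoint[OF IH(1)])
      (use coeff_jacobi_adjoint(1)[OF IH(1), of a b] IH(2) Suc.prems in auto)
qed

lemma degree_jacobi_poly: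
  assumes "a > -1" "b > -1"
  shows "degree (jacobi_poly a b m) = m" "jacobi_poly a b m \<noteq> 0"
  using jacobi_poly_degree_aux[OF assms, of m] le_degree[of "jacobi_poly a b m" m]
  by (auto simp: polys_below_Suc)

lemma integrable_jacobi_poly:
  assumes "a > -1" "b > -1" "continuous_on {-1..1} f"
  shows "integrable (jacobi_measure a b) (\<lambda>t. f t * poly p t)"
  using assms by (intro square_integrable_mult square_integrable_jacobi_continuous continuous_intros) auto

text \<open>
  Every Rodrigues step moves one derivative to the other factor and raises both exponents, until this
  factor is zero.
\<close>

lemma jacobi_poly_orthogonal:
  assumes "a > -1" "b > -1" "q \<in> polys_below m"
  shows "(\<integral>t. poly q t * poly (jacobi_poly a b m) t \<partial>jacobi_measure a b) = 0"
  using assms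
proof (induction m arbitrary: a b q)
  case 0
  then show ?case
    by (simp add: polys_below_0)
next
  case (Suc n)
  have "(\<integral>t. poly (pderiv q) t * poly (jacobi_poly (a + 1) (b + 1) n) t \<partial>jacobi_measure (a + 1) (b + 1)) = 0"
    using Suc.prems polys_below_pderiv[of q "Suc n"] by (intro Suc.IH) auto
  then have "(\<integral>t. poly q t * poly (jacobi_adjoint a b (jacobi_poly (a + 1) (b + 1) n)) t \<partial>jacobi_measure a b) = 0"
    using jacobi_integral_by_parts[OF Suc.prems(1,2) ac_deriv_poly] by simp
  then show ?case
    unfolding jacobi_poly_Suc by simp
qed

text \<open>
  A polynomial of norm zero vanishes almost everywhere on an interval, hence at infinitely many points.
\<close>

lemma sqnorm_jacobi_poly_pos:
  assumes "a > -1" "b > -1" "p \<noteq> 0"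
  shows "0 < sqnorm (jacobi_measure a b) (poly p)"
proof (rule ccontr)
  assume "\<not> ?thesis"
  then have "sqnorm (jacobi_measure a b) (poly p) = 0"
    using sqnorm_nonneg[of "jacobi_measure a b" "poly p"] by linarith
  moreover have "square_integrable (jacobi_measure a b) (poly p)"
    using assms by (intro square_integrable_jacobi_continuous continuous_intros)
  ultimately have "AE t in jacobi_measure a b. (poly p t)\<^sup>2 = 0"
    unfolding sqnorm_def square_integrable_def by (subst (asm) integral_nonneg_eq_0_iff_AE) auto
  then have "AE t in lebesgue_on {-1<..<1}. poly p t = 0"
    by (simp add: AE_jacobi_measure)
  moreover have "AE t in lebesgue_on {-1<..<1}. poly p t \<noteq> 0"
  proof -
    have "negligible {t. poly p t = 0}"
      using poly_roots_finite[OF assms(3)] by (rule negligible_finite)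
    then have "AE t in lebesgue. t \<notin> {t. poly p t = 0}"
      by (intro AE_not_in) (simp add: negligible_iff_null_sets)
    then have "AE t in lebesgue. poly p t \<noteq> 0"
      by simp
    then show ?thesis
      by (subst AE_restrict_space_iff) auto
  qed
  ultimately have "AE t in lebesgue_on {-1<..<1::real}. False"
    by eventually_elim simp
  then have "AE t in lebesgue. t \<notin> {-1<..<1::real}"
    by (subst (asm) AE_restrict_space_iff) auto
  then have "{-1<..<1::real} \<in> null_sets lebesgue"
    by (subst AE_iff_null_sets) auto
  then have "emeasure lebesgue {-1<..<1::real} = 0"
    by (rule null_setsD1)
  then show False
    by simp
qed

lemma orthogonal_polynomials_jacobi:
  assumes "a > -1" "b > -1"
  shows "orthogonal_polynomials (jacobi_measure a b) (jacobi_poly a b)"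
proof
  show "integrable (jacobi_measure a b) (poly p)" for p
    using integrable_jacobi_poly[OF assms, of "\<lambda>_. 1" p] by simp
  show "(\<integral>x. poly (jacobi_poly a b m) x * poly (jacobi_poly a b n) x \<partial>jacobi_measure a b) = 0"
    if "m \<noteq> n" for m n
  proof (cases "m < n")
    case True
    then show ?thesis
      using degree_jacobi_poly[OF assms, of m] by (intro jacobi_poly_orthogonal assms) (simp add: polys_below_iff)
  next
    case False
    then have "(\<integral>x. poly (jacobi_poly a b n) x * poly (jacobi_poly a b m) x \<partial>jacobi_measure a b) = 0"
      using degree_jacobi_poly[OF assms, of n] that by (intro jacobi_poly_orthogonal assms) (simp add: polys_below_iff)
    then show ?thesis
      by (simp add: mult.commute)
  qed
qed (use assms in \<open>simp_all add: degree_jacobi_poly sqnorm_jacobi_poly_pos\<close>)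

section \<open>Spectral gap of the Jacobi operator\<close>

abbreviation jacobi_proj :: "real \<Rightarrow> real \<Rightarrow> nat \<Rightarrow> (real \<Rightarrow> real) \<Rightarrow> real poly" where
  "jacobi_proj a b \<equiv> orthogonal_polynomials.proj (jacobi_measure a b) (jacobi_poly a b)"

abbreviation jacobi_sqnorm :: "real \<Rightarrow> real \<Rightarrow> (real \<Rightarrow> real) \<Rightarrow> real" where
  "jacobi_sqnorm a b \<equiv> sqnorm (jacobi_measure a b)"

definition jacobi_eigenvalue :: "real \<Rightarrow> real \<Rightarrow> nat \<Rightarrow> real" where
  "jacobi_eigenvalue a b m = real m * (real m + a + b + 1)"

lemma polys_below_jacobi_adjoint:
  assumes "q \<in> polys_below n"
  shows "jacobi_adjoint a b q \<in> polys_below (Suc n)"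
proof (cases n)
  case 0
  then have "q = 0"
    using assms by (simp add: polys_below_0)
  then show ?thesis
    by (simp add: jacobi_adjoint_def polys_below_def)
next
  case (Suc m)
  then show ?thesis
    using assms coeff_jacobi_adjoint(2)[of q m] by simp
qed

text \<open>
  The adjoint of \<open>d/dt\<close> maps polynomials of degree below \<open>n - 1\<close> to polynomials of degree below \<open>n\<close>, to which
  the error \<open>f - \<Pi>\<^sub>n f\<close> is orthogonal.
\<close>

lemma pderiv_jacobi_proj:
  assumes ab: "a > -1" "b > -1" and fg: "ac_deriv (-1) 1 f g"
    and g: "square_integrable (jacobi_measure (a + 1) (b + 1)) g"
  shows "pderiv (jacobi_proj a b n f) = jacobi_proj (a + 1) (b + 1) (n - 1) g"
proof -
  interpret J: orthogonal_polynomials "jacobi_measure a b" "jacobi_poly a b"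
    using ab by (rule orthogonal_polynomials_jacobi)
  interpret J1: orthogonal_polynomials "jacobi_measure (a + 1) (b + 1)" "jacobi_poly (a + 1) (b + 1)"
    using ab by (intro orthogonal_polynomials_jacobi) auto
  let ?p = "jacobi_proj a b n f"
  have f: "square_integrable (jacobi_measure a b) f"
    by (intro square_integrable_jacobi_continuous ab ac_deriv_continuous_on[OF fg])
  have "J1.proj (n - 1) g = pderiv ?p"
  proof (rule J1.proj_unique[OF g])
    show "pderiv ?p \<in> polys_below (n - 1)"
      by (intro polys_below_pderiv J.proj_in_polys_below)
    fix q assume q: "q \<in> polys_below (n - 1)"
    have "jacobi_adjoint a b q \<in> polys_below n"
    proof (cases n)
      case 0
      then have "q = 0"
        using q by (simp add: polys_below_0)
      then show ?thesis
        by (simp add: jacobi_adjoint_def polys_below_def)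
    next
      case (Suc m)
      then show ?thesis
        using polys_below_jacobi_adjoint[OF q] by simp
    qed
    then show "(\<integral>x. (g x - poly (pderiv ?p) x) * poly q x \<partial>jacobi_measure (a + 1) (b + 1)) = 0"
      using J.proj_orthogonal[OF f]
      by (subst jacobi_integral_by_parts[OF ab ac_deriv_diff[OF fg ac_deriv_poly]]) simp
  qed
  then show ?thesis
    by simp
qed

text \<open>
  The difference \<open>r\<close> of the two sides has lower degree than the Jacobi polynomial, by comparison of leading coefficients,
  and it is orthogonal to all polynomials of lower degree, because the operator is symmetric and does not raise the degree.
  Hence it is orthogonal to itself.
\<close>

lemma jacobi_differential_equation:
  assumes ab: "a > -1" "b > -1"
  shows "jacobi_adjoint a b (pderiv (jacobi_poly a b m)) = smult (- jacobi_eigenvalue a b m) (jacobi_poly a b m)"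
proof (cases m)
  case 0
  then show ?thesis
    by (simp add: jacobi_poly_def jacobi_eigenvalue_def jacobi_adjoint_def)
next
  case (Suc k)
  interpret J: orthogonal_polynomials "jacobi_measure a b" "jacobi_poly a b"
    using ab by (rule orthogonal_polynomials_jacobi)
  let ?P = "jacobi_poly a b m"
  let ?L = "jacobi_adjoint a b (pderiv ?P)"
  define r where "r = ?L + smult (jacobi_eigenvalue a b m) ?P"
  have P: "?P \<in> polys_below (Suc m)"
    using degree_jacobi_poly[OF ab] by (simp add: polys_below_Suc)
  then have P': "pderiv ?P \<in> polys_below (Suc k)"
    using polys_below_pderiv[of ?P "Suc m"] Suc by simp
  note L = coeff_jacobi_adjoint[OF P', of a b]
  have "coeff r m = 0"
    using L(1) Suc by (simp add: r_def coeff_pderiv jacobi_eigenvalue_def algebra_simps)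
  moreover have "r \<in> polys_below (Suc m)"
    unfolding r_def using L(2) P Suc by (intro polys_below_add polys_below_smult) auto
  ultimately have r: "r \<in> polys_below m"
    by (auto simp: polys_below_def Suc_le_eq dest!: le_imp_less_or_eq)
  have "(\<integral>x. poly r x * poly ?L x \<partial>jacobi_measure a b)
      = - (\<integral>x. poly (pderiv r) x * poly (pderiv ?P) x \<partial>jacobi_measure (a + 1) (b + 1))"
    using jacobi_integral_by_parts[OF ab ac_deriv_poly] by simp
  also have "\<dots> = - (\<integral>x. poly (pderiv ?P) x * poly (pderiv r) x \<partial>jacobi_measure (a + 1) (b + 1))"
    by (simp add: mult.commute)
  also have "\<dots> = (\<integral>x. poly ?P x * poly (jacobi_adjoint a b (pderiv r)) x \<partial>jacobi_measure a b)"
    using jacobi_integral_by_parts[OF ab ac_deriv_poly] by simp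
  also have "\<dots> = 0"
    using polys_below_jacobi_adjoint[OF polys_below_pderiv[OF r]] Suc by (intro J.orthogonal_polys_below) simp
  finally have 1: "(\<integral>x. poly r x * poly ?L x \<partial>jacobi_measure a b) = 0" .
  have 2: "(\<integral>x. poly r x * poly ?P x \<partial>jacobi_measure a b) = 0"
    using J.orthogonal_polys_below[OF r] by (simp add: mult.commute)
  have i: "integrable (jacobi_measure a b) (\<lambda>x. poly r x * poly q x)" for q
    by (intro J.integrable_mult_poly J.square_integrable_poly)
  have "sqnorm (jacobi_measure a b) (poly r)
      = (\<integral>x. poly r x * poly ?L x + jacobi_eigenvalue a b m * (poly r x * poly ?P x) \<partial>jacobi_measure a b)"
    unfolding sqnorm_def by (intro Bochner_Integration.integral_cong) (auto simp: r_def power2_eq_square algebra_simps)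
  also have "\<dots> = 0"
    using i by (subst Bochner_Integration.integral_add) (auto simp: 1 2)
  finally have "r = 0"
    using J.sqnorm_poly_pos[of r] by force
  then show ?thesis
    by (simp add: r_def eq_neg_iff_add_eq_0)
qed

text \<open>
  By the differential equation the derivatives of the Jacobi polynomials are orthogonal as well, for the raised
  weight; differentiation multiplies the squared norm of each component by its eigenvalue.
\<close>

lemma sqnorm_jacobi_lincomb:
  fixes c :: "nat \<Rightarrow> real" and A :: "nat set"
  assumes ab: "a > -1" "b > -1" and A: "finite A"
  defines "p \<equiv> \<Sum>m\<in>A. smult (c m) (jacobi_poly a b m)"
  shows "jacobi_sqnorm a b (poly p) = (\<Sum>m\<in>A. (c m)\<^sup>2 * jacobi_sqnorm a b (poly (jacobi_poly a b m)))"
    and "jacobi_sqnorm (a + 1) (b + 1) (poly (pderiv p))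
       = (\<Sum>m\<in>A. (c m)\<^sup>2 * jacobi_sqnorm a b (poly (jacobi_poly a b m)) * jacobi_eigenvalue a b m)"
proof -
  interpret J: orthogonal_polynomials "jacobi_measure a b" "jacobi_poly a b"
    using ab by (rule orthogonal_polynomials_jacobi)
  have pP: "(\<integral>x. poly p x * poly (jacobi_poly a b m) x \<partial>jacobi_measure a b)
      = c m * jacobi_sqnorm a b (poly (jacobi_poly a b m))" if "m \<in> A" for m
    using J.integral_P_lincomb[OF A, of m c] that by (simp add: p_def mult.commute)
  have "jacobi_sqnorm a b (poly p) = (\<integral>x. poly p x * poly p x \<partial>jacobi_measure a b)"
    by (simp add: sqnorm_def power2_eq_square)
  also have "\<dots> = (\<Sum>m\<in>A. c m * (\<integral>x. poly p x * poly (jacobi_poly a b m) x \<partial>jacobi_measure a b))"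
    unfolding p_def by (intro J.integral_mult_poly_lincomb J.square_integrable_poly A)
  finally show "jacobi_sqnorm a b (poly p) = (\<Sum>m\<in>A. (c m)\<^sup>2 * jacobi_sqnorm a b (poly (jacobi_poly a b m)))"
    by (simp add: pP power2_eq_square mult.assoc)
  have dp: "jacobi_adjoint a b (pderiv p) = (\<Sum>m\<in>A. smult (- c m * jacobi_eigenvalue a b m) (jacobi_poly a b m))"
  proof -
    have "pderiv p = (\<Sum>m\<in>A. smult (c m) (pderiv (jacobi_poly a b m)))"
      unfolding p_def using A by (induction A) (simp_all add: pderiv_add pderiv_smult)
    then show ?thesis
      by (simp add: jacobi_adjoint_sum jacobi_differential_equation[OF ab])
  qed
  have "jacobi_sqnorm (a + 1) (b + 1) (poly (pderiv p))
      = - (\<integral>x. poly p x * poly (jacobi_adjoint a b (pderiv p)) x \<partial>jacobi_measure a b)"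
    unfolding sqnorm_def power2_eq_square by (rule jacobi_integral_by_parts[OF ab ac_deriv_poly])
  also have "\<dots> = - (\<Sum>m\<in>A. (- c m * jacobi_eigenvalue a b m) *
      (\<integral>x. poly p x * poly (jacobi_poly a b m) x \<partial>jacobi_measure a b))"
    unfolding dp by (subst J.integral_mult_poly_lincomb[OF J.square_integrable_poly A]) simp
  finally show "jacobi_sqnorm (a + 1) (b + 1) (poly (pderiv p))
       = (\<Sum>m\<in>A. (c m)\<^sup>2 * jacobi_sqnorm a b (poly (jacobi_poly a b m)) * jacobi_eigenvalue a b m)"
    by (simp add: pP power2_eq_square sum_negf[symmetric] mult_ac)
qed

lemma jacobi_eigenvalue_mono:
  assumes "a > -1" "b > -1" "m \<le> n"
  shows "jacobi_eigenvalue a b m \<le> jacobi_eigenvalue a b n"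
proof (cases "m = 0")
  case True
  have "0 \<le> real n * (real n + a + b + 1)"
    using assms by (cases n) auto
  then show ?thesis
    using True by (simp add: jacobi_eigenvalue_def)
next
  case False
  then show ?thesis
    using assms unfolding jacobi_eigenvalue_def by (intro mult_mono) auto
qed

lemma jacobi_eigenvalue_nonneg:
  "a > -1 \<Longrightarrow> b > -1 \<Longrightarrow> 0 \<le> jacobi_eigenvalue a b n"
  using jacobi_eigenvalue_mono[of a b 0 n] by (simp add: jacobi_eigenvalue_def)

text \<open>
  The inverse inequality between the weights: components of degree at most \<open>n\<close> have eigenvalue at most that of \<open>n\<close>.
\<close>

lemma sqnorm_pderiv_le_eigenvalue:
  assumes ab: "a > -1" "b > -1" and p: "p \<in> polys_below (Suc n)"
  shows "jacobi_sqnorm (a + 1) (b + 1) (poly (pderiv p)) \<le> jacobi_eigenvalue a b n * jacobi_sqnorm a b (poly p)"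
proof -
  interpret J: orthogonal_polynomials "jacobi_measure a b" "jacobi_poly a b"
    using ab by (rule orthogonal_polynomials_jacobi)
  obtain c where p: "p = (\<Sum>m<Suc n. smult (c m) (jacobi_poly a b m))"
    using J.polys_below_expansion[OF p] by blast
  show ?thesis
    unfolding p sqnorm_jacobi_lincomb[OF ab finite_lessThan] sum_distrib_left
  proof (rule sum_mono)
    fix m assume "m \<in> {..<Suc n}"
    then have "jacobi_eigenvalue a b m \<le> jacobi_eigenvalue a b n"
      using ab by (intro jacobi_eigenvalue_mono) auto
    then show "(c m)\<^sup>2 * jacobi_sqnorm a b (poly (jacobi_poly a b m)) * jacobi_eigenvalue a b m
        \<le> jacobi_eigenvalue a b n * ((c m)\<^sup>2 * jacobi_sqnorm a b (poly (jacobi_poly a b m)))"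
      by (subst mult.commute) (intro mult_right_mono mult_nonneg_nonneg sqnorm_nonneg, auto)
  qed
qed

lemma eigenvalue_le_sqnorm_pderiv:
  fixes c :: "nat \<Rightarrow> real" and n K :: nat
  assumes ab: "a > -1" "b > -1"
  defines "p \<equiv> \<Sum>m=n..<K. smult (c m) (jacobi_poly a b m)"
  shows "jacobi_eigenvalue a b n * jacobi_sqnorm a b (poly p) \<le> jacobi_sqnorm (a + 1) (b + 1) (poly (pderiv p))"
  unfolding p_def sqnorm_jacobi_lincomb[OF ab finite_atLeastLessThan] sum_distrib_left
proof (rule sum_mono)
  fix m assume "m \<in> {n..<K}"
  then have "jacobi_eigenvalue a b n \<le> jacobi_eigenvalue a b m"
    using ab by (intro jacobi_eigenvalue_mono) auto
  then show "jacobi_eigenvalue a b n * ((c m)\<^sup>2 * jacobi_sqnorm a b (poly (jacobi_poly a b m)))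
      \<le> (c m)\<^sup>2 * jacobi_sqnorm a b (poly (jacobi_poly a b m)) * jacobi_eigenvalue a b m"
    by (subst mult.commute) (intro mult_left_mono mult_nonneg_nonneg sqnorm_nonneg, auto)
qed

lemma real_polynomial_function_imp_poly:
  assumes "real_polynomial_function (f :: real \<Rightarrow> real)"
  shows "\<exists>p. f = poly p"
  using assms
proof induction
  case (linear f)
  have "f x = poly [:0, f 1:] x" for x
    using linear_scale[OF bounded_linear.linear[OF linear], of x 1] by simp
  then have "f = poly [:0, f 1:]"
    by (rule ext)
  then show ?case
    by blast
next
  case (const c)
  have "(\<lambda>x. c) = poly [:c:]"
    by auto
  then show ?case
    by blast
next
  case (add f g)
  then obtain p q where "f = poly p" "g = poly q"
    by blast
  then have "(\<lambda>x. f x + g x) = poly (p + q)"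
    by auto
  then show ?case
    by blast
next
  case (mult f g)
  then obtain p q where "f = poly p" "g = poly q"
    by blast
  then have "(\<lambda>x. f x * g x) = poly (p * q)"
    by auto
  then show ?case
    by blast
qed

text \<open>
  The Weierstrass theorem, since uniform approximation on \<open>[-1, 1]\<close> is stronger than approximation for
  a finite measure.
\<close>

lemma jacobi_polys_dense:
  assumes ab: "a > -1" "b > -1" and f: "continuous_on {-1..1} f" and "\<epsilon> > 0"
  shows "\<exists>K\<ge>n. jacobi_sqnorm a b (\<lambda>x. f x - poly (jacobi_proj a b K f) x) < \<epsilon>"
proof -
  interpret J: orthogonal_polynomials "jacobi_measure a b" "jacobi_poly a b"
    using ab by (rule orthogonal_polynomials_jacobi)
  interpret finite_measure "jacobi_measure a b"
    by (rule finite_measure_jacobi[OF ab])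
  define h where "h = measure (jacobi_measure a b) (space (jacobi_measure a b))"
  \<comment> \<open>total mass \<open>h\<close> times the squared uniform distance stays below \<open>\<epsilon>\<close>\<close>
  define \<delta> where "\<delta> = sqrt (\<epsilon> / (2 * (h + 1)))"
  have h: "h \<ge> 0"
    by (simp add: h_def)
  have \<delta>: "\<delta> > 0"
    using h \<open>\<epsilon> > 0\<close> by (simp add: \<delta>_def)
  obtain g where "real_polynomial_function g" and g: "\<And>x. x \<in> {-1..1} \<Longrightarrow> \<bar>f x - g x\<bar> < \<delta>"
    using Stone_Weierstrass_real_polynomial_function[OF compact_Icc f \<delta>] by blast
  then obtain q where q: "g = poly q"
    using real_polynomial_function_imp_poly by blast
  define K where "K = max n (Suc (degree q))"
  have "q \<in> polys_below K"
    by (simp add: K_def polys_below_iff max_def)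
  have sf: "square_integrable (jacobi_measure a b) f"
    by (intro square_integrable_jacobi_continuous ab f)
  have "jacobi_sqnorm a b (\<lambda>x. f x - poly (J.proj K f) x) \<le> jacobi_sqnorm a b (\<lambda>x. f x - poly q x)"
    by (intro J.proj_best_approximation sf) fact
  also have "\<dots> \<le> (\<integral>x. \<delta>\<^sup>2 \<partial>jacobi_measure a b)"
    unfolding sqnorm_def
  proof (rule integral_mono)
    show "integrable (jacobi_measure a b) (\<lambda>x. (f x - poly q x)\<^sup>2)"
      using square_integrable_diff[OF sf J.square_integrable_poly[of q]] by (simp add: square_integrable_def)
    fix x assume "x \<in> space (jacobi_measure a b)"
    then have "\<bar>f x - poly q x\<bar> \<le> \<bar>\<delta>\<bar>"
      using g[of x] \<delta> by (simp add: space_jacobi_measure q)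
    then show "(f x - poly q x)\<^sup>2 \<le> \<delta>\<^sup>2"
      by (simp add: abs_le_square_iff)
  qed simp
  also have "\<dots> = \<epsilon> * (h / (2 * (h + 1)))"
    using h \<open>\<epsilon> > 0\<close> by (simp add: \<delta>_def h_def)
  also have "\<dots> < \<epsilon> * 1"
    using h \<open>\<epsilon> > 0\<close> by (intro mult_strict_left_mono) (auto simp: field_simps)
  finally show ?thesis
    by (intro exI[of _ K]) (auto simp: K_def)
qed

text \<open>
  The projections of the error \<open>e\<close> onto polynomials of degree below \<open>K\<close> have only components of degree
  at least \<open>n\<close>, so they satisfy the inequality by comparison of eigenvalues; their derivatives are
  projections of \<open>e'\<close>, and hence no larger than \<open>e'\<close>.  Density of polynomials allows the limit in \<open>K\<close>.
\<close>

lemma jacobi_poincare: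
  assumes ab: "a > -1" "b > -1" and fg: "ac_deriv (-1) 1 f g"
    and g: "square_integrable (jacobi_measure (a + 1) (b + 1)) g"
  shows "jacobi_eigenvalue a b n * jacobi_sqnorm a b (\<lambda>x. f x - poly (jacobi_proj a b n f) x)
       \<le> jacobi_sqnorm (a + 1) (b + 1) (\<lambda>x. g x - poly (jacobi_proj (a + 1) (b + 1) (n - 1) g) x)"
    (is "?l * _ \<le> ?R")
proof -
  interpret J: orthogonal_polynomials "jacobi_measure a b" "jacobi_poly a b"
    using ab by (rule orthogonal_polynomials_jacobi)
  interpret J1: orthogonal_polynomials "jacobi_measure (a + 1) (b + 1)" "jacobi_poly (a + 1) (b + 1)"
    using ab by (intro orthogonal_polynomials_jacobi) auto
  define e e' where "e x = f x - poly (J.proj n f) x" and "e' x = g x - poly (J1.proj (n - 1) g) x" for x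
  have ee': "ac_deriv (-1) 1 e e'"
    using ac_deriv_diff[OF fg ac_deriv_poly[of "J.proj n f"]] pderiv_jacobi_proj[OF ab fg g, of n]
    by (simp add: e_def[abs_def] e'_def[abs_def])
  have f: "square_integrable (jacobi_measure a b) f"
    by (intro square_integrable_jacobi_continuous ab ac_deriv_continuous_on[OF fg])
  have ce: "continuous_on {-1..1} e"
    by (rule ac_deriv_continuous_on[OF ee'])
  then have e: "square_integrable (jacobi_measure a b) e"
    by (intro square_integrable_jacobi_continuous ab)
  have se': "square_integrable (jacobi_measure (a + 1) (b + 1)) e'"
    unfolding e'_def by (intro square_integrable_diff g J1.square_integrable_poly)
  have proj_bound: "?l * jacobi_sqnorm a b (poly (J.proj K e)) \<le> ?R" if "K \<ge> n" for K
  proof -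
    define c where "c m = (\<integral>x. e x * poly (jacobi_poly a b m) x \<partial>jacobi_measure a b) / jacobi_sqnorm a b (poly (jacobi_poly a b m))" for m
    have "c m = 0" if "m < n" for m
    proof -
      have "jacobi_poly a b m \<in> polys_below n"
        using that degree_jacobi_poly[OF ab, of m] by (simp add: polys_below_iff)
      from J.proj_orthogonal[OF f this] show ?thesis
        by (simp add: c_def e_def)
    qed
    then have "(\<Sum>m<n. smult (c m) (jacobi_poly a b m)) = 0"
      by (intro sum.neutral) auto
    then have p: "J.proj K e = (\<Sum>m=n..<K. smult (c m) (jacobi_poly a b m))"
      unfolding J.proj_def c_def[symmetric] lessThan_atLeast0
      using sum.atLeastLessThan_concat[of 0 n K "\<lambda>m. smult (c m) (jacobi_poly a b m)"] that by simp
    have "?l * jacobi_sqnorm a b (poly (J.proj K e)) \<le> jacobi_sqnorm (a + 1) (b + 1) (poly (pderiv (J.proj K e)))"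
      unfolding p by (rule eigenvalue_le_sqnorm_pderiv[OF ab])
    also have "\<dots> = jacobi_sqnorm (a + 1) (b + 1) (poly (J1.proj (K - 1) e'))"
      by (simp add: pderiv_jacobi_proj[OF ab ee' se'])
    also have "\<dots> \<le> jacobi_sqnorm (a + 1) (b + 1) e'"
      by (rule J1.sqnorm_proj_le[OF se'])
    finally show ?thesis
      by (simp add: e'_def[abs_def])
  qed
  have "?l * jacobi_sqnorm a b e \<le> ?R"
  proof (rule field_le_epsilon)
    fix \<epsilon> :: real assume "\<epsilon> > 0"
    have l0: "?l \<ge> 0"
      by (rule jacobi_eigenvalue_nonneg[OF ab])
    define \<delta> where "\<delta> = \<epsilon> / (?l + 1)"
    have "\<delta> > 0"
      using \<open>\<epsilon> > 0\<close> l0 by (simp add: \<delta>_def)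
    then obtain K where K: "K \<ge> n" "jacobi_sqnorm a b (\<lambda>x. e x - poly (J.proj K e) x) < \<delta>"
      using jacobi_polys_dense[OF ab ce] by blast
    have eq: "e = (\<lambda>x. (e x - poly (J.proj K e) x) + poly (J.proj K e) x)"
      by auto
    have "jacobi_sqnorm a b e
        = jacobi_sqnorm a b (\<lambda>x. e x - poly (J.proj K e) x) + jacobi_sqnorm a b (poly (J.proj K e))"
      by (subst eq, subst sqnorm_add_expand)
        (auto intro: square_integrable_diff e J.square_integrable_poly
          simp: J.proj_orthogonal[OF e J.proj_in_polys_below])
    then have "?l * jacobi_sqnorm a b e
        = ?l * jacobi_sqnorm a b (\<lambda>x. e x - poly (J.proj K e) x) + ?l * jacobi_sqnorm a b (poly (J.proj K e))"
      by (simp add: distrib_left)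
    also have "\<dots> \<le> ?l * \<delta> + ?R"
      using K l0 by (intro add_mono proj_bound mult_left_mono) auto
    also have "?l * \<delta> \<le> \<epsilon>"
      using l0 \<open>\<epsilon> > 0\<close> by (simp add: \<delta>_def field_simps)
    finally show "?l * jacobi_sqnorm a b e \<le> ?R + \<epsilon>"
      by simp
  qed
  then show ?thesis
    by (simp add: e_def[abs_def])
qed

section \<open>Projection error without derivatives\<close>

lemma jacobi_eigenvalue_lower:
  assumes "a > -1" "b > -1"
  shows "min 1 (a + b + 2) * (real n)\<^sup>2 \<le> jacobi_eigenvalue a b n"
proof (cases n)
  case 0
  then show ?thesis
    by (simp add: jacobi_eigenvalue_def)
next
  case (Suc k)
  define \<kappa> where "\<kappa> = min 1 (a + b + 2)"
  have "\<kappa> * real k \<le> 1 * real k"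
    by (intro mult_right_mono) (auto simp: \<kappa>_def)
  moreover have "\<kappa> \<le> a + b + 2"
    by (simp add: \<kappa>_def)
  ultimately have "\<kappa> * real n \<le> real n + a + b + 1"
    unfolding Suc of_nat_Suc distrib_left by linarith
  then have "real n * (\<kappa> * real n) \<le> real n * (real n + a + b + 1)"
    by (rule mult_left_mono) simp
  then show ?thesis
    by (simp add: jacobi_eigenvalue_def \<kappa>_def power2_eq_square mult_ac)
qed

text \<open>
  For \<open>n = 1\<close> the assumption forces \<open>s = 0\<close>, and both sides are \<open>1\<close>.
\<close>

lemma power_le_four_power_pred:
  assumes "s < n"
  shows "real n ^ (2 * s) \<le> 4 ^ s * real (n - 1) ^ (2 * s)"
proof (cases "s = 0")
  case False
  then have "real n \<le> 2 * real (n - 1)"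
    using assms by (simp add: of_nat_diff)
  then have "real n ^ (2 * s) \<le> (2 * real (n - 1)) ^ (2 * s)"
    by (intro power_mono) auto
  also have "\<dots> = 4 ^ s * real (n - 1) ^ (2 * s)"
    by (simp add: power_mult_distrib power_mult)
  finally show ?thesis .
qed simp

lemma jacobi_chain_square_integrable:
  assumes "a > -1" "b > -1" "\<forall>j<s. ac_deriv (-1) 1 (F j) (F (Suc j))"
    and "square_integrable (jacobi_measure a b) (F s)" "j \<le> s"
  shows "square_integrable (jacobi_measure a b) (F j)"
proof (cases "j = s")
  case False
  then show ?thesis
    using assms by (intro square_integrable_jacobi_continuous ac_deriv_continuous_on[of _ _ _ "F (Suc j)"]) auto
qed (use assms in simp)

abbreviation jacobi_error :: "real \<Rightarrow> real \<Rightarrow> nat \<Rightarrow> (nat \<Rightarrow> real \<Rightarrow> real) \<Rightarrow> nat \<Rightarrow> real" where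
  "jacobi_error a b n F j \<equiv>
     jacobi_sqnorm a b (\<lambda>x. F j x - poly ((pderiv ^^ j) (jacobi_proj a b n (F 0))) x)"

text \<open>
  The bound of the error by the power \<open>4j - 1 - 2s\<close> of \<open>n\<close>, without division.  For \<open>j = 0\<close> the truncated
  subtraction gives exponent \<open>0\<close> on the right, which is the rate of the projection error itself.  The
  sequence \<open>F\<close> lists a function and its derivatives.
\<close>

definition jacobi_rate :: "real \<Rightarrow> real \<Rightarrow> real \<Rightarrow> nat \<Rightarrow> nat \<Rightarrow> bool" where
  "jacobi_rate a b C j s \<longleftrightarrow> (\<forall>n F. s \<le> n \<longrightarrow> (\<forall>i<s. ac_deriv (-1) 1 (F i) (F (Suc i))) \<longrightarrow>
     square_integrable (jacobi_measure a b) (F s) \<longrightarrow>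
     real n ^ (2 * s) * jacobi_error a b n F j \<le> C * real n ^ (4 * j - 1) * jacobi_sqnorm a b (F s))"

lemma jacobi_rateD:
  "jacobi_rate a b C j s \<Longrightarrow> s \<le> n \<Longrightarrow> \<forall>i<s. ac_deriv (-1) 1 (F i) (F (Suc i)) \<Longrightarrow>
     square_integrable (jacobi_measure a b) (F s) \<Longrightarrow>
     real n ^ (2 * s) * jacobi_error a b n F j \<le> C * real n ^ (4 * j - 1) * jacobi_sqnorm a b (F s)"
  by (simp add: jacobi_rate_def)

lemma jacobi_rate_mono:
  assumes "jacobi_rate a b C j s" "C \<le> D"
  shows "jacobi_rate a b D j s"
  unfolding jacobi_rate_def
proof (intro allI impI)
  fix n and F :: "nat \<Rightarrow> real \<Rightarrow> real"
  assume "s \<le> n" "\<forall>i<s. ac_deriv (-1) 1 (F i) (F (Suc i))" "square_integrable (jacobi_measure a b) (F s)"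
  from jacobi_rateD[OF assms(1) this]
  have "real n ^ (2 * s) * jacobi_error a b n F j \<le> C * real n ^ (4 * j - 1) * jacobi_sqnorm a b (F s)" .
  also have "\<dots> \<le> D * real n ^ (4 * j - 1) * jacobi_sqnorm a b (F s)"
    using assms(2) by (intro mult_right_mono sqnorm_nonneg) auto
  finally show "real n ^ (2 * s) * jacobi_error a b n F j \<le> D * real n ^ (4 * j - 1) * jacobi_sqnorm a b (F s)" .
qed

lemma jacobi_L2_rate:
  assumes "a > -1" "b > -1"
  shows "\<exists>C\<ge>0. jacobi_rate a b C 0 s"
  using assms
proof (induction s arbitrary: a b)
  case 0
  interpret J: orthogonal_polynomials "jacobi_measure a b" "jacobi_poly a b"
    using 0 by (rule orthogonal_polynomials_jacobi)
  show ?case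
    unfolding jacobi_rate_def using J.sqnorm_diff_proj_le by (intro exI[of _ 1]) auto
next
  case (Suc s)
  note ab = Suc.prems
  have ab1: "a + 1 > -1" "b + 1 > -1"
    using ab by auto
  obtain C where C: "C \<ge> 0" "jacobi_rate (a + 1) (b + 1) C 0 s"
    using Suc.IH[OF ab1] by blast
  define \<kappa> where "\<kappa> = min 1 (a + b + 2)"
  have \<kappa>: "\<kappa> > 0"
    using ab by (simp add: \<kappa>_def)
  show ?case
    unfolding jacobi_rate_def
  proof (intro exI[of _ "4 ^ s * C / \<kappa>"] conjI allI impI)
    show "4 ^ s * C / \<kappa> \<ge> 0"
      using C(1) \<kappa> by simp
    fix n and F :: "nat \<Rightarrow> real \<Rightarrow> real"
    assume n: "Suc s \<le> n" and F: "\<forall>j<Suc s. ac_deriv (-1) 1 (F j) (F (Suc j))"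
      and Fs: "square_integrable (jacobi_measure a b) (F (Suc s))"
    let ?E = "jacobi_sqnorm a b (\<lambda>x. F 0 x - poly (jacobi_proj a b n (F 0)) x)"
    let ?E1 = "jacobi_sqnorm (a + 1) (b + 1) (\<lambda>x. F 1 x - poly (jacobi_proj (a + 1) (b + 1) (n - 1) (F 1)) x)"
    have Fs1: "square_integrable (jacobi_measure (a + 1) (b + 1)) (F (Suc s))"
      and le: "jacobi_sqnorm (a + 1) (b + 1) (F (Suc s)) \<le> jacobi_sqnorm a b (F (Suc s))"
      using square_integrable_jacobi_Suc[OF Fs] by auto
    have F1: "square_integrable (jacobi_measure (a + 1) (b + 1)) (F 1)"
      using jacobi_chain_square_integrable[OF ab1 F Fs1, of 1] by simp
    have "real (n - 1) ^ (2 * s) * ?E1 \<le> C * jacobi_sqnorm (a + 1) (b + 1) (F (Suc s))"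
      using jacobi_rateD[OF C(2), of "n - 1" "\<lambda>j. F (Suc j)"] n F Fs1 by simp
    also have "\<dots> \<le> C * jacobi_sqnorm a b (F (Suc s))"
      by (intro mult_left_mono le C(1))
    finally have 1: "real (n - 1) ^ (2 * s) * ?E1 \<le> C * jacobi_sqnorm a b (F (Suc s))" .
    have "jacobi_eigenvalue a b n * ?E \<le> ?E1"
      using F by (intro jacobi_poincare ab F1) auto
    moreover have "\<kappa> * (real n)\<^sup>2 * ?E \<le> jacobi_eigenvalue a b n * ?E"
      unfolding \<kappa>_def by (intro mult_right_mono jacobi_eigenvalue_lower ab sqnorm_nonneg)
    ultimately have 2: "\<kappa> * (real n)\<^sup>2 * ?E \<le> ?E1"
      by linarith
    have "\<kappa> * (real n ^ (2 * Suc s) * ?E) = real n ^ (2 * s) * (\<kappa> * (real n)\<^sup>2 * ?E)"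
      by (simp add: power_add power2_eq_square mult_ac)
    also have "\<dots> \<le> 4 ^ s * real (n - 1) ^ (2 * s) * (\<kappa> * (real n)\<^sup>2 * ?E)"
      using \<kappa> power_le_four_power_pred[of s n] n
      by (intro mult_right_mono mult_nonneg_nonneg sqnorm_nonneg) auto
    also have "\<dots> \<le> 4 ^ s * real (n - 1) ^ (2 * s) * ?E1"
      by (intro mult_left_mono 2) auto
    also have "\<dots> = 4 ^ s * (real (n - 1) ^ (2 * s) * ?E1)"
      by (simp only: mult.assoc)
    also have "\<dots> \<le> 4 ^ s * (C * jacobi_sqnorm a b (F (Suc s)))"
      by (intro mult_left_mono 1) auto
    finally have "real n ^ (2 * Suc s) * ?E \<le> 4 ^ s * C / \<kappa> * jacobi_sqnorm a b (F (Suc s))"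
      using \<kappa> by (simp add: field_simps)
    then show "real n ^ (2 * Suc s) * jacobi_error a b n F 0
        \<le> 4 ^ s * C / \<kappa> * real n ^ (4 * 0 - 1) * jacobi_sqnorm a b (F (Suc s))"
      by simp
  qed
qed

section \<open>Inverse inequalities\<close>

text \<open>
  Integration by parts of \<open>t (p\<^sup>2)'\<close> against the raised weight produces, up to multiples of the raised norm of \<open>p\<close>,
  the integral of \<open>((a + 1) (1 + t) + (b + 1) (1 - t)) p\<^sup>2\<close> against the smaller weight, and the factor in front of
  \<open>p\<^sup>2\<close> is bounded below.  In this way a norm for the smaller weight is controlled by the raised weight and one derivative.
\<close>

lemma jacobi_weight_drop_bound:
  assumes ab: "a > -1" "b > -1"
  shows "2 * min (a + 1) (b + 1) * jacobi_sqnorm a b (poly p)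
       \<le> (a + b + 3) * jacobi_sqnorm (a + 1) (b + 1) (poly p)
         + 2 * (\<integral>x. x * poly p x * poly (pderiv p) x \<partial>jacobi_measure (a + 1) (b + 1))"
proof -
  interpret J: orthogonal_polynomials "jacobi_measure a b" "jacobi_poly a b"
    using ab by (rule orthogonal_polynomials_jacobi)
  define q where "q = jacobi_adjoint a b [:0, 1:]"
  define c where "c = min (a + 1) (b + 1)"
  have q: "poly q x = (1 - x\<^sup>2) + ((b + 1) * (1 - x) - (a + 1) * (1 + x)) * x" for x
    unfolding q_def poly_jacobi_adjoint by (simp add: pderiv_pCons)
  have sq: "poly (p * p) x = (poly p x)\<^sup>2" for x
    by (simp add: power2_eq_square)
  have "2 * (\<integral>x. x * poly p x * poly (pderiv p) x \<partial>jacobi_measure (a + 1) (b + 1))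
      = (\<integral>x. poly (pderiv (p * p)) x * poly [:0, 1:] x \<partial>jacobi_measure (a + 1) (b + 1))"
    unfolding Bochner_Integration.integral_mult_right_zero[symmetric]
    by (intro Bochner_Integration.integral_cong) (auto simp: pderiv_mult algebra_simps)
  also have "\<dots> = - (\<integral>x. (poly p x)\<^sup>2 * poly q x \<partial>jacobi_measure a b)"
    unfolding jacobi_integral_by_parts[OF ab ac_deriv_poly] q_def[symmetric] sq ..
  finally have ibp: "2 * (\<integral>x. x * poly p x * poly (pderiv p) x \<partial>jacobi_measure (a + 1) (b + 1))
      = - (\<integral>x. (poly p x)\<^sup>2 * poly q x \<partial>jacobi_measure a b)" .
  have "poly p \<in> borel_measurable (lebesgue_on {-1<..<1})"
    by (intro measurable_continuous_Icc continuous_intros)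
  then have up: "jacobi_sqnorm (a + 1) (b + 1) (poly p) = (\<integral>x. (1 - x\<^sup>2) * (poly p x)\<^sup>2 \<partial>jacobi_measure a b)"
    unfolding sqnorm_def by (subst integral_jacobi_Suc) auto
  have i: "integrable (jacobi_measure a b) (\<lambda>x. (poly p x)\<^sup>2 * poly r x)" for r
    by (rule J.integrable_eq_poly[of _ "p * p * r"]) (simp add: power2_eq_square)
  have i1: "integrable (jacobi_measure a b) (\<lambda>x. (poly p x)\<^sup>2)"
    by (rule J.integrable_eq_poly[of _ "p * p"]) (simp add: power2_eq_square)
  have i2: "integrable (jacobi_measure a b) (\<lambda>x. (1 - x\<^sup>2) * (poly p x)\<^sup>2)"
    by (rule J.integrable_eq_poly[of _ "[:1, 0, -1:] * (p * p)"]) (simp add: power2_eq_square algebra_simps)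
  have "0 \<le> (\<integral>x. (a + b + 3) * ((1 - x\<^sup>2) * (poly p x)\<^sup>2) - (poly p x)\<^sup>2 * poly q x - 2 * c * (poly p x)\<^sup>2 \<partial>jacobi_measure a b)"
  proof (rule Bochner_Integration.integral_nonneg)
    fix x assume "x \<in> space (jacobi_measure a b)"
    then have x: "-1 < x" "x < 1"
      by (auto simp: space_jacobi_measure)
    have "c * (1 + x) \<le> (a + 1) * (1 + x)" "c * (1 - x) \<le> (b + 1) * (1 - x)"
      using x by (auto intro!: mult_right_mono simp: c_def)
    then have "0 \<le> (a + 1) * (1 + x) + (b + 1) * (1 - x) - 2 * c"
      by (simp add: algebra_simps)
    also have "\<dots> = (a + b + 3) * (1 - x\<^sup>2) - poly q x - 2 * c"
      unfolding q by (simp add: power2_eq_square algebra_simps)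
    finally have "0 \<le> (poly p x)\<^sup>2 * ((a + b + 3) * (1 - x\<^sup>2) - poly q x - 2 * c)"
      by simp
    then show "0 \<le> (a + b + 3) * ((1 - x\<^sup>2) * (poly p x)\<^sup>2) - (poly p x)\<^sup>2 * poly q x - 2 * c * (poly p x)\<^sup>2"
      by (simp add: algebra_simps)
  qed
  also have "\<dots> = (a + b + 3) * jacobi_sqnorm (a + 1) (b + 1) (poly p)
      - (\<integral>x. (poly p x)\<^sup>2 * poly q x \<partial>jacobi_measure a b) - 2 * c * jacobi_sqnorm a b (poly p)"
    unfolding up using i i1 i2 by (simp add: sqnorm_def)
  finally show ?thesis
    using ibp by (simp add: c_def)
qed

text \<open>
  For a Jacobi polynomial \<open>q\<close> of degree \<open>m\<close> the polynomial \<open>t q' - m q\<close> has lower degree, so the integral with the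
  derivative is \<open>m\<close> times the squared norm.  The loss is only one factor of \<open>m\<close>, against \<open>m\<^sup>2\<close> for
  general polynomials of the same degree; this accounts for the \<open>-1/2\<close> in the final exponent.
\<close>

lemma sqnorm_jacobi_poly_drop:
  assumes ab: "a > -1" "b > -1"
  shows "2 * min (a + 1) (b + 1) * jacobi_sqnorm a b (poly (jacobi_poly (a + 1) (b + 1) m))
       \<le> (a + b + 3 + 2 * real m) * jacobi_sqnorm (a + 1) (b + 1) (poly (jacobi_poly (a + 1) (b + 1) m))"
proof -
  interpret J1: orthogonal_polynomials "jacobi_measure (a + 1) (b + 1)" "jacobi_poly (a + 1) (b + 1)"
    using ab by (intro orthogonal_polynomials_jacobi) auto
  define q where "q = jacobi_poly (a + 1) (b + 1) m"
  define r where "r = [:0, 1:] * pderiv q - smult (real m) q"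
  have q: "degree q = m"
    unfolding q_def by (rule J1.degree_P)
  have "coeff r i = 0" if "m \<le> i" for i
    using that q by (cases i) (auto simp: r_def coeff_pCons coeff_pderiv coeff_eq_0 le_Suc_eq)
  then have r: "r \<in> polys_below m"
    by (simp add: polys_below_def)
  have i: "integrable (jacobi_measure (a + 1) (b + 1)) (\<lambda>x. poly q x * poly s x)" for s
    by (intro J1.integrable_mult_poly J1.square_integrable_poly)
  have "(\<integral>x. x * poly q x * poly (pderiv q) x \<partial>jacobi_measure (a + 1) (b + 1))
      = (\<integral>x. poly q x * poly r x + real m * (poly q x * poly q x) \<partial>jacobi_measure (a + 1) (b + 1))"
    by (intro Bochner_Integration.integral_cong) (auto simp: r_def algebra_simps)
  also have "\<dots> = real m * jacobi_sqnorm (a + 1) (b + 1) (poly q)"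
    using J1.orthogonal_polys_below[OF r] i
    by (subst Bochner_Integration.integral_add) (auto simp: q_def[symmetric] sqnorm_def power2_eq_square)
  finally show ?thesis
    using jacobi_weight_drop_bound[OF ab, of q] by (simp add: q_def distrib_right)
qed

text \<open>
  The integral with the derivative is distributed over the smaller weight as \<open>p\<close> times \<open>(1 - t\<^sup>2) p'\<close>.  The first
  factor is absorbed into the left side, and the second is a norm of \<open>p'\<close> for the twice raised weight, which the
  eigenvalues control by the raised norm of \<open>p\<close>.
\<close>

lemma sqnorm_poly_drop:
  assumes ab: "a > -1" "b > -1" and p: "p \<in> polys_below (Suc n)"
  defines "c \<equiv> min (a + 1) (b + 1)"
  shows "c * jacobi_sqnorm a b (poly p)
       \<le> (a + b + 3 + jacobi_eigenvalue (a + 1) (b + 1) n / c) * jacobi_sqnorm (a + 1) (b + 1) (poly p)"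
proof -
  interpret J: orthogonal_polynomials "jacobi_measure a b" "jacobi_poly a b"
    using ab by (rule orthogonal_polynomials_jacobi)
  have c: "c > 0"
    using ab by (simp add: c_def)
  define p' where "p' = pderiv p"
  have "2 * (\<integral>x. x * poly p x * poly p' x \<partial>jacobi_measure (a + 1) (b + 1))
      = 2 * (\<integral>x. (1 - x\<^sup>2) * (x * poly p x * poly p' x) \<partial>jacobi_measure a b)"
    by (subst integral_jacobi_Suc) (auto intro!: measurable_continuous_Icc continuous_intros)
  also have "\<dots> = (\<integral>x. 2 * ((1 - x\<^sup>2) * (x * poly p x * poly p' x)) \<partial>jacobi_measure a b)"
    by simp
  also have "\<dots> \<le> (\<integral>x. c * (poly p x)\<^sup>2 + (1 / c) * ((1 - x\<^sup>2) * ((1 - x\<^sup>2) * (poly p' x)\<^sup>2)) \<partial>jacobi_measure a b)"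
  proof (rule integral_mono)
    show "integrable (jacobi_measure a b) (\<lambda>x. 2 * ((1 - x\<^sup>2) * (x * poly p x * poly p' x)))"
      by (rule J.integrable_eq_poly[of _ "[:2:] * [:1, 0, -1:] * ([:0, 1:] * p * p')"])
        (simp add: power2_eq_square algebra_simps)
    show "integrable (jacobi_measure a b) (\<lambda>x. c * (poly p x)\<^sup>2 + (1 / c) * ((1 - x\<^sup>2) * ((1 - x\<^sup>2) * (poly p' x)\<^sup>2)))"
      by (rule J.integrable_eq_poly[of _ "smult c (p * p) + smult (1 / c) ([:1, 0, -1:] * ([:1, 0, -1:] * (p' * p')))"])
        (simp add: power2_eq_square algebra_simps)
    fix x assume "x \<in> space (jacobi_measure a b)"
    then have x: "x\<^sup>2 \<le> 1"
      by (auto simp: space_jacobi_measure abs_square_le_1)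
    define u v where "u = poly p x" and "v = (1 - x\<^sup>2) * poly p' x"
    \<comment> \<open>the weighted inequality \<open>2 x u v \<le> c u\<^sup>2 + v\<^sup>2 / c\<close> for \<open>\<bar>x\<bar> \<le> 1\<close>\<close>
    have "0 \<le> (c * u - x * v)\<^sup>2 / c"
      using c by simp
    also have "\<dots> = c * u\<^sup>2 - 2 * (x * u * v) + x\<^sup>2 * v\<^sup>2 / c"
      using c by (simp add: field_simps power2_eq_square)
    also have "x\<^sup>2 * v\<^sup>2 / c \<le> 1 * v\<^sup>2 / c"
      using c x by (intro divide_right_mono mult_right_mono) auto
    finally show "2 * ((1 - x\<^sup>2) * (x * poly p x * poly p' x))
        \<le> c * (poly p x)\<^sup>2 + (1 / c) * ((1 - x\<^sup>2) * ((1 - x\<^sup>2) * (poly p' x)\<^sup>2))"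
      by (simp add: u_def v_def power_mult_distrib power2_eq_square[of "1 - x\<^sup>2"] mult_ac)
  qed
  also have "\<dots> = c * jacobi_sqnorm a b (poly p)
      + (1 / c) * (\<integral>x. (1 - x\<^sup>2) * ((1 - x\<^sup>2) * (poly p' x)\<^sup>2) \<partial>jacobi_measure a b)"
  proof -
    have "integrable (jacobi_measure a b) (\<lambda>x. (poly p x)\<^sup>2)"
      by (rule J.integrable_eq_poly[of _ "p * p"]) (simp add: power2_eq_square)
    moreover have "integrable (jacobi_measure a b) (\<lambda>x. (1 - x\<^sup>2) * ((1 - x\<^sup>2) * (poly p' x)\<^sup>2))"
      by (rule J.integrable_eq_poly[of _ "[:1, 0, -1:] * ([:1, 0, -1:] * (p' * p'))"])
        (simp add: power2_eq_square algebra_simps)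
    ultimately show ?thesis
      unfolding sqnorm_def by (subst Bochner_Integration.integral_add) (auto simp del: times_divide_eq_left)
  qed
  also have "(\<integral>x. (1 - x\<^sup>2) * ((1 - x\<^sup>2) * (poly p' x)\<^sup>2) \<partial>jacobi_measure a b)
      = jacobi_sqnorm (a + 1 + 1) (b + 1 + 1) (poly p')"
    unfolding sqnorm_def
    by (subst integral_jacobi_Suc, auto intro!: measurable_continuous_Icc continuous_intros)
      (subst integral_jacobi_Suc, auto intro!: measurable_continuous_Icc continuous_intros)
  also have "\<dots> \<le> jacobi_eigenvalue (a + 1) (b + 1) n * jacobi_sqnorm (a + 1) (b + 1) (poly p)"
    unfolding p'_def using ab p by (intro sqnorm_pderiv_le_eigenvalue) auto
  finally have "2 * (\<integral>x. x * poly p x * poly p' x \<partial>jacobi_measure (a + 1) (b + 1))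
      \<le> c * jacobi_sqnorm a b (poly p)
        + (1 / c) * (jacobi_eigenvalue (a + 1) (b + 1) n * jacobi_sqnorm (a + 1) (b + 1) (poly p))"
    using c by (simp add: mult_left_mono divide_right_mono)
  then show ?thesis
    using jacobi_weight_drop_bound[OF ab, of p, folded c_def p'_def] by (simp add: algebra_simps)
qed

lemma jacobi_eigenvalue_upper:
  assumes "n \<ge> 1" "a + b + 1 \<ge> -1"
  shows "jacobi_eigenvalue a b n \<le> (a + b + 3) * (real n)\<^sup>2"
proof -
  have "a + b + 1 \<le> (a + b + 2) * real n"
    using assms mult_left_mono[of 1 "real n" "a + b + 2"] by simp
  then have "real n * (real n + a + b + 1) \<le> real n * (real n + (a + b + 2) * real n)"
    by (intro mult_left_mono) auto
  then show ?thesis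
    by (simp add: jacobi_eigenvalue_def power2_eq_square algebra_simps)
qed

text \<open>
  Passing to the derivative in the raised weight and then back to the smaller weight costs a factor \<open>n\<^sup>2\<close> each.
\<close>

lemma jacobi_Markov:
  assumes ab: "a > -1" "b > -1"
  shows "\<exists>C\<ge>0. \<forall>n\<ge>1. \<forall>p\<in>polys_below n.
     jacobi_sqnorm a b (poly (pderiv p)) \<le> C * real n ^ 4 * jacobi_sqnorm a b (poly p)"
proof -
  define c where "c = min (a + 1) (b + 1)"
  define D where "D = (a + b + 3 + (a + b + 5) / c) / c"
  have c: "c > 0" and pos: "a + b + 3 > 0"
    using ab by (simp_all add: c_def)
  then have D: "D \<ge> 0"
    by (simp add: D_def)
  show ?thesis
  proof (intro exI[of _ "D * (a + b + 3)"] conjI allI ballI impI)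
    show "0 \<le> D * (a + b + 3)"
      using D pos by simp
    fix n :: nat and p assume n: "1 \<le> n" and p: "p \<in> polys_below n"
    have le: "jacobi_eigenvalue a b n \<le> (a + b + 3) * (real n)\<^sup>2"
      using n ab by (intro jacobi_eigenvalue_upper) auto
    have "jacobi_eigenvalue (a + 1) (b + 1) n \<le> (a + 1 + (b + 1) + 3) * (real n)\<^sup>2"
      using n ab by (intro jacobi_eigenvalue_upper) auto
    then have "jacobi_eigenvalue (a + 1) (b + 1) n / c \<le> (a + b + 5) / c * (real n)\<^sup>2"
      using c by (simp add: field_simps)
    moreover have "a + b + 3 \<le> (a + b + 3) * (real n)\<^sup>2"
      using pos n by simp
    ultimately have le1: "a + b + 3 + jacobi_eigenvalue (a + 1) (b + 1) n / c \<le> c * D * (real n)\<^sup>2"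
      using c by (simp add: D_def distrib_right)
    have p': "pderiv p \<in> polys_below (Suc n)"
      using polys_below_pderiv[OF p] by (rule polys_below_mono) simp
    have "c * jacobi_sqnorm a b (poly (pderiv p))
        \<le> (a + b + 3 + jacobi_eigenvalue (a + 1) (b + 1) n / c) * jacobi_sqnorm (a + 1) (b + 1) (poly (pderiv p))"
      unfolding c_def by (rule sqnorm_poly_drop[OF ab p'])
    also have "\<dots> \<le> (c * D * (real n)\<^sup>2) * jacobi_sqnorm (a + 1) (b + 1) (poly (pderiv p))"
      by (intro mult_right_mono le1 sqnorm_nonneg)
    also have "\<dots> \<le> (c * D * (real n)\<^sup>2) * ((a + b + 3) * (real n)\<^sup>2 * jacobi_sqnorm a b (poly p))"
    proof (rule mult_left_mono)
      have "jacobi_sqnorm (a + 1) (b + 1) (poly (pderiv p)) \<le> jacobi_eigenvalue a b n * jacobi_sqnorm a b (poly p)"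
        using polys_below_mono[OF p] by (intro sqnorm_pderiv_le_eigenvalue ab) auto
      also have "\<dots> \<le> (a + b + 3) * (real n)\<^sup>2 * jacobi_sqnorm a b (poly p)"
        by (intro mult_right_mono le sqnorm_nonneg)
      finally show "jacobi_sqnorm (a + 1) (b + 1) (poly (pderiv p)) \<le> (a + b + 3) * (real n)\<^sup>2 * jacobi_sqnorm a b (poly p)" .
    qed (use c D in simp)
    also have "\<dots> = c * (D * (a + b + 3) * real n ^ 4 * jacobi_sqnorm a b (poly p))"
      by (simp add: power2_eq_square power4_eq_xxxx mult_ac)
    finally have "c * jacobi_sqnorm a b (poly (pderiv p))
        \<le> c * (D * (a + b + 3) * real n ^ 4 * jacobi_sqnorm a b (poly p))" .
    then show "jacobi_sqnorm a b (poly (pderiv p)) \<le> D * (a + b + 3) * real n ^ 4 * jacobi_sqnorm a b (poly p)"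
      using c by simp
  qed
qed

lemma jacobi_Markov_iterated:
  assumes ab: "a > -1" "b > -1"
  shows "\<exists>C\<ge>0. \<forall>n\<ge>1. \<forall>p\<in>polys_below n.
     jacobi_sqnorm a b (poly ((pderiv ^^ i) p)) \<le> C * real n ^ (4 * i) * jacobi_sqnorm a b (poly p)"
proof (induction i)
  case 0
  then show ?case
    by (intro exI[of _ 1]) auto
next
  case (Suc i)
  then obtain C where C: "C \<ge> 0" "\<And>n p. n \<ge> 1 \<Longrightarrow> p \<in> polys_below n \<Longrightarrow>
     jacobi_sqnorm a b (poly ((pderiv ^^ i) p)) \<le> C * real n ^ (4 * i) * jacobi_sqnorm a b (poly p)"
    by blast
  obtain D where D: "D \<ge> 0" "\<And>n p. n \<ge> 1 \<Longrightarrow> p \<in> polys_below n \<Longrightarrow>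
     jacobi_sqnorm a b (poly (pderiv p)) \<le> D * real n ^ 4 * jacobi_sqnorm a b (poly p)"
    using jacobi_Markov[OF ab] by blast
  show ?case
  proof (intro exI[of _ "C * D"] conjI allI ballI impI)
    fix n :: nat and p assume n: "1 \<le> n" and p: "p \<in> polys_below n"
    have "jacobi_sqnorm a b (poly ((pderiv ^^ Suc i) p)) = jacobi_sqnorm a b (poly ((pderiv ^^ i) (pderiv p)))"
      by (simp add: funpow_swap1)
    also have "\<dots> \<le> C * real n ^ (4 * i) * jacobi_sqnorm a b (poly (pderiv p))"
      using polys_below_mono[OF polys_below_pderiv[OF p]] by (intro C(2) n) auto
    also have "\<dots> \<le> C * real n ^ (4 * i) * (D * real n ^ 4 * jacobi_sqnorm a b (poly p))"
      using C(1) by (intro mult_left_mono D(2) n p) auto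
    finally show "jacobi_sqnorm a b (poly ((pderiv ^^ Suc i) p))
        \<le> C * D * real n ^ (4 * Suc i) * jacobi_sqnorm a b (poly p)"
      by (simp add: power_add mult_ac)
  qed (use C D in auto)
qed

section \<open>Derivatives of the projection error\<close>

text \<open>
  If \<open>f\<close> is the derivative of \<open>f\<^sub>0\<close>, the polynomial on the left is \<open>\<Pi> f - (\<Pi> f\<^sub>0)'\<close> with \<open>\<Pi>\<close> of index \<open>Suc n\<close>.
  It does not change when \<open>f\<close> is replaced by the error \<open>g\<close> of its projection of index \<open>n\<close>.  For this \<open>g\<close> the components
  with respect to the raised weight vanish in all degrees \<open>m\<close> with \<open>m + 2 < n\<close>, because multiplication
  by \<open>1 - t\<^sup>2\<close> turns the raised weight into the original one and adds two to the degree.  At most two components remain.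
\<close>

lemma jacobi_commutator_bound:
  assumes ab: "a > -1" "b > -1"
  shows "\<exists>C\<ge>0. \<forall>n f. square_integrable (jacobi_measure a b) f \<longrightarrow>
     jacobi_sqnorm a b (poly (jacobi_proj a b (Suc n) f - jacobi_proj (a + 1) (b + 1) n f))
       \<le> C * real (Suc n) * jacobi_sqnorm a b (\<lambda>x. f x - poly (jacobi_proj a b n f) x)"
proof -
  interpret J: orthogonal_polynomials "jacobi_measure a b" "jacobi_poly a b"
    using ab by (rule orthogonal_polynomials_jacobi)
  interpret J1: orthogonal_polynomials "jacobi_measure (a + 1) (b + 1)" "jacobi_poly (a + 1) (b + 1)"
    using ab by (intro orthogonal_polynomials_jacobi) auto
  let ?q = "jacobi_poly (a + 1) (b + 1)"
  define c where "c = min (a + 1) (b + 1)"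
  define D where "D = (a + b + 5) / (2 * c)"
  have c: "c > 0"
    using ab by (simp add: c_def)
  have D: "D \<ge> 0"
    using ab c by (simp add: D_def)
  have drop: "jacobi_sqnorm a b (poly (?q m)) \<le> D * real (Suc m) * jacobi_sqnorm (a + 1) (b + 1) (poly (?q m))" for m
  proof -
    have "0 \<le> (a + b + 3) * real m"
      using ab by simp
    then have "a + b + 3 + 2 * real m \<le> (a + b + 5) * real (Suc m)"
      by (simp add: algebra_simps)
    then have "(a + b + 3 + 2 * real m) * jacobi_sqnorm (a + 1) (b + 1) (poly (?q m))
        \<le> (a + b + 5) * real (Suc m) * jacobi_sqnorm (a + 1) (b + 1) (poly (?q m))"
      by (intro mult_right_mono sqnorm_nonneg)
    then have "2 * c * jacobi_sqnorm a b (poly (?q m))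
        \<le> (a + b + 5) * real (Suc m) * jacobi_sqnorm (a + 1) (b + 1) (poly (?q m))"
      using sqnorm_jacobi_poly_drop[OF ab, of m] unfolding c_def by linarith
    then show ?thesis
      using c by (simp add: D_def field_simps)
  qed
  show ?thesis
  proof (intro exI[of _ "2 + 8 * D"] conjI allI impI)
    show "0 \<le> 2 + 8 * D"
      using D by simp
    fix n f assume f: "square_integrable (jacobi_measure a b) f"
    define g where "g x = f x - poly (J.proj n f) x" for x
    have g: "square_integrable (jacobi_measure a b) g"
      unfolding g_def[abs_def] by (intro square_integrable_diff f J.square_integrable_poly)
    note g1 = square_integrable_jacobi_Suc[OF g]
    note f1 = square_integrable_jacobi_Suc(1)[OF f]
    define k where "k m = (\<integral>x. g x * poly (?q m) x \<partial>jacobi_measure (a + 1) (b + 1)) / jacobi_sqnorm (a + 1) (b + 1) (poly (?q m))" for m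
    have comp: "jacobi_sqnorm a b (poly (smult (k m) (?q m))) \<le> D * real n * jacobi_sqnorm a b g" if "m < n" for m
    proof -
      define h where "h = jacobi_sqnorm (a + 1) (b + 1) (poly (?q m))"
      have h: "h > 0"
        unfolding h_def by (rule J1.sqnorm_P_pos)
      have "(k m)\<^sup>2 * h = (\<integral>x. g x * poly (?q m) x \<partial>jacobi_measure (a + 1) (b + 1))\<^sup>2 / h"
        using h by (simp add: k_def h_def[symmetric] power_divide power2_eq_square[of h])
      also have "\<dots> \<le> jacobi_sqnorm (a + 1) (b + 1) g * h / h"
        using h Cauchy_Schwarz_integral[OF g1(1) J1.square_integrable_poly[of "?q m"]]
        by (intro divide_right_mono) (auto simp: h_def)
      also have "\<dots> \<le> jacobi_sqnorm a b g"
        using h g1(2) by simp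
      finally have kh: "(k m)\<^sup>2 * h \<le> jacobi_sqnorm a b g" .
      have "jacobi_sqnorm a b (poly (smult (k m) (?q m))) = (k m)\<^sup>2 * jacobi_sqnorm a b (poly (?q m))"
        using sqnorm_cmult[of _ "k m" "poly (?q m)"] by (simp add: sqnorm_def)
      also have "\<dots> \<le> (k m)\<^sup>2 * (D * real (Suc m) * h)"
        unfolding h_def by (intro mult_left_mono drop) auto
      also have "\<dots> = D * real (Suc m) * ((k m)\<^sup>2 * h)"
        by (simp only: mult_ac)
      also have "\<dots> \<le> D * real n * jacobi_sqnorm a b g"
        using D that h by (intro mult_mono kh) (auto intro: sqnorm_nonneg)
      finally show ?thesis .
    qed
    have vanish: "k m = 0" if "m + 2 < n" for m
    proof -
      have "[:1, 0, -1:] * ?q m \<in> polys_below (Suc m + 2)"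
        using J1.degree_P[of m] by (intro polys_below_mult) (auto simp: polys_below_iff)
      then have "[:1, 0, -1:] * ?q m \<in> polys_below n"
        by (rule polys_below_mono) (use that in simp)
      from J.proj_orthogonal[OF f this]
      have "(\<integral>x. (1 - x\<^sup>2) * (g x * poly (?q m) x) \<partial>jacobi_measure a b) = 0"
        by (simp add: g_def power2_eq_square algebra_simps)
      moreover have "(\<lambda>x. g x * poly (?q m) x) \<in> borel_measurable (lebesgue_on {-1<..<1})"
        using J.integrable_mult_poly[OF g, of "?q m"] borel_measurable_integrable
        by (simp add: measurable_jacobi_measure[symmetric])
      ultimately show ?thesis
        by (simp add: k_def integral_jacobi_Suc)
    qed
    have proj1: "J1.proj n g = (\<Sum>m<n. smult (k m) (?q m))"
      unfolding J1.proj_def k_def ..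
    have nn: "0 \<le> D * real n * jacobi_sqnorm a b g"
      using D by (intro mult_nonneg_nonneg sqnorm_nonneg) auto
    have "jacobi_sqnorm a b (poly (J1.proj n g)) \<le> 4 * (D * real n * jacobi_sqnorm a b g)"
    proof -
      consider "n = 0" | "n = 1" | l where "n = Suc (Suc l)"
        by (metis One_nat_def old.nat.exhaust)
      then show ?thesis
      proof cases
        case 1
        then show ?thesis
          unfolding proj1 by (simp add: sqnorm_def)
      next
        case 2
        then have "jacobi_sqnorm a b (poly (J1.proj n g)) \<le> D * real n * jacobi_sqnorm a b g"
          using comp[of 0] unfolding proj1 by simp
        then show ?thesis
          using nn by linarith
      next
        case (3 l)
        have "(\<Sum>m<l. smult (k m) (?q m)) = 0"
          by (intro sum.neutral) (auto simp: vanish 3)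
        then have "J1.proj n g = smult (k l) (?q l) + smult (k (Suc l)) (?q (Suc l))"
          unfolding proj1 unfolding 3 by simp
        then have "jacobi_sqnorm a b (poly (J1.proj n g))
            \<le> 2 * jacobi_sqnorm a b (poly (smult (k l) (?q l))) + 2 * jacobi_sqnorm a b (poly (smult (k (Suc l)) (?q (Suc l))))"
          using J.sqnorm_poly_add_le by simp
        then show ?thesis
          using comp[of l] comp[of "Suc l"] 3 by simp
      qed
    qed
    moreover have "jacobi_sqnorm a b (poly (J.proj (Suc n) g)) \<le> jacobi_sqnorm a b g"
      by (rule J.sqnorm_proj_le[OF g])
    moreover have "J.proj (Suc n) f - J1.proj n f = J.proj (Suc n) g - J1.proj n g"
    proof -
      have "J.proj (Suc n) g = J.proj (Suc n) f - J.proj n f"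
        unfolding g_def[abs_def] using J.proj_in_polys_below by (intro J.proj_diff_poly f) (rule polys_below_mono, auto)
      moreover have "J1.proj n g = J1.proj n f - J.proj n f"
        unfolding g_def[abs_def] by (intro J1.proj_diff_poly f1 J.proj_in_polys_below)
      ultimately show ?thesis
        by simp
    qed
    ultimately have "jacobi_sqnorm a b (poly (J.proj (Suc n) f - J1.proj n f))
        \<le> 2 * jacobi_sqnorm a b g + 2 * (4 * (D * real n * jacobi_sqnorm a b g))"
      using J.sqnorm_poly_diff_le[of "J.proj (Suc n) g" "J1.proj n g"] by simp
    also have "\<dots> \<le> (2 + 8 * D) * real (Suc n) * jacobi_sqnorm a b g"
      using D sqnorm_nonneg[of "jacobi_measure a b" g] by (simp add: algebra_simps)
    finally show "jacobi_sqnorm a b (poly (J.proj (Suc n) f - J1.proj n f))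
        \<le> (2 + 8 * D) * real (Suc n) * jacobi_sqnorm a b (\<lambda>x. f x - poly (J.proj n f) x)"
      by (simp add: g_def[abs_def])
  qed
qed

lemma poly_funpow_pderiv_diff: "(pderiv ^^ i) (p - q) = (pderiv ^^ i) p - (pderiv ^^ i) (q :: real poly)"
  by (induction i) (simp_all add: pderiv_diff)

text \<open>
  The derivative of order \<open>j + 1\<close> of the error is the derivative of order \<open>j\<close> of the error for \<open>F 1\<close>, which the
  induction hypothesis covers with \<open>s - 1\<close> in place of \<open>s\<close>, plus the derivative of order \<open>j\<close> of the commutator
  \<open>Q\<close>, a polynomial to which the Markov inequality applies.
\<close>

lemma jacobi_derivative_rate:
  assumes ab: "a > -1" "b > -1" and "j \<le> s"
  shows "\<exists>C\<ge>0. jacobi_rate a b C j s"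
  using assms(3)
proof (induction j arbitrary: s)
  case 0
  show ?case
    by (rule jacobi_L2_rate[OF ab])
next
  case (Suc j)
  show ?case
  proof (cases s)
    case 0
    then show ?thesis
      using Suc.prems by simp
  next
    case (Suc s')
    obtain C1 where C1: "C1 \<ge> 0" "jacobi_rate a b C1 j s'"
      using Suc.IH[of s'] Suc.prems Suc by auto
    obtain C2 where C2: "C2 \<ge> 0" "jacobi_rate a b C2 0 s'"
      using jacobi_L2_rate[OF ab, of s'] by blast
    obtain C3 where C3: "C3 \<ge> 0" "\<And>n f. square_integrable (jacobi_measure a b) f \<Longrightarrow>
        jacobi_sqnorm a b (poly (jacobi_proj a b (Suc n) f - jacobi_proj (a + 1) (b + 1) n f))
        \<le> C3 * real (Suc n) * jacobi_sqnorm a b (\<lambda>x. f x - poly (jacobi_proj a b n f) x)"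
      using jacobi_commutator_bound[OF ab] by blast
    obtain C4 where C4: "C4 \<ge> 0" "\<And>n p. n \<ge> 1 \<Longrightarrow> p \<in> polys_below n \<Longrightarrow>
        jacobi_sqnorm a b (poly ((pderiv ^^ j) p)) \<le> C4 * real n ^ (4 * j) * jacobi_sqnorm a b (poly p)"
      using jacobi_Markov_iterated[OF ab, of j] by blast
    interpret J: orthogonal_polynomials "jacobi_measure a b" "jacobi_poly a b"
      using ab by (rule orthogonal_polynomials_jacobi)
    interpret J1: orthogonal_polynomials "jacobi_measure (a + 1) (b + 1)" "jacobi_poly (a + 1) (b + 1)"
      using ab by (intro orthogonal_polynomials_jacobi) auto
    define C where "C = 2 * C1 + 2 * (C4 * C3 * 4 ^ s' * C2)"
    show ?thesis
      unfolding jacobi_rate_def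
    proof (intro exI[of _ C] conjI allI impI)
      show "C \<ge> 0"
        using C1(1) C2(1) C3(1) C4(1) by (simp add: C_def)
      fix n and F :: "nat \<Rightarrow> real \<Rightarrow> real"
      assume sn: "s \<le> n"
        and F: "\<forall>i<s. ac_deriv (-1) 1 (F i) (F (Suc i))" and Fs: "square_integrable (jacobi_measure a b) (F s)"
      have js: "Suc j \<le> s" and n: "1 \<le> n"
        using Suc.prems sn by auto
      let ?N = "jacobi_sqnorm a b (F s)"
      have sqF: "square_integrable (jacobi_measure a b) (F i)" if "i \<le> s" for i
        using jacobi_chain_square_integrable[OF ab F Fs that] .
      have F1: "square_integrable (jacobi_measure a b) (F 1)"
        using sqF[of 1] js by simp
      define Q where "Q = J.proj n (F 1) - pderiv (J.proj n (F 0))"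
      have Q1: "Q = J.proj (Suc (n - 1)) (F 1) - J1.proj (n - 1) (F 1)"
        using F Suc n pderiv_jacobi_proj[OF ab, of "F 0" "F 1" n] square_integrable_jacobi_Suc(1)[OF F1]
        by (simp add: Q_def)
      have Qn: "Q \<in> polys_below n"
        unfolding Q_def using J.proj_in_polys_below[of n "F 0"] polys_below_pderiv[of "J.proj n (F 0)" n]
        by (intro polys_below_diff J.proj_in_polys_below) (rule polys_below_mono, auto)
      let ?E = "jacobi_sqnorm a b (\<lambda>x. F 1 x - poly (J.proj (n - 1) (F 1)) x)"
      have "real n ^ (2 * s') * jacobi_sqnorm a b (poly ((pderiv ^^ j) Q))
          \<le> real n ^ (2 * s') * (C4 * real n ^ (4 * j) * (C3 * real n * ?E))"
      proof (rule mult_left_mono)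
        have "jacobi_sqnorm a b (poly ((pderiv ^^ j) Q)) \<le> C4 * real n ^ (4 * j) * jacobi_sqnorm a b (poly Q)"
          by (intro C4(2) n Qn)
        also have "jacobi_sqnorm a b (poly Q) \<le> C3 * real n * ?E"
          unfolding Q1 using C3(2)[OF F1, of "n - 1"] n by simp
        finally show "jacobi_sqnorm a b (poly ((pderiv ^^ j) Q)) \<le> C4 * real n ^ (4 * j) * (C3 * real n * ?E)"
          using C4(1) by (simp add: mult_left_mono)
      qed simp
      also have "\<dots> = C4 * C3 * real n ^ (4 * j + 1) * (real n ^ (2 * s') * ?E)"
        by (simp add: mult_ac)
      also have "real n ^ (2 * s') * ?E \<le> 4 ^ s' * real (n - 1) ^ (2 * s') * ?E"
        using power_le_four_power_pred[of s' n] sn Suc by (intro mult_right_mono sqnorm_nonneg) auto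
      also have "\<dots> = 4 ^ s' * (real (n - 1) ^ (2 * s') * ?E)"
        by (simp only: mult.assoc)
      also have "real (n - 1) ^ (2 * s') * ?E \<le> C2 * ?N"
        using jacobi_rateD[OF C2(2), of "n - 1" "\<lambda>i. F (Suc i)"] sn Suc F Fs by simp
      finally have Qb: "real n ^ (2 * s') * jacobi_sqnorm a b (poly ((pderiv ^^ j) Q))
          \<le> C4 * C3 * real n ^ (4 * j + 1) * (4 ^ s' * (C2 * ?N))"
        using C3(1) C4(1) by (simp add: mult_left_mono)
      let ?G = "\<lambda>x. F (Suc j) x - poly ((pderiv ^^ j) (J.proj n (F 1))) x"
      have Gb: "real n ^ (2 * s') * jacobi_sqnorm a b ?G \<le> C1 * real n ^ (4 * j - 1) * ?N"
        using jacobi_rateD[OF C1(2), of n "\<lambda>i. F (Suc i)"] sn Suc F Fs by simp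
      have G: "square_integrable (jacobi_measure a b) ?G"
        using js by (intro square_integrable_diff sqF J.square_integrable_poly)
      have eq: "(\<lambda>x. F (Suc j) x - poly ((pderiv ^^ Suc j) (J.proj n (F 0))) x)
          = (\<lambda>x. ?G x + poly ((pderiv ^^ j) Q) x)"
        by (simp add: Q_def poly_funpow_pderiv_diff funpow_swap1)
      have "real n ^ (2 * s') * jacobi_error a b n F (Suc j)
          \<le> real n ^ (2 * s') * (2 * jacobi_sqnorm a b ?G + 2 * jacobi_sqnorm a b (poly ((pderiv ^^ j) Q)))"
        unfolding eq by (intro mult_left_mono sqnorm_add_le G J.square_integrable_poly) auto
      also have "\<dots> \<le> 2 * (C1 * real n ^ (4 * j - 1) * ?N) + 2 * (C4 * C3 * real n ^ (4 * j + 1) * (4 ^ s' * (C2 * ?N)))"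
        using Gb Qb by (simp add: algebra_simps)
      also have "C1 * real n ^ (4 * j - 1) * ?N \<le> C1 * real n ^ (4 * j + 1) * ?N"
        using n C1(1) by (intro mult_right_mono mult_left_mono power_increasing sqnorm_nonneg) auto
      finally have fin: "real n ^ (2 * s') * jacobi_error a b n F (Suc j)
          \<le> C * real n ^ (4 * j + 1) * ?N"
        by (simp add: C_def algebra_simps)
      have "real n ^ (2 * s) * jacobi_error a b n F (Suc j)
          = (real n)\<^sup>2 * (real n ^ (2 * s') * jacobi_error a b n F (Suc j))"
        unfolding Suc by (simp add: power2_eq_square)
      also have "\<dots> \<le> (real n)\<^sup>2 * (C * real n ^ (4 * j + 1) * ?N)"
        by (intro mult_left_mono fin) auto
      also have "\<dots> = C * real n ^ (4 * Suc j - 1) * ?N"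
        by (simp add: power2_eq_square eval_nat_numeral mult_ac)
      finally show "real n ^ (2 * s) * jacobi_error a b n F (Suc j)
          \<le> C * real n ^ (4 * Suc j - 1) * ?N" .
    qed
  qed
qed

lemma jacobi_derivative_rate_uniform:
  assumes ab: "a > -1" "b > -1"
  shows "\<exists>C\<ge>1. \<forall>s\<le>\<mu>. \<forall>j\<le>s. jacobi_rate a b C j s"
proof -
  have "\<exists>c. j \<le> s \<longrightarrow> 0 \<le> c \<and> jacobi_rate a b c j s" for j s
    using jacobi_derivative_rate[OF ab, of j s] by blast
  then obtain C where C: "\<And>j s. j \<le> s \<longrightarrow> 0 \<le> C j s \<and> jacobi_rate a b (C j s) j s"
    by metis
  define D where "D = 1 + (\<Sum>s\<le>\<mu>. \<Sum>j\<le>s. C j s)"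
  have nonneg: "0 \<le> (\<Sum>j\<le>s. C j s)" for s
    using C by (intro sum_nonneg) auto
  have "C j s \<le> D" if "j \<le> s" "s \<le> \<mu>" for j s
  proof -
    have "C j s \<le> (\<Sum>j\<le>s. C j s)"
      using that C by (intro member_le_sum) auto
    also have "\<dots> \<le> (\<Sum>s\<le>\<mu>. \<Sum>j\<le>s. C j s)"
      using that nonneg by (intro member_le_sum[of s "{..\<mu>}" "\<lambda>s. \<Sum>j\<le>s. C j s"]) auto
    finally show ?thesis
      by (simp add: D_def)
  qed
  then have "\<forall>s\<le>\<mu>. \<forall>j\<le>s. jacobi_rate a b D j s"
    using C jacobi_rate_mono by blast
  moreover have "D \<ge> 1"
    using nonneg by (simp add: D_def sum_nonneg)
  ultimately show ?thesis
    by blast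
qed

section \<open>Smooth functions with compact support\<close>

definition smooth :: "(real \<Rightarrow> real) \<Rightarrow> bool" where
  "smooth \<phi> \<longleftrightarrow> (\<forall>i t. (deriv ^^ i) \<phi> differentiable (at t))"

text \<open>
  It suffices to exhibit a class of functions that is closed under differentiation.
\<close>

lemma smooth_coinduct:
  assumes "\<phi> \<in> A" and "\<And>h. h \<in> A \<Longrightarrow> \<exists>h'\<in>A. \<forall>t. (h has_real_derivative h' t) (at t)"
  shows "smooth \<phi>"
proof -
  have *: "deriv h \<in> A" if h: "h \<in> A" for h
  proof -
    obtain h' where h': "h' \<in> A" "\<And>t. (h has_real_derivative h' t) (at t)"
      using assms(2)[OF h] by blast
    have "deriv h = h'"
      using h'(2) by (intro ext DERIV_imp_deriv)
    then show ?thesis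
      using h'(1) by simp
  qed
  have "(deriv ^^ i) \<phi> \<in> A" for i
    by (induction i) (use assms(1) * in auto)
  then show ?thesis
    unfolding smooth_def using assms(2) real_differentiable_def by blast
qed

lemma smooth_DERIV: "smooth \<phi> \<Longrightarrow> (\<phi> has_real_derivative deriv \<phi> t) (at t)"
  unfolding smooth_def DERIV_deriv_iff_real_differentiable by (metis funpow_0)

lemma smooth_deriv: "smooth \<phi> \<Longrightarrow> smooth (deriv \<phi>)"
  unfolding smooth_def by (metis funpow_swap1 funpow.simps(2) o_apply)

lemma smooth_deriv_funpow: "smooth \<phi> \<Longrightarrow> smooth ((deriv ^^ i) \<phi>)"
  by (induction i) (auto intro: smooth_deriv)

lemma smooth_antideriv:
  assumes "\<And>t. (\<phi> has_real_derivative \<psi> t) (at t)" "smooth \<psi>"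
  shows "smooth \<phi>"
  by (rule smooth_coinduct[where A = "insert \<phi> {h. smooth h}"])
    (use assms in \<open>auto intro: smooth_deriv smooth_DERIV\<close>)

lemma smooth_continuous_on: "smooth \<phi> \<Longrightarrow> continuous_on S \<phi>"
  using smooth_DERIV DERIV_continuous_on continuous_on_subset by (metis has_field_derivative_at_within)

lemma smooth_const: "smooth (\<lambda>x. c)"
  by (rule smooth_coinduct[where A = "range (\<lambda>c x. c)"]) (auto intro!: derivative_eq_intros)

text \<open>
  The smallest class that contains the products of smooth functions and is closed under sums; by the product rule
  it is closed under differentiation.
\<close>

inductive_set smooth_products :: "(real \<Rightarrow> real) set" where
  prod: "smooth f \<Longrightarrow> smooth g \<Longrightarrow> (\<lambda>x. f x * g x) \<in> smooth_products"
| add: "f \<in> smooth_products \<Longrightarrow> g \<in> smooth_products \<Longrightarrow> (\<lambda>x. f x + g x) \<in> smooth_products"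

lemma smooth_products_deriv:
  assumes "h \<in> smooth_products"
  shows "\<exists>h'\<in>smooth_products. \<forall>t. (h has_real_derivative h' t) (at t)"
  using assms
proof induction
  case (prod f g)
  have "(\<lambda>x. deriv f x * g x + f x * deriv g x) \<in> smooth_products"
    by (intro smooth_products.intros prod smooth_deriv)
  moreover have "((\<lambda>x. f x * g x) has_real_derivative deriv f t * g t + f t * deriv g t) (at t)" for t
    using DERIV_mult[OF smooth_DERIV[OF prod(1)] smooth_DERIV[OF prod(2)], of t] by (simp add: mult.commute)
  ultimately show ?case
    by (intro bexI[of _ "\<lambda>x. deriv f x * g x + f x * deriv g x"]) auto
next
  case (add f g)
  then obtain f' g' where "f' \<in> smooth_products" "\<And>t. (f has_real_derivative f' t) (at t)"
    "g' \<in> smooth_products" "\<And>t. (g has_real_derivative g' t) (at t)"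
    by blast
  then show ?case
    by (intro bexI[of _ "\<lambda>t. f' t + g' t"]) (auto intro: smooth_products.add DERIV_add)
qed

lemma smooth_mult: "smooth f \<Longrightarrow> smooth g \<Longrightarrow> smooth (\<lambda>x. f x * g x)"
  using smooth_coinduct[OF smooth_products.prod smooth_products_deriv] .

lemma smooth_add:
  assumes "smooth f" "smooth g"
  shows "smooth (\<lambda>x. f x + g x)"
proof (rule smooth_coinduct[OF _ smooth_products_deriv])
  have "(\<lambda>x. f x * 1 + g x * 1) \<in> smooth_products"
    by (intro smooth_products.intros assms smooth_const)
  then show "(\<lambda>x. f x + g x) \<in> smooth_products"
    by simp
qed

lemma smooth_affine:
  assumes "smooth f"
  shows "smooth (\<lambda>x. f (c * x + d))"
proof (rule smooth_coinduct[where A = "{\<lambda>x. k * h (c * x + d) | k h. smooth h}"])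
  show "(\<lambda>x. f (c * x + d)) \<in> {\<lambda>x. k * h (c * x + d) |k h. smooth h}"
    using assms by (auto intro!: exI[of _ 1] exI[of _ f])
  fix h assume "h \<in> {\<lambda>x. k * h (c * x + d) |k h. smooth h}"
  then obtain k g where h: "h = (\<lambda>x. k * g (c * x + d))" and g: "smooth g"
    by blast
  have "(h has_real_derivative (k * c) * deriv g (c * t + d)) (at t)" for t
  proof -
    have "((\<lambda>x. g (c * x + d)) has_real_derivative deriv g (c * t + d) * c) (at t)"
      by (rule DERIV_chain2[OF smooth_DERIV[OF g]]) (auto intro!: derivative_eq_intros)
    from DERIV_cmult[OF this, of k] show ?thesis
      unfolding h by (simp add: mult_ac)
  qed
  then show "\<exists>h'\<in>{\<lambda>x. k * h (c * x + d) |k h. smooth h}. \<forall>t. (h has_real_derivative h' t) (at t)"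
    using smooth_deriv[OF g] by (intro bexI[of _ "\<lambda>t. (k * c) * deriv g (c * t + d)"]) auto
qed

text \<open>
  For \<open>p = 1\<close> this is the standard smooth function that vanishes exactly on the negative half line and at \<open>0\<close>.  The
  polynomial in \<open>1 / x\<close> makes the class closed under differentiation.
\<close>

definition flat_exp :: "real poly \<Rightarrow> real \<Rightarrow> real" where
  "flat_exp p x = (if x > 0 then poly p (1 / x) * exp (- (1 / x)) else 0)"

lemma poly_exp_neg_tendsto_0: "((\<lambda>y. poly p y * exp (- y)) \<longlongrightarrow> (0 :: real)) at_top"
proof -
  have "((\<lambda>y. \<Sum>i\<le>degree p. coeff p i * (y ^ i / exp y)) \<longlongrightarrow> (\<Sum>i\<le>degree p. coeff p i * 0)) at_top"
    by (intro tendsto_intros tendsto_power_div_exp_0)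
  then show ?thesis
    by (simp add: poly_altdef sum_distrib_right exp_minus divide_inverse mult.assoc)
qed

lemma flat_exp_deriv:
  "(flat_exp p has_real_derivative flat_exp ([:0, 0, 1:] * (p - pderiv p)) t) (at t)"
proof -
  consider "t > 0" | "t < 0" | "t = 0"
    by linarith
  then show ?thesis
  proof cases
    case 1
    have "((\<lambda>x. poly p (1 / x) * exp (- (1 / x))) has_real_derivative
        flat_exp ([:0, 0, 1:] * (p - pderiv p)) t) (at t)"
      using 1 by (auto intro!: derivative_eq_intros DERIV_chain2[OF poly_DERIV]
          simp: flat_exp_def field_simps power2_eq_square)
    then show ?thesis
      by (rule has_field_derivative_transform_within_open[of _ _ _ "{0<..}"]) (use 1 in \<open>auto simp: flat_exp_def\<close>)
  next
    case 2
    have "((\<lambda>x. 0) has_real_derivative flat_exp ([:0, 0, 1:] * (p - pderiv p)) t) (at t)"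
      using 2 by (simp add: flat_exp_def)
    then show ?thesis
      by (rule has_field_derivative_transform_within_open[of _ _ _ "{..<0}"]) (use 2 in \<open>auto simp: flat_exp_def\<close>)
  next
    case 3
    have "((\<lambda>x. poly ([:0, 1:] * p) (inverse x) * exp (- inverse x)) \<longlongrightarrow> 0) (at_right 0)"
      using filterlim_compose[OF poly_exp_neg_tendsto_0 filterlim_inverse_at_top_right] .
    then have "((\<lambda>h. (flat_exp p (0 + h) - flat_exp p 0) / h) \<longlongrightarrow> 0) (at_right 0)"
      by (rule Lim_transform_eventually)
        (auto simp: eventually_at_right_field flat_exp_def field_simps intro!: exI[of _ 1])
    moreover have "((\<lambda>h. (flat_exp p (0 + h) - flat_exp p 0) / h) \<longlongrightarrow> 0) (at_left 0)"
      by (rule Lim_transform_eventually[OF tendsto_const])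
        (auto simp: eventually_at_left_field flat_exp_def intro!: exI[of _ "-1"])
    ultimately have "((\<lambda>h. (flat_exp p (0 + h) - flat_exp p 0) / h) \<longlongrightarrow> 0) (at 0)"
      by (simp add: filterlim_split_at)
    then show ?thesis
      using 3 by (simp add: DERIV_def flat_exp_def)
  qed
qed

lemma smooth_flat_exp: "smooth (flat_exp p)"
  by (rule smooth_coinduct[where A = "range flat_exp"]) (use flat_exp_deriv in blast)+

text \<open>
  The scaling by \<open>n\<close> lets the bumps converge to the indicator of \<open>(c, d)\<close> while their supports stay in \<open>[c, d]\<close>.
\<close>

definition bump :: "real \<Rightarrow> real \<Rightarrow> nat \<Rightarrow> real \<Rightarrow> real" where
  "bump c d n x = flat_exp 1 (real (Suc n) * (x - c)) * flat_exp 1 (real (Suc n) * (d - x))"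

lemma bump_bounds: "0 \<le> bump c d n x" "bump c d n x \<le> 1"
  by (auto simp: bump_def flat_exp_def intro!: mult_le_one)

lemma bump_eq_0: "x \<notin> {c<..<d} \<Longrightarrow> bump c d n x = 0"
  by (auto simp: bump_def flat_exp_def zero_less_mult_iff)

lemma bump_pos: "x \<in> {c<..<d} \<Longrightarrow> 0 < bump c d n x"
  by (auto simp: bump_def flat_exp_def zero_less_mult_iff)

lemma smooth_bump: "smooth (bump c d n)"
proof -
  have "smooth (\<lambda>x. flat_exp 1 (real (Suc n) * x + (- real (Suc n) * c)) * flat_exp 1 (- real (Suc n) * x + real (Suc n) * d))"
    by (intro smooth_mult smooth_affine smooth_flat_exp)
  also have "(\<lambda>x. flat_exp 1 (real (Suc n) * x + (- real (Suc n) * c)) * flat_exp 1 (- real (Suc n) * x + real (Suc n) * d)) = bump c d n"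
    by (simp add: bump_def[abs_def] algebra_simps)
  finally show ?thesis .
qed

lemma bump_tendsto: "(\<lambda>n. bump c d n x) \<longlonglongrightarrow> indicator {c<..<d} x"
proof (cases "x \<in> {c<..<d}")
  case True
  have *: "(\<lambda>n. flat_exp 1 (real (Suc n) * y)) \<longlonglongrightarrow> 1" if "y > 0" for y
  proof -
    have "(\<lambda>n. exp (- (1 / y) * (1 / real (Suc n)))) \<longlonglongrightarrow> exp (- (1 / y) * 0)"
      by (intro tendsto_intros LIMSEQ_Suc lim_1_over_n)
    moreover have "flat_exp 1 (real (Suc n) * y) = exp (- (1 / y) * (1 / real (Suc n)))" for n
      using that by (simp add: flat_exp_def del: of_nat_Suc)
    ultimately show ?thesis
      by simp
  qed
  show ?thesis
    using True tendsto_mult[OF *[of "x - c"] *[of "d - x"]] by (simp add: bump_def)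
qed (simp add: bump_eq_0)

lemma test_function_iff:
  "test_function S \<phi> \<longleftrightarrow> smooth \<phi> \<and> (\<exists>K. compact K \<and> K \<subseteq> S \<and> (\<forall>t. t \<notin> K \<longrightarrow> \<phi> t = 0))"
  by (simp add: test_function_def smooth_def)

lemma test_function_bump: "{c..d} \<subseteq> S \<Longrightarrow> test_function S (bump c d n)"
  unfolding test_function_iff using smooth_bump
  by (intro conjI exI[of _ "{c..d}"]) (auto intro!: bump_eq_0)

lemma deriv_eq_0_outside:
  fixes \<phi> :: "real \<Rightarrow> real"
  assumes "compact K" "\<And>t. t \<notin> K \<Longrightarrow> \<phi> t = 0" "t \<notin> K"
  shows "deriv \<phi> t = 0"
proof -
  have "((\<lambda>x. 0) has_real_derivative 0) (at t)"
    by simp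
  then have "(\<phi> has_real_derivative 0) (at t)"
    by (rule has_field_derivative_transform_within_open[of _ _ _ "- K"])
      (use assms in \<open>auto simp: compact_imp_closed open_Compl\<close>)
  then show ?thesis
    by (rule DERIV_imp_deriv)
qed

lemma deriv_funpow_eq_0_outside:
  fixes \<phi> :: "real \<Rightarrow> real"
  assumes "compact K" "\<And>t. t \<notin> K \<Longrightarrow> \<phi> t = 0" "t \<notin> K"
  shows "(deriv ^^ i) \<phi> t = 0"
  using assms(3)
proof (induction i arbitrary: t)
  case (Suc i)
  then show ?case
    using deriv_eq_0_outside[OF assms(1), of "(deriv ^^ i) \<phi>" t] by simp
qed (use assms(2) in auto)

lemma test_function_deriv: "test_function S \<phi> \<Longrightarrow> test_function S (deriv \<phi>)"
  unfolding test_function_iff using smooth_deriv deriv_eq_0_outside by blast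

section \<open>Uniqueness of weak derivatives\<close>

text \<open>
  The sets over which the integral vanishes form a Dynkin system that contains all half lines.
\<close>

lemma AE_eq_0_if_interval_integrals_eq_0:
  fixes g :: "real \<Rightarrow> real"
  assumes g: "g absolutely_integrable_on {c..d}"
    and zero: "\<And>x y. c \<le> x \<Longrightarrow> x \<le> y \<Longrightarrow> y \<le> d \<Longrightarrow> integral {x..y} g = 0"
  shows "AE t in lebesgue. t \<in> {c..d} \<longrightarrow> g t = 0"
proof -
  define h where "h t = indicator {c..d} t * g t" for t
  have h: "integrable lebesgue h"
    using g by (simp add: set_integrable_def h_def[abs_def])
  have hA: "integrable lebesgue (\<lambda>t. indicator A t * h t)" if "A \<in> sets lebesgue" for A
    using integrable_mult_indicator[OF that h] by simp
  have atMost: "(LINT t:{..x}|lebesgue. h t) = 0" for x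
  proof -
    have i: "g absolutely_integrable_on {c..min x d}"
      by (rule set_integrable_subset[OF g]) auto
    have "(LINT t:{..x}|lebesgue. h t) = (LINT t:{c..min x d}|lebesgue. g t)"
      unfolding set_lebesgue_integral_def
      by (intro Bochner_Integration.integral_cong) (auto simp: h_def indicator_def)
    also have "\<dots> = integral {c..min x d} g"
      by (rule set_lebesgue_integral_eq_integral(2)[OF i])
    also have "\<dots> = 0"
      using zero[of c "min x d"] by (cases "c \<le> min x d") auto
    finally show ?thesis .
  qed
  have total: "(LINT t|lebesgue. h t) = 0"
  proof -
    have "(LINT t|lebesgue. h t) = (LINT t:{..d}|lebesgue. h t)"
      unfolding set_lebesgue_integral_def
      by (intro Bochner_Integration.integral_cong) (auto simp: h_def indicator_def)
    then show ?thesis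
      by (simp add: atMost)
  qed
  have borel: "(LINT t:A|lebesgue. h t) = 0" if "A \<in> sets borel" for A :: "real set"
  proof -
    have "A \<in> sigma_sets UNIV (range (\<lambda>a :: real. {..a}))"
      using that by (simp add: borel_eq_atMost)
    then show ?thesis
    proof (rule sigma_sets_induct_disjoint[rotated 2])
      show "Int_stable (range (\<lambda>a :: real. {..a}))"
        by (auto simp: Int_stable_def)
    next
      fix A assume "A \<in> range (\<lambda>a :: real. {..a})"
      then show "(LINT t:A|lebesgue. h t) = 0"
        using atMost by auto
    next
      fix A assume A: "A \<in> sigma_sets UNIV (range (\<lambda>a :: real. {..a}))" "(LINT t:A|lebesgue. h t) = 0"
      then have "A \<in> sets lebesgue"
        using sets_completionI_sets[of A lborel] by (simp add: borel_eq_atMost)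
      have "(LINT t:UNIV - A|lebesgue. h t) = (LINT t|lebesgue. h t - indicator A t * h t)"
        unfolding set_lebesgue_integral_def
        by (intro Bochner_Integration.integral_cong) (auto simp: indicator_def)
      also have "\<dots> = (LINT t|lebesgue. h t) - (LINT t:A|lebesgue. h t)"
        using h hA[OF \<open>A \<in> sets lebesgue\<close>] by (simp add: set_lebesgue_integral_def)
      finally show "(LINT t:UNIV - A|lebesgue. h t) = 0"
        using A(2) total by simp
    next
      fix A :: "nat \<Rightarrow> real set"
      assume A: "disjoint_family A" "range A \<subseteq> sigma_sets UNIV (range (\<lambda>a :: real. {..a}))"
        "\<And>i. (LINT t:A i|lebesgue. h t) = 0"
      have Al: "A i \<in> sets lebesgue" for i
      proof -
        have "A i \<in> sigma_sets UNIV (range (\<lambda>a :: real. {..a}))"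
          using A(2) by blast
        then show ?thesis
          using sets_completionI_sets[of "A i" lborel] by (simp add: borel_eq_atMost)
      qed
      have "(LINT t:(\<Union>i. A i)|lebesgue. h t) = (\<Sum>i. LINT t:A i|lebesgue. h t)"
        using A(1) Al h
        by (intro lebesgue_integral_countable_add)
          (auto simp: disjoint_family_on_def set_integrable_def intro!: hA[simplified])
      then show "(LINT t:(\<Union>i. A i)|lebesgue. h t) = 0"
        by (simp add: A(3))
    qed (auto simp: set_lebesgue_integral_def)
  qed
  have "AE t in lebesgue. h t = 0"
  proof (rule density_unique_real[OF h])
    show "integrable lebesgue (\<lambda>t :: real. 0 :: real)"
      by simp
    fix A :: "real set" assume "A \<in> sets lebesgue"
    then obtain B N where BN: "B \<in> sets borel" "negligible N" "B \<union> N = A"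
      using sets_lebesgue_almost_borel by blast
    have N: "N \<in> null_sets lebesgue"
      using BN(2) by (simp add: negligible_iff_null_sets)
    have "(LINT t:A|lebesgue. h t) = (LINT t:B|lebesgue. h t)"
    proof (rule set_integral_cong_set)
      show "AE x in lebesgue. (x \<in> B) = (x \<in> A)"
        using AE_not_in[OF N] by (rule AE_mp) (use BN(3) in auto)
      have "B \<in> sets lebesgue"
        using BN(1) by simp
      then show "set_borel_measurable lebesgue B h" "set_borel_measurable lebesgue A h"
        using hA \<open>A \<in> sets lebesgue\<close> by (auto simp: set_borel_measurable_def)
    qed
    then show "(LINT t:A|lebesgue. h t) = (LINT t:A|lebesgue. 0)"
      using borel[OF BN(1)] by simp
  qed
  then show ?thesis
    by eventually_elim (auto simp: h_def)
qed

lemma set_integral_supported: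
  assumes "{c..d} \<subseteq> S" "\<And>t. t \<notin> {c..d} \<Longrightarrow> \<phi> t = (0 :: real)"
  shows "(LINT t:S|lebesgue. g t * \<phi> t) = (LINT t:{c..d}|lebesgue. g t * \<phi> t)"
  unfolding set_lebesgue_integral_def
  by (intro Bochner_Integration.integral_cong) (use assms in \<open>auto simp: indicator_def\<close>)

text \<open>
  Testing with the bumps on a subinterval and dominated convergence give vanishing integrals over all subintervals.
\<close>

lemma fundamental_lemma_calculus_of_variations:
  assumes g: "locally_integrable S g"
    and zero: "\<And>\<phi>. test_function S \<phi> \<Longrightarrow> (LINT t:S|lebesgue. g t * \<phi> t) = 0"
    and sub: "{c..d} \<subseteq> S"
  shows "AE t in lebesgue. t \<in> {c..d} \<longrightarrow> g t = 0"
proof (rule AE_eq_0_if_interval_integrals_eq_0)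
  show "g absolutely_integrable_on {c..d}"
    using g sub by (simp add: locally_integrable_def)
  fix x y assume xy: "c \<le> x" "x \<le> y" "y \<le> d"
  have sub': "{x..y} \<subseteq> S"
    using sub xy by auto
  then have gi: "g absolutely_integrable_on {x..y}"
    using g by (simp add: locally_integrable_def)
  define h where "h t = indicator {x..y} t * g t" for t
  have h: "integrable lebesgue h"
    using gi by (simp add: set_integrable_def h_def[abs_def])
  have [measurable]: "{x<..<y} \<in> sets lebesgue" "h \<in> borel_measurable lebesgue"
    using h by auto
  have [measurable]: "bump x y n \<in> borel_measurable lebesgue" for n
    using borel_measurable_continuous_onI[OF smooth_continuous_on[OF smooth_bump]]
    by (intro measurable_completion) simp
  have "(\<lambda>n. LINT t|lebesgue. h t * bump x y n t) \<longlonglongrightarrow> (LINT t|lebesgue. h t * indicator {x<..<y} t)"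
  proof (rule integral_dominated_convergence)
    show "integrable lebesgue (\<lambda>t. \<bar>h t\<bar>)"
      using h by simp
    show "AE t in lebesgue. (\<lambda>n. h t * bump x y n t) \<longlonglongrightarrow> h t * indicator {x<..<y} t"
      by (intro AE_I2 tendsto_intros bump_tendsto)
    show "AE t in lebesgue. norm (h t * bump x y n t) \<le> \<bar>h t\<bar>" for n
      using bump_bounds[of x y n] by (auto simp: abs_mult mult_left_le)
  qed (use h in auto)
  moreover have "(LINT t|lebesgue. h t * bump x y n t) = 0" for n
  proof -
    have "(LINT t|lebesgue. h t * bump x y n t) = (LINT t:{x..y}|lebesgue. g t * bump x y n t)"
      by (simp add: set_lebesgue_integral_def h_def mult.assoc)
    also have "\<dots> = (LINT t:S|lebesgue. g t * bump x y n t)"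
      by (rule set_integral_supported[symmetric, OF sub']) (auto intro!: bump_eq_0)
    also have "\<dots> = 0"
      by (intro zero test_function_bump sub')
    finally show ?thesis .
  qed
  ultimately have "(LINT t|lebesgue. h t * indicator {x<..<y} t) = 0"
    by (simp add: LIMSEQ_const_iff)
  also have "(LINT t|lebesgue. h t * indicator {x<..<y} t) = (LINT t:{x<..<y}|lebesgue. g t)"
    unfolding set_lebesgue_integral_def
    by (intro Bochner_Integration.integral_cong) (auto simp: h_def indicator_def)
  also have "\<dots> = integral {x<..<y} g"
    using gi by (intro set_lebesgue_integral_eq_integral) (simp add: absolutely_integrable_on_Icc_iff_Ioo)
  finally show "integral {x..y} g = 0"
    by (simp add: integral_open_interval_real)
qed

lemma AE_Ioo_if_AE_Icc:
  fixes a b :: real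
  assumes "\<And>c d. a < c \<Longrightarrow> d < b \<Longrightarrow> AE t in lebesgue. t \<in> {c..d} \<longrightarrow> Q t"
  shows "AE t in lebesgue. t \<in> {a<..<b} \<longrightarrow> Q t"
proof -
  have "AE t in lebesgue. \<forall>n. t \<in> {a + 1 / real (Suc n)..b - 1 / real (Suc n)} \<longrightarrow> Q t"
    unfolding AE_all_countable by (intro allI assms) auto
  then show ?thesis
  proof eventually_elim
    case (elim t)
    show ?case
    proof
      assume t: "t \<in> {a<..<b}"
      then have "min (t - a) (b - t) > 0"
        by auto
      then obtain n where "1 / real (Suc n) < min (t - a) (b - t)"
        using nat_approx_posE by blast
      then have "t \<in> {a + 1 / real (Suc n)..b - 1 / real (Suc n)}"
        by auto
      then show "Q t"
        using elim by blast
    qed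
  qed
qed

lemma set_integrable_mult_test_function:
  assumes g: "locally_integrable S g" and \<phi>: "test_function S \<phi>"
  shows "set_integrable lebesgue S (\<lambda>t. g t * (deriv ^^ i) \<phi> t)"
proof -
  obtain K where K: "compact K" "K \<subseteq> S" "\<And>t. t \<notin> K \<Longrightarrow> \<phi> t = 0" and s: "smooth \<phi>"
    using \<phi> unfolding test_function_iff by blast
  have zero: "(deriv ^^ i) \<phi> t = 0" if "t \<notin> K" for t
    by (rule deriv_funpow_eq_0_outside[OF K(1,3) that])
  have c: "continuous_on UNIV ((deriv ^^ i) \<phi>)"
    by (intro smooth_continuous_on smooth_deriv_funpow s)
  have gK: "g absolutely_integrable_on K"
    using g K by (simp add: locally_integrable_def)
  have "bounded ((deriv ^^ i) \<phi> ` K)"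
    by (intro compact_imp_bounded compact_continuous_image continuous_on_subset[OF c] K) auto
  moreover have "(deriv ^^ i) \<phi> \<in> borel_measurable (lebesgue_on K)"
    using borel_compact[OF K(1)]
    by (intro continuous_imp_measurable_on_sets_lebesgue continuous_on_subset[OF c]) auto
  ultimately have "(\<lambda>t. (deriv ^^ i) \<phi> t * g t) absolutely_integrable_on K"
    using gK borel_compact[OF K(1)] by (intro absolutely_integrable_bounded_measurable_product_real) auto
  moreover have "(\<lambda>t. indicat_real K t *\<^sub>R ((deriv ^^ i) \<phi> t * g t))
      = (\<lambda>t. indicator S t *\<^sub>R (g t * (deriv ^^ i) \<phi> t))"
    using K(2) zero by (auto simp: indicator_def fun_eq_iff)
  ultimately show ?thesis
    unfolding set_integrable_def by (simp only:)
qed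

lemma locally_integrable_diff:
  "locally_integrable S f \<Longrightarrow> locally_integrable S g \<Longrightarrow> locally_integrable S (\<lambda>t. f t - g t)"
  by (auto simp: locally_integrable_def)

lemma has_weak_derivD:
  "has_weak_deriv S j u v \<Longrightarrow> test_function S \<phi> \<Longrightarrow>
     (LINT t:S|lebesgue. u t * (deriv ^^ j) \<phi> t) = (-1) ^ j * (LINT t:S|lebesgue. v t * \<phi> t)"
  unfolding has_weak_deriv_def by blast

lemma weak_deriv_unique:
  assumes "has_weak_deriv S j u v" "has_weak_deriv S j u v'" "{a<..<b} \<subseteq> S"
  shows "AE t in lebesgue. t \<in> {a<..<b} \<longrightarrow> v t = v' t"
proof (rule AE_Ioo_if_AE_Icc)
  fix c d assume "a < c" "d < b"
  then have "{c..d} \<subseteq> S"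
    using assms(3) by auto
  have loc: "locally_integrable S v" "locally_integrable S v'"
    using assms by (auto simp: has_weak_deriv_def)
  have "AE t in lebesgue. t \<in> {c..d} \<longrightarrow> v t - v' t = 0"
  proof (rule fundamental_lemma_calculus_of_variations[OF _ _ \<open>{c..d} \<subseteq> S\<close>])
    show "locally_integrable S (\<lambda>t. v t - v' t)"
      by (intro locally_integrable_diff loc)
    fix \<phi> assume \<phi>: "test_function S \<phi>"
    have "(-1) ^ j * (LINT t:S|lebesgue. v t * \<phi> t) = (-1) ^ j * (LINT t:S|lebesgue. v' t * \<phi> t)"
      using has_weak_derivD[OF assms(1) \<phi>] has_weak_derivD[OF assms(2) \<phi>] by simp
    then have "(LINT t:S|lebesgue. v t * \<phi> t) = (LINT t:S|lebesgue. v' t * \<phi> t)"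
      by simp
    then show "(LINT t:S|lebesgue. (v t - v' t) * \<phi> t) = 0"
      using set_integrable_mult_test_function[OF loc(1) \<phi>, of 0] set_integrable_mult_test_function[OF loc(2) \<phi>, of 0]
      by (simp add: left_diff_distrib)
  qed
  then show "AE t in lebesgue. t \<in> {c..d} \<longrightarrow> v t = v' t"
    by eventually_elim auto
qed

lemma weak_deriv_AE_eq:
  assumes "has_weak_deriv S j u v" "{a<..<b} \<subseteq> S"
  shows "AE t in lebesgue. t \<in> {a<..<b} \<longrightarrow> weak_deriv S j u t = v t"
proof -
  have "has_weak_deriv S j u (weak_deriv S j u)"
    unfolding weak_deriv_def using assms(1) by (rule someI[of "has_weak_deriv S j u"])
  then show ?thesis
    using assms by (rule weak_deriv_unique)
qed

lemma ac_deriv_smooth: "smooth \<phi> \<Longrightarrow> a \<le> b \<Longrightarrow> ac_deriv a b \<phi> (deriv \<phi>)"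
  by (intro ac_derivI smooth_continuous_on smooth_DERIV absolutely_integrable_continuous_real smooth_deriv)

lemma ac_deriv_iterated_by_parts:
  assumes "a \<le> b" "\<And>i. i < j \<Longrightarrow> ac_deriv a b (G i) (G (Suc i))"
    and "smooth \<phi>" "\<And>i. (deriv ^^ i) \<phi> a = 0" "\<And>i. (deriv ^^ i) \<phi> b = 0"
  shows "integral {a..b} (\<lambda>t. G 0 t * (deriv ^^ j) \<phi> t) = (-1) ^ j * integral {a..b} (\<lambda>t. G j t * \<phi> t)"
  using assms(2)
proof (induction j arbitrary: G)
  case (Suc j)
  have "integral {a..b} (\<lambda>t. G 0 t * (deriv ^^ Suc j) \<phi> t) + integral {a..b} (\<lambda>t. G 1 t * (deriv ^^ j) \<phi> t) = 0"
    using ac_deriv_by_parts[OF assms(1) Suc.prems[of 0] ac_deriv_smooth[OF smooth_deriv_funpow[OF assms(3), of j] assms(1)]]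
    by (simp add: assms(4,5))
  moreover have "integral {a..b} (\<lambda>t. G 1 t * (deriv ^^ j) \<phi> t) = (-1) ^ j * integral {a..b} (\<lambda>t. G (Suc j) t * \<phi> t)"
    using Suc.IH[of "\<lambda>i. G (Suc i)"] Suc.prems by simp
  ultimately show ?case
    by simp
qed simp

section \<open>Weak derivatives and absolute continuity\<close>

lemma LINT_Ioo_eq_integral:
  fixes f :: "real \<Rightarrow> real"
  assumes "f absolutely_integrable_on {a..b}"
  shows "(LINT t:{a<..<b}|lebesgue. f t) = integral {a..b} f"
proof -
  have "(LINT t:{a<..<b}|lebesgue. f t) = integral {a<..<b} f"
    using assms by (intro set_lebesgue_integral_eq_integral) (simp add: absolutely_integrable_on_Icc_iff_Ioo)
  then show ?thesis
    by (simp add: integral_open_interval_real)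
qed

lemma absolutely_integrable_cong_AE:
  fixes f g :: "real \<Rightarrow> real"
  assumes f: "f absolutely_integrable_on {a..b}" and eq: "AE t in lebesgue. t \<in> {a<..<b} \<longrightarrow> g t = f t"
  shows "g absolutely_integrable_on {a..b}" "integral {a..b} g = integral {a..b} f"
proof -
  obtain N where N0: "{t \<in> space lebesgue. \<not> (t \<in> {a<..<b} \<longrightarrow> g t = f t)} \<subseteq> N"
    and "emeasure lebesgue N = 0" "N \<in> sets lebesgue"
    by (rule AE_E[OF eq])
  then have "N \<in> null_sets lebesgue"
    by (intro null_setsI)
  moreover have "{t. \<not> (t \<in> {a<..<b} \<longrightarrow> g t = f t)} \<subseteq> N"
    using N0 by simp
  ultimately have N: "N \<in> null_sets lebesgue" "{t. \<not> (t \<in> {a<..<b} \<longrightarrow> g t = f t)} \<subseteq> N"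
    by blast+
  have neg: "negligible (N \<union> {a, b})"
    using N(1) by (auto simp: negligible_iff_null_sets[symmetric] intro: negligible_Un negligible_finite)
  have *: "g x = f x" if "x \<in> {a..b} - (N \<union> {a, b})" for x
  proof -
    have "x \<in> {a<..<b}" "x \<notin> N"
      using that by auto
    then show ?thesis
      using N(2) by blast
  qed
  show "g absolutely_integrable_on {a..b}"
    using f neg * by (rule absolutely_integrable_spike)
  show "integral {a..b} g = integral {a..b} f"
    using neg * by (intro integral_spike[OF neg]) auto
qed

lemma test_function_support:
  assumes "test_function {a<..<b} \<phi>" "a < b"
  shows "\<exists>c d. a < c \<and> d < b \<and> (\<forall>t. t \<notin> {c..d} \<longrightarrow> \<phi> t = 0)"
proof -
  obtain K where K: "compact K" "K \<subseteq> {a<..<b}" "\<And>t. t \<notin> K \<Longrightarrow> \<phi> t = 0"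
    using assms(1) unfolding test_function_iff by blast
  show ?thesis
  proof (cases "K = {}")
    case True
    then show ?thesis
      using K(3) assms(2) by (intro exI[of _ "(a + b) / 2"]) auto
  next
    case False
    obtain c where c: "c \<in> K" "\<And>t. t \<in> K \<Longrightarrow> c \<le> t"
      using compact_attains_inf[OF K(1) False] by blast
    obtain d where d: "d \<in> K" "\<And>t. t \<in> K \<Longrightarrow> t \<le> d"
      using compact_attains_sup[OF K(1) False] by blast
    have "a < c" "d < b"
      using K(2) c(1) d(1) by auto
    moreover have "\<phi> t = 0" if "t \<notin> {c..d}" for t
      using K(3)[of t] c(2)[of t] d(2)[of t] that by (cases "t \<in> K") auto
    ultimately show ?thesis
      by blast
  qed
qed

lemma test_function_lincomb:
  assumes "test_function S \<phi>" "test_function S \<psi>"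
  shows "test_function S (\<lambda>t. \<phi> t + c * \<psi> t)"
proof -
  obtain K where K: "compact K" "K \<subseteq> S" "\<And>t. t \<notin> K \<Longrightarrow> \<phi> t = 0" and "smooth \<phi>"
    using assms(1) unfolding test_function_iff by blast
  moreover obtain L where L: "compact L" "L \<subseteq> S" "\<And>t. t \<notin> L \<Longrightarrow> \<psi> t = 0" and "smooth \<psi>"
    using assms(2) unfolding test_function_iff by blast
  ultimately show ?thesis
    unfolding test_function_iff
    by (intro conjI smooth_add smooth_mult smooth_const exI[of _ "K \<union> L"]) auto
qed

text \<open>
  The primitive from the left endpoint vanishes to the left of the support, and to its right because the total integral is zero.
\<close>

lemma test_function_primitive:
  assumes \<psi>: "test_function {a<..<b} \<psi>" and ab: "a < b" and zero: "integral {a..b} \<psi> = 0"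
  shows "\<exists>\<eta>. test_function {a<..<b} \<eta> \<and> deriv \<eta> = \<psi>"
proof -
  obtain c d where cd: "a < c" "d < b" and supp: "\<And>t. t \<notin> {c..d} \<Longrightarrow> \<psi> t = 0"
    using test_function_support[OF \<psi> ab] by blast
  have smooth: "smooth \<psi>"
    using \<psi> by (simp add: test_function_iff)
  then have cont: "continuous_on S \<psi>" for S
    by (rule smooth_continuous_on)
  define \<eta> where "\<eta> x = integral {a..x} \<psi>" for x
  have left: "\<eta> x = 0" if "x < c" for x
  proof -
    have "integral {a..x} \<psi> = integral {a..x} (\<lambda>t. 0)"
      using that by (intro Henstock_Kurzweil_Integration.integral_cong supp) auto
    then show ?thesis
      by (simp add: \<eta>_def)
  qed
  have right: "\<eta> x = 0" if "d < x" for x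
  proof (cases "x < c")
    case False
    define m where "m = max x b"
    have combine: "integral {a..y} \<psi> + integral {y..m} \<psi> = integral {a..m} \<psi>" if "a \<le> y" "y \<le> m" for y
      using that by (intro Henstock_Kurzweil_Integration.integral_combine integrable_continuous_real cont) auto
    have vanish: "integral {y..m} \<psi> = 0" if "d < y" for y
    proof -
      have "integral {y..m} \<psi> = integral {y..m} (\<lambda>t. 0)"
        using that by (intro Henstock_Kurzweil_Integration.integral_cong supp) auto
      then show ?thesis
        by simp
    qed
    have "integral {a..x} \<psi> = integral {a..m} \<psi>"
      using combine[of x] vanish[of x] False cd that by (simp add: m_def)
    also have "\<dots> = integral {a..b} \<psi>"
      using combine[of b] vanish[of b] cd ab by (simp add: m_def)
    finally show ?thesis
      using zero by (simp add: \<eta>_def)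
  qed (rule left)
  have der: "(\<eta> has_real_derivative \<psi> x) (at x)" for x
  proof (cases "x < c")
    case True
    have "((\<lambda>x. 0) has_real_derivative \<psi> x) (at x)"
      using True supp[of x] by simp
    then show ?thesis
      by (rule has_field_derivative_transform_within_open[of _ _ _ "{..<c}"]) (use True left in auto)
  next
    case False
    then have "(\<eta> has_real_derivative \<psi> x) (at x within {a..x + 1})"
      unfolding \<eta>_def[abs_def] using cd by (intro integral_has_real_derivative cont) auto
    then show ?thesis
      using False cd by (simp add: at_within_Icc_at)
  qed
  have "test_function {a<..<b} \<eta>"
    unfolding test_function_iff
    using smooth_antideriv[OF der smooth] left right cd
    by (intro conjI exI[of _ "{c..d}"]) (auto simp: not_le)
  moreover have "deriv \<eta> = \<psi>"
    using der by (intro ext DERIV_imp_deriv)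
  ultimately show ?thesis
    by blast
qed

lemma test_function_integral_eq:
  assumes "test_function {a<..<b} \<phi>"
  shows "(LINT t:{a<..<b}|lebesgue. \<phi> t) = integral {a..b} \<phi>"
  using assms by (intro LINT_Ioo_eq_integral absolutely_integrable_continuous_real smooth_continuous_on)
    (simp add: test_function_iff)

text \<open>
  The difference \<open>g\<close> of \<open>v\<close> and a primitive of \<open>w\<close> is orthogonal to all derivatives of test functions, that is, to all test
  functions with integral zero.  Subtracting from a test function a multiple of a fixed bump \<open>\<theta>\<close> makes the
  integral zero, so \<open>g\<close> minus a constant is orthogonal to all test functions.
\<close>

lemma du_Bois_Reymond:
  assumes ab: "a < b" and v: "locally_integrable {a<..<b} v" and w: "w absolutely_integrable_on {a..b}"
    and weak: "\<And>\<phi>. test_function {a<..<b} \<phi> \<Longrightarrow>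
      (LINT t:{a<..<b}|lebesgue. v t * deriv \<phi> t) = - (LINT t:{a<..<b}|lebesgue. w t * \<phi> t)"
  shows "\<exists>f. ac_deriv a b f w \<and> (AE t in lebesgue. t \<in> {a<..<b} \<longrightarrow> v t = f t)"
proof -
  let ?S = "{a<..<b}"
  define W where "W x = integral {a..x} w" for x
  have W: "ac_deriv a b W w"
    unfolding ac_deriv_def using w by (simp add: W_def)
  have Wc: "continuous_on {a..b} W"
    by (rule ac_deriv_continuous_on[OF W])
  define g where "g t = v t - W t" for t
  have Wloc: "locally_integrable ?S W"
    unfolding locally_integrable_def
  proof (intro allI impI)
    fix K assume K: "compact K \<and> K \<subseteq> ?S"
    have "W absolutely_integrable_on {a..b}"
      by (rule absolutely_integrable_continuous_real[OF Wc])
    then show "W absolutely_integrable_on K"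
      by (rule set_integrable_subset) (use K borel_compact[of K] in auto)
  qed
  have g: "locally_integrable ?S g"
    unfolding g_def[abs_def] by (intro locally_integrable_diff v Wloc)
  have gi: "set_integrable lebesgue ?S (\<lambda>t. g t * \<phi> t)" if "test_function ?S \<phi>" for \<phi>
    using set_integrable_mult_test_function[OF g that, of 0] by simp
  have orth: "(LINT t:?S|lebesgue. g t * deriv \<phi> t) = 0" if \<phi>: "test_function ?S \<phi>" for \<phi>
  proof -
    have s: "smooth \<phi>"
      using \<phi> by (simp add: test_function_iff)
    obtain c d where cd: "a < c" "d < b" and supp: "\<And>t. t \<notin> {c..d} \<Longrightarrow> \<phi> t = 0"
      using test_function_support[OF \<phi> ab] by blast
    have i1: "(\<lambda>t. W t * deriv \<phi> t) absolutely_integrable_on {a..b}"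
      by (intro absolutely_integrable_continuous_real continuous_intros Wc smooth_continuous_on smooth_deriv s)
    have "(\<lambda>t. \<phi> t * w t) absolutely_integrable_on {a..b}"
      by (intro absolutely_integrable_mult_continuous smooth_continuous_on s w)
    then have i2: "(\<lambda>t. w t * \<phi> t) absolutely_integrable_on {a..b}"
      by (simp add: mult.commute)
    have "integral {a..b} (\<lambda>t. W t * deriv \<phi> t) + integral {a..b} (\<lambda>t. w t * \<phi> t) = 0"
      using ac_deriv_by_parts[OF _ W ac_deriv_smooth[OF s]] ab supp[of a] supp[of b] cd by simp
    then have "(LINT t:?S|lebesgue. W t * deriv \<phi> t) = (LINT t:?S|lebesgue. v t * deriv \<phi> t)"
      unfolding weak[OF \<phi>] LINT_Ioo_eq_integral[OF i1] LINT_Ioo_eq_integral[OF i2] by simp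
    then show ?thesis
      using set_integrable_mult_test_function[OF v \<phi>, of 1] set_integrable_mult_test_function[OF Wloc \<phi>, of 1]
      by (simp add: g_def left_diff_distrib)
  qed
  define \<theta> where "\<theta> = bump ((2 * a + b) / 3) ((a + 2 * b) / 3) 0"
  have \<theta>: "test_function ?S \<theta>"
    unfolding \<theta>_def using ab by (intro test_function_bump) auto
  define I where "I = integral {a..b} \<theta>"
  have "I \<noteq> 0"
  proof
    assume "I = 0"
    have "\<forall>x\<in>{a..b}. \<theta> x = 0"
      using \<open>I = 0\<close> ab unfolding I_def
      by (subst (asm) integral_eq_0_iff) (auto simp: \<theta>_def bump_bounds intro: smooth_continuous_on smooth_bump)
    moreover have "\<theta> ((a + b) / 2) > 0"
      unfolding \<theta>_def using ab by (intro bump_pos) (auto simp: field_simps)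
    ultimately show False
      using ab by auto
  qed
  define \<kappa> where "\<kappa> = (LINT t:?S|lebesgue. g t * \<theta> t) / I"
  have const: "locally_integrable ?S (\<lambda>t. \<kappa>)"
    unfolding locally_integrable_def
    by (auto intro!: absolutely_integrable_on_const lmeasurable_compact)
  have "AE t in lebesgue. t \<in> ?S \<longrightarrow> g t - \<kappa> = 0"
  proof (rule AE_Ioo_if_AE_Icc)
    fix c d assume "a < c" "d < b"
    then have sub: "{c..d} \<subseteq> ?S"
      by auto
    show "AE t in lebesgue. t \<in> {c..d} \<longrightarrow> g t - \<kappa> = 0"
    proof (rule fundamental_lemma_calculus_of_variations[OF _ _ sub])
      show "locally_integrable ?S (\<lambda>t. g t - \<kappa>)"
        by (intro locally_integrable_diff g const)
      fix \<psi> assume \<psi>: "test_function ?S \<psi>"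
      define s where "s = integral {a..b} \<psi>"
      define \<zeta> where "\<zeta> t = \<psi> t + (- (s / I)) * \<theta> t" for t
      have \<zeta>: "test_function ?S \<zeta>"
        unfolding \<zeta>_def[abs_def] by (intro test_function_lincomb \<psi> \<theta>)
      have int: "f integrable_on {a..b}" if "test_function ?S f" for f
        using that by (intro integrable_continuous_real smooth_continuous_on) (simp add: test_function_iff)
      have "integral {a..b} \<zeta> = s + (- (s / I)) * I"
        unfolding \<zeta>_def
        using Henstock_Kurzweil_Integration.integral_add[OF int[OF \<psi>] integrable_on_mult_right[OF int[OF \<theta>], of "- (s / I)"]]
        by (simp add: s_def[symmetric] I_def[symmetric])
      then have "integral {a..b} \<zeta> = 0"
        using \<open>I \<noteq> 0\<close> by simp
      then obtain \<eta> where \<eta>: "test_function ?S \<eta>" "deriv \<eta> = \<zeta>"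
        using test_function_primitive[OF \<zeta> ab] by blast
      have "0 = (LINT t:?S|lebesgue. g t * \<zeta> t)"
        using orth[OF \<eta>(1)] unfolding \<eta>(2) by simp
      also have "\<dots> = (LINT t:?S|lebesgue. g t * \<psi> t - (s / I) * (g t * \<theta> t))"
        unfolding \<zeta>_def by (simp add: algebra_simps)
      also have "\<dots> = (LINT t:?S|lebesgue. g t * \<psi> t) - (s / I) * (LINT t:?S|lebesgue. g t * \<theta> t)"
        using gi[OF \<psi>] gi[OF \<theta>] by (subst set_integral_diff) auto
      finally have "(LINT t:?S|lebesgue. g t * \<psi> t) = \<kappa> * s"
        by (simp add: \<kappa>_def)
      moreover have "(LINT t:?S|lebesgue. \<kappa> * \<psi> t) = \<kappa> * s"
        using test_function_integral_eq[OF \<psi>] by (simp add: s_def)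
      moreover have "set_integrable lebesgue ?S (\<lambda>t. \<kappa> * \<psi> t)"
        using set_integrable_mult_test_function[OF const \<psi>, of 0] by simp
      ultimately show "(LINT t:?S|lebesgue. (g t - \<kappa>) * \<psi> t) = 0"
        using gi[OF \<psi>] unfolding left_diff_distrib by (subst set_integral_diff(2)) auto
    qed
  qed
  then have "AE t in lebesgue. t \<in> ?S \<longrightarrow> v t = W t + \<kappa>"
    by eventually_elim (auto simp: g_def)
  moreover have "ac_deriv a b (\<lambda>t. W t + \<kappa>) w"
    unfolding ac_deriv_def using w ab by (simp add: W_def)
  ultimately show ?thesis
    by blast
qed

lemma weak_deriv_successive:
  assumes v: "has_weak_deriv S i u v" and w: "has_weak_deriv S (Suc i) u w" and \<phi>: "test_function S \<phi>"
  shows "(LINT t:S|lebesgue. v t * deriv \<phi> t) = - (LINT t:S|lebesgue. w t * \<phi> t)"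
proof -
  have "(LINT t:S|lebesgue. u t * (deriv ^^ i) (deriv \<phi>) t) = (-1) ^ i * (LINT t:S|lebesgue. v t * deriv \<phi> t)"
    by (rule has_weak_derivD[OF v test_function_deriv[OF \<phi>]])
  moreover have "(LINT t:S|lebesgue. u t * (deriv ^^ Suc i) \<phi> t) = (-1) ^ Suc i * (LINT t:S|lebesgue. w t * \<phi> t)"
    by (rule has_weak_derivD[OF w \<phi>])
  moreover have "(deriv ^^ i) (deriv \<phi>) = (deriv ^^ Suc i) \<phi>"
    by (simp add: funpow_swap1)
  ultimately have "(-1) ^ i * (LINT t:S|lebesgue. v t * deriv \<phi> t) = (-1) ^ i * (- (LINT t:S|lebesgue. w t * \<phi> t))"
    by simp
  then show ?thesis
    by (subst (asm) mult_left_cancel) auto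
qed

text \<open>
  The weak derivative of order \<open>j + 1\<close> of \<open>u\<close> is the first weak derivative of the one of order \<open>j\<close>, so the lemma of du Bois-Reymond
  applies to each pair of consecutive orders.
\<close>

lemma weak_derivs_absolutely_continuous:
  assumes ab: "a < b" and v: "\<And>j. j \<le> \<mu> \<Longrightarrow> has_weak_deriv {a<..<b} j u (v j)"
    and int: "\<And>j. j \<le> \<mu> \<Longrightarrow> v j absolutely_integrable_on {a..b}"
  shows "\<exists>f. (\<forall>j<\<mu>. ac_deriv a b (f j) (f (Suc j))) \<and> f \<mu> = v \<mu> \<and>
    (\<forall>j\<le>\<mu>. AE t in lebesgue. t \<in> {a<..<b} \<longrightarrow> v j t = f j t)"
proof -
  have "\<exists>f. ac_deriv a b f (v (Suc j)) \<and> (AE t in lebesgue. t \<in> {a<..<b} \<longrightarrow> v j t = f t)" if "j < \<mu>" for j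
  proof (rule du_Bois_Reymond[OF ab])
    show "locally_integrable {a<..<b} (v j)"
      using v[of j] that by (simp add: has_weak_deriv_def)
    show "v (Suc j) absolutely_integrable_on {a..b}"
      using int[of "Suc j"] that by simp
    show "(LINT t:{a<..<b}|lebesgue. v j t * deriv \<phi> t) = - (LINT t:{a<..<b}|lebesgue. v (Suc j) t * \<phi> t)"
      if "test_function {a<..<b} \<phi>" for \<phi>
      using weak_deriv_successive[OF v v that, of j] \<open>j < \<mu>\<close> by simp
  qed
  then obtain F where F: "\<And>j. j < \<mu> \<Longrightarrow> ac_deriv a b (F j) (v (Suc j))"
    "\<And>j. j < \<mu> \<Longrightarrow> AE t in lebesgue. t \<in> {a<..<b} \<longrightarrow> v j t = F j t"
    by metis
  define f where "f j = (if j < \<mu> then F j else v j)" for j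
  have AE: "AE t in lebesgue. t \<in> {a<..<b} \<longrightarrow> v j t = f j t" if "j \<le> \<mu>" for j
    using F(2)[of j] that by (simp add: f_def)
  have "ac_deriv a b (f j) (f (Suc j))" if j: "j < \<mu>" for j
    unfolding ac_deriv_def
  proof (intro conjI ballI)
    have AE': "AE t in lebesgue. t \<in> {a<..<x} \<longrightarrow> f (Suc j) t = v (Suc j) t" if "x \<le> b" for x
    proof -
      have "Suc j \<le> \<mu>"
        using j by simp
      from AE[OF this] show ?thesis
        by eventually_elim (use that in auto)
    qed
    have i: "v (Suc j) absolutely_integrable_on {a..x}" if "x \<le> b" for x
      using j that by (intro set_integrable_subset[OF int[of "Suc j"]]) auto
    show "f (Suc j) absolutely_integrable_on {a..b}"
      by (rule absolutely_integrable_cong_AE(1)[OF i AE']) auto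
    fix x assume x: "x \<in> {a..b}"
    have "integral {a..x} (f (Suc j)) = integral {a..x} (v (Suc j))"
      using x by (intro absolutely_integrable_cong_AE(2)[OF i AE']) auto
    moreover have "F j x = F j a + integral {a..x} (v (Suc j))"
      using x by (intro ac_deriv_eq[OF F(1)[OF j]]) auto
    ultimately show "f j x = f j a + integral {a..x} (f (Suc j))"
      using j by (simp add: f_def)
  qed
  moreover have "f \<mu> = v \<mu>"
    by (simp add: f_def)
  ultimately show ?thesis
    using AE by blast
qed

text \<open>
  A test function on the union has compact support inside it, so all its derivatives vanish at the endpoints of the
  intervals, and integration by parts on each interval has no boundary terms.
\<close>

lemma has_weak_deriv_piecewise:
  assumes N: "finite N" and less: "\<And>n. n \<in> N \<Longrightarrow> c n < d n"
    and disj: "disjoint_family_on (\<lambda>n. {c n<..<d n}) N"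
    and G: "\<And>n i. n \<in> N \<Longrightarrow> i < j \<Longrightarrow> ac_deriv (c n) (d n) (G n i) (G n (Suc i))"
    and int: "\<And>n. n \<in> N \<Longrightarrow> G n 0 absolutely_integrable_on {c n..d n}"
      "\<And>n. n \<in> N \<Longrightarrow> G n j absolutely_integrable_on {c n..d n}"
    and AE: "\<And>n. n \<in> N \<Longrightarrow> AE t in lebesgue. t \<in> {c n<..<d n} \<longrightarrow> e t = G n 0 t"
      "\<And>n. n \<in> N \<Longrightarrow> AE t in lebesgue. t \<in> {c n<..<d n} \<longrightarrow> v t = G n j t"
  shows "has_weak_deriv (\<Union>n\<in>N. {c n<..<d n}) j e v"
proof -
  let ?S = "\<Union>n\<in>N. {c n<..<d n}"
  have ie: "e absolutely_integrable_on {c n..d n}" and iv: "v absolutely_integrable_on {c n..d n}" if "n \<in> N" for n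
    using absolutely_integrable_cong_AE(1)[OF int(1) AE(1)] absolutely_integrable_cong_AE(1)[OF int(2) AE(2)] that
    by blast+
  have loc: "locally_integrable ?S f" if f: "\<And>n. n \<in> N \<Longrightarrow> f absolutely_integrable_on {c n..d n}" for f
    unfolding locally_integrable_def
  proof (intro allI impI)
    fix K assume K: "compact K \<and> K \<subseteq> ?S"
    have "f absolutely_integrable_on ?S"
      using f N by (intro set_integrable_UN) (auto simp: absolutely_integrable_on_Icc_iff_Ioo)
    then show "f absolutely_integrable_on K"
      by (rule set_integrable_subset) (use K borel_compact[of K] in auto)
  qed
  have "(LINT t:?S|lebesgue. e t * (deriv ^^ j) \<phi> t) = (-1) ^ j * (LINT t:?S|lebesgue. v t * \<phi> t)"
    if \<phi>: "test_function ?S \<phi>" for \<phi>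
  proof -
    obtain K where K: "compact K" "K \<subseteq> ?S" "\<And>t. t \<notin> K \<Longrightarrow> \<phi> t = 0" and s: "smooth \<phi>"
      using \<phi> unfolding test_function_iff by blast
    have endpoints: "c n \<notin> ?S" "d n \<notin> ?S" if n: "n \<in> N" for n
    proof -
      have no: False if m: "m \<in> N" and x: "x \<in> {c m<..<d m}" and xn: "x = c n \<or> x = d n" for m x
      proof (cases "m = n")
        case False
        then have "{c m<..<d m} \<inter> {c n<..<d n} = {}"
          using disj m n by (auto simp: disjoint_family_on_def)
        moreover have "\<exists>y. y \<in> {c m<..<d m} \<inter> {c n<..<d n}"
        proof -
          \<comment> \<open>an endpoint of one interval inside another one would make the two overlap\<close>
          have "max (c m) (c n) < min (d m) (d n)"
            using x xn less[OF n] by auto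
          then obtain y where "max (c m) (c n) < y" "y < min (d m) (d n)"
            using dense by blast
          then show ?thesis
            by auto
        qed
        ultimately show ?thesis
          by blast
      qed (use x xn in auto)
      show "c n \<notin> ?S" "d n \<notin> ?S"
        using no by blast+
    qed
    have zero: "(deriv ^^ i) \<phi> (c n) = 0" "(deriv ^^ i) \<phi> (d n) = 0" if "n \<in> N" for i n
    proof -
      have nK: "c n \<notin> K" "d n \<notin> K"
        using endpoints[OF that] subsetD[OF K(2), of "c n"] subsetD[OF K(2), of "d n"] by metis+
      show "(deriv ^^ i) \<phi> (c n) = 0" "(deriv ^^ i) \<phi> (d n) = 0"
        by (intro deriv_funpow_eq_0_outside[OF K(1)] K(3) nK; assumption)+
    qed
    have cont: "continuous_on {c n..d n} ((deriv ^^ i) \<phi>)" for i n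
      by (intro smooth_continuous_on smooth_deriv_funpow s)
    have prod: "(\<lambda>t. f t * (deriv ^^ i) \<phi> t) absolutely_integrable_on {c n..d n}"
      if "f absolutely_integrable_on {c n..d n}" for f i n
      using absolutely_integrable_mult_continuous[OF cont that] by (simp add: mult.commute)
    have split: "(LINT t:?S|lebesgue. f t * (deriv ^^ i) \<phi> t)
        = (\<Sum>n\<in>N. integral {c n..d n} (\<lambda>t. f t * (deriv ^^ i) \<phi> t))"
      if f: "\<And>n. n \<in> N \<Longrightarrow> f absolutely_integrable_on {c n..d n}" for f i
    proof -
      have "(LINT t:?S|lebesgue. f t * (deriv ^^ i) \<phi> t) = (\<Sum>n\<in>N. LINT t:{c n<..<d n}|lebesgue. f t * (deriv ^^ i) \<phi> t)"
        using prod[OF f] by (intro set_integral_finite_Union N disj) (auto simp: absolutely_integrable_on_Icc_iff_Ioo)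
      also have "\<dots> = (\<Sum>n\<in>N. integral {c n..d n} (\<lambda>t. f t * (deriv ^^ i) \<phi> t))"
        by (intro sum.cong refl LINT_Ioo_eq_integral prod f)
      finally show ?thesis .
    qed
    have piece: "integral {c n..d n} (\<lambda>t. e t * (deriv ^^ j) \<phi> t) = (-1) ^ j * integral {c n..d n} (\<lambda>t. v t * \<phi> t)"
      if n: "n \<in> N" for n
    proof -
      have "integral {c n..d n} (\<lambda>t. e t * (deriv ^^ j) \<phi> t) = integral {c n..d n} (\<lambda>t. G n 0 t * (deriv ^^ j) \<phi> t)"
        by (rule absolutely_integrable_cong_AE(2)[OF prod[OF int(1)[OF n]]]) (use AE(1)[OF n] in eventually_elim, auto)
      also have "\<dots> = (-1) ^ j * integral {c n..d n} (\<lambda>t. G n j t * \<phi> t)"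
        using less[OF n] zero[OF n] G[OF n] by (intro ac_deriv_iterated_by_parts s) auto
      also have "integral {c n..d n} (\<lambda>t. G n j t * \<phi> t) = integral {c n..d n} (\<lambda>t. v t * \<phi> t)"
        using prod[OF int(2)[OF n], of 0]
        by (intro absolutely_integrable_cong_AE(2)[symmetric]) (simp, use AE(2)[OF n] in eventually_elim, auto)
      finally show ?thesis .
    qed
    show ?thesis
      using split[OF ie, of j] split[OF iv, of 0] piece by (simp add: sum_distrib_left)
  qed
  then show ?thesis
    unfolding has_weak_deriv_def using loc ie iv by blast
qed

section \<open>Affine changes of variables\<close>

lemma
  fixes f :: "real \<Rightarrow> real"
  assumes h: "h > 0"
  shows set_integrable_affine: "set_integrable lebesgue {c - h<..<c + h} f
      \<longleftrightarrow> set_integrable lebesgue {-1<..<1} (\<lambda>x. f (c + h * x))" (is ?thesis1)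
    and set_integral_affine: "(LINT t:{c - h<..<c + h}|lebesgue. f t)
      = h * (LINT x:{-1<..<1}|lebesgue. f (c + h * x))" (is ?thesis2)
    and set_borel_measurable_affine: "set_borel_measurable lebesgue {c - h<..<c + h} f
      \<longleftrightarrow> set_borel_measurable lebesgue {-1<..<1} (\<lambda>x. f (c + h * x))" (is ?thesis3)
proof -
  define g where "g t = indicator {c - h<..<c + h} t * f t" for t
  have mem: "c + h * x \<in> {c - h<..<c + h} \<longleftrightarrow> x \<in> {-1<..<1}" for x
    using h mult_less_cancel_left_pos[OF h, of "-1" x] mult_less_cancel_left_pos[OF h, of x 1] by auto
  have g: "g (c + h * x) = indicator {-1<..<1} x * f (c + h * x)" for x
    using mem[of x] by (simp add: g_def indicator_def)
  show ?thesis1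
    using lebesgue_integrable_real_affine_iff[of h g c] h
    by (simp add: set_integrable_def g) (simp add: g_def[abs_def])
  show ?thesis2
    using lebesgue_integral_real_affine[of h g c] h
    by (simp add: set_lebesgue_integral_def g) (simp add: g_def[abs_def])
  have "g \<in> borel_measurable lebesgue \<longleftrightarrow> (\<lambda>x. g (c + h * x)) \<in> borel_measurable lebesgue"
  proof
    assume "g \<in> borel_measurable lebesgue"
    then show "(\<lambda>x. g (c + h * x)) \<in> borel_measurable lebesgue"
      using borel_measurable_affine[of g h c] h by simp
  next
    assume "(\<lambda>x. g (c + h * x)) \<in> borel_measurable lebesgue"
    then have "(\<lambda>t. g (c + h * (- c / h + (1 / h) *\<^sub>R t))) \<in> borel_measurable lebesgue"
      using h by (intro borel_measurable_affine) auto
    also have "(\<lambda>t. g (c + h * (- c / h + (1 / h) *\<^sub>R t))) = g"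
      using h by (auto simp: field_simps)
    finally show "g \<in> borel_measurable lebesgue" .
  qed
  then show ?thesis3
    by (simp add: set_borel_measurable_def g) (simp add: g_def[abs_def])
qed

lemma ac_deriv_affine:
  assumes h: "h > 0" and f: "ac_deriv a b f g" and sub: "a \<le> c - h" "c + h \<le> b"
  shows "ac_deriv (-1) 1 (\<lambda>x. f (c + h * x)) (\<lambda>x. h * g (c + h * x))"
  unfolding ac_deriv_def
proof (intro conjI ballI)
  have g: "g absolutely_integrable_on {c - h..c + h}"
    by (rule ac_deriv_integrable[OF ac_deriv_subinterval[OF f sub]])
  then show "(\<lambda>x. h * g (c + h * x)) absolutely_integrable_on {-1..1}"
    using set_integrable_affine[OF h, of c g] by (simp add: absolutely_integrable_on_Icc_iff_Ioo)
  fix x :: real assume x: "x \<in> {-1..1}"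
  have "h * x \<le> h * 1"
    by (rule mult_left_mono) (use h x in auto)
  moreover have "h * (-1) \<le> h * x"
    by (rule mult_left_mono) (use h x in auto)
  ultimately have b: "a \<le> c - h" "c - h \<le> c + h * x" "c + h * x \<le> b"
    using sub by auto
  have "g integrable_on {c - h..c + h * x}"
    using ac_deriv_integrable[OF ac_deriv_subinterval[OF f b(1,3)]] by (simp add: absolutely_integrable_on_def)
  then have "(g has_integral (f (c + h * x) - f (c - h))) (cbox (c - h) (c + h * x))"
    using ac_deriv_increment[OF f b] by (simp add: integrable_integral)
  from has_integral_affinity'[OF this h, of c]
  have "((\<lambda>x. g (h * x + c)) has_integral (f (c + h * x) - f (c - h)) / h) {-1..x}"
    using h by (simp add: field_simps)
  from has_integral_mult_right[OF this, of h]
  have "((\<lambda>x. h * g (c + h * x)) has_integral (f (c + h * x) - f (c - h))) {-1..x}"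
    using h by (simp add: add.commute)
  from integral_unique[OF this]
  show "f (c + h * x) = f (c + h * (-1)) + integral {-1..x} (\<lambda>x. h * g (c + h * x))"
    by simp
qed

lemma AE_lebesgue_affine:
  assumes h: "h > 0" and Q: "AE t in lebesgue. Q t"
  shows "AE x in lebesgue. Q (c + h * x :: real)"
proof -
  obtain N where N: "{t \<in> space lebesgue. \<not> Q t} \<subseteq> N" "emeasure lebesgue N = 0" "N \<in> sets lebesgue"
    by (rule AE_E[OF Q])
  then have "negligible N"
    by (simp add: negligible_iff_emeasure0)
  then have "negligible ((\<lambda>t. (t - c) / h) ` N)"
    by (intro negligible_differentiable_image_negligible)
      (use h in \<open>auto simp: differentiable_on_def real_differentiable_def
        intro!: exI[of _ "1 / h"] derivative_eq_intros\<close>)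
  then have null: "(\<lambda>t. (t - c) / h) ` N \<in> null_sets lebesgue"
    by (simp add: negligible_iff_null_sets)
  show ?thesis
  proof (rule AE_I'[OF null], rule subsetI)
    fix x assume "x \<in> {x \<in> space lebesgue. \<not> Q (c + h * x)}"
    then have "c + h * x \<in> N"
      using N(1) by auto
    then show "x \<in> (\<lambda>t. (t - c) / h) ` N"
      using h by (intro image_eqI[of _ _ "c + h * x"]) auto
  qed
qed

lemma set_borel_measurable_lebesgue_on:
  fixes f :: "real \<Rightarrow> real"
  assumes "S \<in> sets lebesgue"
  shows "set_borel_measurable lebesgue S f \<longleftrightarrow> f \<in> borel_measurable (lebesgue_on S)"
  using assms by (simp add: set_borel_measurable_def borel_measurable_restrict_space_iff)

lemma
  shows square_integrable_jacobi_iff: "square_integrable (jacobi_measure a b) f \<longleftrightarrow>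
      set_borel_measurable lebesgue {-1<..<1} f \<and>
      set_integrable lebesgue {-1<..<1} (\<lambda>x. jacobi_weight a b x * (f x)\<^sup>2)" (is ?thesis1)
    and sqnorm_jacobi_eq: "f \<in> borel_measurable (lebesgue_on {-1<..<1}) \<Longrightarrow>
      jacobi_sqnorm a b f = (LINT x:{-1<..<1}|lebesgue. jacobi_weight a b x * (f x)\<^sup>2)" (is "_ \<Longrightarrow> ?thesis2")
proof -
  have m: "(\<lambda>x. (f x)\<^sup>2) \<in> borel_measurable (lebesgue_on {-1<..<1})" if "f \<in> borel_measurable (lebesgue_on {-1<..<1})"
    using that by measurable
  show ?thesis1
    using integrable_jacobi_measure[OF m]
    by (auto simp: square_integrable_def set_borel_measurable_lebesgue_on measurable_jacobi_measure
        absolutely_integrable_iff_lebesgue_on)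
  show ?thesis2 if "f \<in> borel_measurable (lebesgue_on {-1<..<1})"
    unfolding sqnorm_def integral_jacobi_measure[OF m[OF that]]
    by (simp add: set_lebesgue_integral_def integral_restrict_space)
qed

lemma set_integral_cong_AE_lebesgue:
  fixes f g :: "real \<Rightarrow> real"
  assumes "set_integrable lebesgue S f" "AE t in lebesgue. t \<in> S \<longrightarrow> g t = f t"
  shows "set_integrable lebesgue S g" "(LINT t:S|lebesgue. g t) = (LINT t:S|lebesgue. f t)"
proof -
  have f: "integrable lebesgue (\<lambda>t. indicator S t * f t)"
    using assms(1) by (simp add: set_integrable_def)
  have ae: "AE t in lebesgue. indicator S t * f t = indicator S t * g t"
    using assms(2) by eventually_elim (auto simp: indicator_def)
  have g: "(\<lambda>t. indicator S t * g t) \<in> borel_measurable lebesgue"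
    using borel_measurable_integrable[OF f] ae by (rule borel_measurable_AE)
  show "set_integrable lebesgue S g"
    unfolding set_integrable_def using integrable_cong_AE_imp[OF f g ae] by simp
  show "(LINT t:S|lebesgue. g t) = (LINT t:S|lebesgue. f t)"
    unfolding set_lebesgue_integral_def
    using integral_cong_AE[OF borel_measurable_integrable[OF f] g ae] by simp
qed

lemma L2_norm_cong_AE:
  assumes "f \<in> L2_space w S" "AE t in lebesgue. t \<in> S \<longrightarrow> g t = f t"
  shows "L2_norm w S g = L2_norm w S f" 
proof -
  have "AE t in lebesgue. t \<in> S \<longrightarrow> w t * \<bar>g t\<bar>\<^sup>2 = w t * \<bar>f t\<bar>\<^sup>2"
    using assms(2) by eventually_elim auto
  from set_integral_cong_AE_lebesgue(2)[OF _ this] show ?thesis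
    using assms(1) by (simp add: L2_norm_def L2_space_def)
qed

lemma L2_space_cong_AE:
  assumes f: "f \<in> L2_space w S" and ae: "AE t in lebesgue. t \<in> S \<longrightarrow> g t = f t"
  shows "g \<in> L2_space w S"
proof -
  have eq: "AE t in lebesgue. indicator S t *\<^sub>R f t = indicator S t *\<^sub>R g t"
    using ae by eventually_elim (auto simp: indicator_def)
  have "set_borel_measurable lebesgue S f"
    using f by (simp add: L2_space_def)
  then have "set_borel_measurable lebesgue S g"
    unfolding set_borel_measurable_def using eq by (rule borel_measurable_AE)
  moreover have "set_integrable lebesgue S (\<lambda>t. w t * \<bar>g t\<bar>\<^sup>2)"
  proof (rule set_integral_cong_AE_lebesgue(1))
    show "set_integrable lebesgue S (\<lambda>t. w t * \<bar>f t\<bar>\<^sup>2)"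
      using f by (simp add: L2_space_def)
    show "AE t in lebesgue. t \<in> S \<longrightarrow> w t * \<bar>g t\<bar>\<^sup>2 = w t * \<bar>f t\<bar>\<^sup>2"
      using ae by eventually_elim auto
  qed
  ultimately show ?thesis
    by (simp add: L2_space_def)
qed

lemma set_integrable_UN_iff:
  fixes f :: "'a \<Rightarrow> real"
  assumes I: "finite I" and A: "\<And>i. i \<in> I \<Longrightarrow> A i \<in> sets M"
  shows "set_integrable M (\<Union>i\<in>I. A i) f \<longleftrightarrow> (\<forall>i\<in>I. set_integrable M (A i) f)"
proof
  assume f: "set_integrable M (\<Union>i\<in>I. A i) f"
  show "\<forall>i\<in>I. set_integrable M (A i) f"
  proof
    fix i assume "i \<in> I"
    then show "set_integrable M (A i) f"
      by (intro set_integrable_subset[OF f] A) blast+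
  qed
next
  assume "\<forall>i\<in>I. set_integrable M (A i) f"
  then show "set_integrable M (\<Union>i\<in>I. A i) f"
    using I A by (intro set_integrable_UN) blast+
qed

lemma set_borel_measurable_UN_iff:
  fixes f :: "'a \<Rightarrow> real"
  assumes I: "finite I" and A: "\<And>i. i \<in> I \<Longrightarrow> A i \<in> sets M" and disj: "disjoint_family_on A I"
  shows "set_borel_measurable M (\<Union>i\<in>I. A i) f \<longleftrightarrow> (\<forall>i\<in>I. set_borel_measurable M (A i) f)"
proof
  assume f: "set_borel_measurable M (\<Union>i\<in>I. A i) f"
  show "\<forall>i\<in>I. set_borel_measurable M (A i) f"
  proof
    fix i assume "i \<in> I"
    then show "set_borel_measurable M (A i) f"
      by (intro set_borel_measurable_subset[OF f] A) blast+
  qed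
next
  assume f: "\<forall>i\<in>I. set_borel_measurable M (A i) f"
  have "(\<lambda>t. \<Sum>i\<in>I. indicator (A i) t *\<^sub>R f t) \<in> borel_measurable M"
    by (rule borel_measurable_sum) (use f in \<open>simp add: set_borel_measurable_def\<close>)
  moreover have "(\<Sum>i\<in>I. indicator (A i) t *\<^sub>R f t) = indicator (\<Union>i\<in>I. A i) t *\<^sub>R f t" for t
    unfolding indicator_UN_disjoint[OF I disj] by (simp add: sum_distrib_right)
  ultimately show "set_borel_measurable M (\<Union>i\<in>I. A i) f"
    by (simp add: set_borel_measurable_def)
qed

lemma
  fixes g :: "real \<Rightarrow> real"
  assumes sub: "A \<subseteq> B" and neg: "negligible (B - A)"
  shows set_integrable_negligible_diff: "set_integrable lebesgue B g \<longleftrightarrow> set_integrable lebesgue A g"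
    and set_integral_negligible_diff: "(LINT t:B|lebesgue. g t) = (LINT t:A|lebesgue. g t)"
    and set_borel_measurable_negligible_diff:
      "set_borel_measurable lebesgue B g \<longleftrightarrow> set_borel_measurable lebesgue A g"
proof -
  define f1 f2 where "f1 t = indicator B t * g t" and "f2 t = indicator A t * g t" for t
  have eq: "f1 t = f2 t" if "t \<notin> B - A" for t
    using sub that by (cases "t \<in> A") (auto simp: f1_def f2_def)
  have "AE t in lebesgue. t \<notin> B - A"
    using neg by (intro AE_not_in) (simp add: negligible_iff_null_sets)
  then have ae: "AE t in lebesgue. f1 t = f2 t"
    by eventually_elim (rule eq)
  then have ae': "AE t in lebesgue. f2 t = f1 t"
    by eventually_elim simp
  have m: "f1 \<in> borel_measurable lebesgue \<longleftrightarrow> f2 \<in> borel_measurable lebesgue"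
    using borel_measurable_AE[OF _ ae] borel_measurable_AE[OF _ ae'] by blast
  then show "set_borel_measurable lebesgue B g \<longleftrightarrow> set_borel_measurable lebesgue A g"
    by (simp add: set_borel_measurable_def f1_def[abs_def] f2_def[abs_def])
  have i: "integrable lebesgue f1 \<longleftrightarrow> integrable lebesgue f2"
    using m integrable_cong_AE[OF _ _ ae] borel_measurable_integrable by blast
  then show "set_integrable lebesgue B g \<longleftrightarrow> set_integrable lebesgue A g"
    by (simp add: set_integrable_def f1_def[abs_def] f2_def[abs_def])
  have "integral\<^sup>L lebesgue f1 = integral\<^sup>L lebesgue f2"
  proof (cases "f1 \<in> borel_measurable lebesgue")
    case True
    then show ?thesis
      using m by (intro integral_cong_AE ae) auto
  next
    case False
    then have "\<not> integrable lebesgue f1" "\<not> integrable lebesgue f2"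
      using m borel_measurable_integrable by blast+
    then show ?thesis
      by (simp add: not_integrable_integral_eq)
  qed
  then show "(LINT t:B|lebesgue. g t) = (LINT t:A|lebesgue. g t)"
    by (simp add: set_lebesgue_integral_def f1_def[abs_def] f2_def[abs_def])
qed

section \<open>Restriction to the cells\<close>

text \<open>
  The cell with number \<open>n\<close> has half width \<open>h = T / 2\<^sup>k\<close> and centre \<open>mid n\<close>, and \<open>pull n\<close> transports functions on
  this cell to \<open>(-1, 1)\<close>.
\<close>

locale jacobi_wavelets =
  fixes \<nu> \<gamma> T :: real and k :: nat
  assumes \<nu>: "-1 < \<nu>" "\<nu> < 1" and \<gamma>: "-1 < \<gamma>" "\<gamma> < 1" and T_pos: "T > 0" and k_pos: "k \<ge> 1"
begin

definition h :: real where "h = T / 2 ^ k"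

definition mid :: "nat \<Rightarrow> real" where "mid n = (2 * real n - 1) * h"

abbreviation N :: "nat set" where "N \<equiv> {1..2 ^ (k - 1)}"

abbreviation inner_cell :: "nat \<Rightarrow> real set" where "inner_cell n \<equiv> {mid n - h<..<mid n + h}"

abbreviation w :: "real \<Rightarrow> real" where "w \<equiv> wavelet_weight \<nu> \<gamma> T k"

definition pull :: "nat \<Rightarrow> (real \<Rightarrow> real) \<Rightarrow> real \<Rightarrow> real" where
  "pull n f x = f (mid n + h * x)"

lemma h_pos: "h > 0"
  using T_pos by (simp add: h_def)

lemma half_T: "T / 2 ^ (k - 1) = 2 * h"
proof -
  have "(2 :: real) ^ k = 2 * 2 ^ (k - 1)"
    using k_pos by (simp add: power_eq_if)
  then show ?thesis
    by (simp add: h_def)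
qed

lemma T_eq: "2 * h * 2 ^ (k - 1) = T"
  using half_T by (simp add: field_simps)

lemma cell_eq: "cell T k n = {mid n - h..<mid n + h}"
proof -
  have "(real n - 1) / 2 ^ (k - 1) * T = (real n - 1) * (T / 2 ^ (k - 1))"
    by simp
  also have "\<dots> = mid n - h"
    unfolding half_T mid_def by (simp add: algebra_simps)
  finally have 1: "(real n - 1) / 2 ^ (k - 1) * T = mid n - h" .
  have "real n / 2 ^ (k - 1) * T = real n * (T / 2 ^ (k - 1))"
    by simp
  also have "\<dots> = mid n + h"
    unfolding half_T mid_def by (simp add: algebra_simps)
  finally have 2: "real n / 2 ^ (k - 1) * T = mid n + h" .
  show ?thesis
    unfolding cell_def 1 2 ..
qed

lemma cell_interiors_eq: "cell_interiors T k = (\<Union>n\<in>N. inner_cell n)"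
  by (simp add: cell_interiors_def cell_eq)

lemma cell_unique:
  assumes "t \<in> cell T k n" "t \<in> cell T k m"
  shows "n = m"
proof -
  have le: "m \<le> n" if "t \<in> cell T k n" "t \<in> cell T k m" for n m
  proof -
    have "h * (2 * real m - 2) \<le> t" "t < h * (2 * real n)"
      using that by (auto simp: cell_eq mid_def algebra_simps)
    then have "h * (2 * real m - 2) < h * (2 * real n)"
      by linarith
    then have "2 * real m - 2 < 2 * real n"
      using h_pos by simp
    then show ?thesis
      by linarith
  qed
  show ?thesis
    using le[OF assms] le[OF assms(2,1)] by simp
qed

lemma inner_cell_subset_cell: "inner_cell n \<subseteq> cell T k n"
  by (auto simp: cell_eq)

lemma disjoint_inner_cells: "disjoint_family_on inner_cell N"
  using cell_unique inner_cell_subset_cell unfolding disjoint_family_on_def by blast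

lemma cell_bounds:
  assumes "n \<in> N"
  shows "0 \<le> mid n - h" "mid n + h \<le> T"
proof -
  have "0 \<le> h * (2 * real n - 2)"
    using assms h_pos by auto
  then show "0 \<le> mid n - h"
    by (simp add: mid_def algebra_simps)
  have "real n \<le> 2 ^ (k - 1)"
    using assms of_nat_mono[of n "2 ^ (k - 1)"] by simp
  then have "2 * h * real n \<le> 2 * h * 2 ^ (k - 1)"
    using h_pos by (intro mult_left_mono) auto
  then have "2 * h * real n \<le> T"
    by (simp only: T_eq)
  then show "mid n + h \<le> T"
    by (simp add: mid_def algebra_simps)
qed

lemma inner_cells_subset: "(\<Union>n\<in>N. inner_cell n) \<subseteq> {0<..<T}"
proof
  fix t assume "t \<in> (\<Union>n\<in>N. inner_cell n)"
  then obtain n where n: "n \<in> N" "t \<in> inner_cell n"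
    by blast
  then show "t \<in> {0<..<T}"
    using cell_bounds[OF n(1)] by auto
qed

lemma cells_cover: "{0<..<T} - (\<Union>n\<in>N. inner_cell n) \<subseteq> (\<lambda>n. mid n - h) ` N"
proof
  fix t assume t: "t \<in> {0<..<T} - (\<Union>n\<in>N. inner_cell n)"
  define m where "m = nat \<lfloor>t / (2 * h)\<rfloor>"
  have "0 \<le> t / (2 * h)"
    using t h_pos by simp
  then have m: "real m \<le> t / (2 * h)" "t / (2 * h) < real m + 1"
    unfolding m_def by (auto simp: floor_less_cancel)
  have "t / (2 * h) < 2 ^ (k - 1)"
  proof -
    have "t < 2 * h * 2 ^ (k - 1)"
      unfolding T_eq using t by simp
    then show ?thesis
      using h_pos by (simp add: pos_divide_less_eq mult_ac)
  qed
  then have "real m < 2 ^ (k - 1)"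
    using m by linarith
  then have "real m < real (2 ^ (k - 1))"
    by (simp only: of_nat_power of_nat_numeral)
  then have "m < 2 ^ (k - 1)"
    by (simp only: of_nat_less_iff)
  then have mN: "Suc m \<in> N"
    by simp
  have "mid (Suc m) - h \<le> t" "t < mid (Suc m) + h"
    using m h_pos by (auto simp: mid_def field_simps)
  moreover have "t \<notin> inner_cell (Suc m)"
    using t mN by blast
  ultimately have "t = mid (Suc m) - h"
    by auto
  then show "t \<in> (\<lambda>n. mid n - h) ` N"
    using mN by blast
qed

lemma negligible_outside_cells: "negligible ({0<..<T} - (\<Union>n\<in>N. inner_cell n))"
  by (rule negligible_subset[OF negligible_finite cells_cover]) simp

lemma cell_coord_mid: "cell_coord T k n (mid n + h * x) = x"
  using T_pos by (simp add: cell_coord_def mid_def h_def field_simps)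

lemma weight_on_cell:
  assumes "n \<in> N" "t \<in> cell T k n"
  shows "w t = jacobi_weight \<nu> \<gamma> (cell_coord T k n t)"
proof -
  have "w t = (\<Sum>m\<in>N. if m = n then jacobi_weight \<nu> \<gamma> (cell_coord T k n t) else 0)"
    unfolding wavelet_weight_def using assms cell_unique by (intro sum.cong) auto
  then show ?thesis
    using assms(1) by simp
qed

lemma inner_cell_image:
  assumes "n \<in> N" "x \<in> {-1<..<1}"
  shows "mid n + h * x \<in> inner_cell n"
proof -
  have "h * x < h * 1"
    by (rule mult_strict_left_mono) (use assms h_pos in auto)
  moreover have "h * (-1) < h * x"
    by (rule mult_strict_left_mono) (use assms h_pos in auto)
  ultimately show ?thesis
    by simp
qed

lemma weight_inner_cell:
  assumes "n \<in> N" "x \<in> {-1<..<1}"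
  shows "w (mid n + h * x) = jacobi_weight \<nu> \<gamma> x"
proof -
  have "mid n + h * x \<in> cell T k n"
    using inner_cell_image[OF assms] inner_cell_subset_cell by blast
  then show ?thesis
    using weight_on_cell[OF assms(1)] by (simp add: cell_coord_mid)
qed

lemma
  assumes n: "n \<in> N"
  shows weighted_integrable_cell: "set_integrable lebesgue (inner_cell n) (\<lambda>t. w t * f t)
      \<longleftrightarrow> set_integrable lebesgue {-1<..<1} (\<lambda>x. jacobi_weight \<nu> \<gamma> x * pull n f x)"
    and weighted_integral_cell: "(LINT t:inner_cell n|lebesgue. w t * f t)
      = h * (LINT x:{-1<..<1}|lebesgue. jacobi_weight \<nu> \<gamma> x * pull n f x)"
proof -
  have eq: "w (mid n + h * x) * f (mid n + h * x) = jacobi_weight \<nu> \<gamma> x * pull n f x" if "x \<in> {-1<..<1}" for x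
    using weight_inner_cell[OF n that] by (simp add: pull_def)
  show "set_integrable lebesgue (inner_cell n) (\<lambda>t. w t * f t)
      \<longleftrightarrow> set_integrable lebesgue {-1<..<1} (\<lambda>x. jacobi_weight \<nu> \<gamma> x * pull n f x)"
    unfolding set_integrable_affine[OF h_pos] by (rule set_integrable_cong) (use eq in auto)
  show "(LINT t:inner_cell n|lebesgue. w t * f t)
      = h * (LINT x:{-1<..<1}|lebesgue. jacobi_weight \<nu> \<gamma> x * pull n f x)"
    unfolding set_integral_affine[OF h_pos] using eq
    by (intro arg_cong[where f = "\<lambda>x. h * x"] set_lebesgue_integral_cong) auto
qed

lemma
  shows L2_space_cells: "f \<in> L2_space w (\<Union>n\<in>N. inner_cell n)
      \<longleftrightarrow> (\<forall>n\<in>N. square_integrable (jacobi_measure \<nu> \<gamma>) (pull n f))"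
    and L2_norm_cells: "f \<in> L2_space w (\<Union>n\<in>N. inner_cell n) \<Longrightarrow>
      (L2_norm w (\<Union>n\<in>N. inner_cell n) f)\<^sup>2 = (\<Sum>n\<in>N. h * jacobi_sqnorm \<nu> \<gamma> (pull n f))"
proof -
  let ?S = "\<Union>n\<in>N. inner_cell n"
  have meas: "set_borel_measurable lebesgue ?S f \<longleftrightarrow> (\<forall>n\<in>N. set_borel_measurable lebesgue (inner_cell n) f)"
    by (rule set_borel_measurable_UN_iff[OF _ _ disjoint_inner_cells]) simp_all
  have int: "set_integrable lebesgue ?S g \<longleftrightarrow> (\<forall>n\<in>N. set_integrable lebesgue (inner_cell n) g)" for g :: "real \<Rightarrow> real"
    by (rule set_integrable_UN_iff) simp_all
  have pull2: "pull n (\<lambda>t. (f t)\<^sup>2) = (\<lambda>x. (pull n f x)\<^sup>2)" for n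
    by (simp add: pull_def[abs_def])
  have mc: "set_borel_measurable lebesgue (inner_cell n) f \<longleftrightarrow> set_borel_measurable lebesgue {-1<..<1} (pull n f)" for n
    unfolding set_borel_measurable_affine[OF h_pos] pull_def[abs_def] ..
  show *: "f \<in> L2_space w ?S \<longleftrightarrow> (\<forall>n\<in>N. square_integrable (jacobi_measure \<nu> \<gamma>) (pull n f))"
    unfolding L2_space_def mem_Collect_eq meas int mc square_integrable_jacobi_iff power2_abs
    using weighted_integrable_cell[of _ "\<lambda>t. (f t)\<^sup>2"] by (auto simp: pull2)
  assume f: "f \<in> L2_space w ?S"
  then have fi: "set_integrable lebesgue (inner_cell n) (\<lambda>t. w t * (f t)\<^sup>2)" if "n \<in> N" for n
    using that unfolding L2_space_def mem_Collect_eq int by simp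
  have "0 \<le> w t" for t
    unfolding wavelet_weight_def by (intro sum_nonneg) (auto intro: jacobi_weight_nonneg)
  then have "(L2_norm w ?S f)\<^sup>2 = (LINT t:?S|lebesgue. w t * (f t)\<^sup>2)"
    unfolding L2_norm_def power2_abs set_lebesgue_integral_def
    by (intro real_sqrt_pow2 Bochner_Integration.integral_nonneg) auto
  also have "\<dots> = (\<Sum>n\<in>N. LINT t:inner_cell n|lebesgue. w t * (f t)\<^sup>2)"
    by (intro set_integral_finite_Union disjoint_inner_cells fi) auto
  also have "\<dots> = (\<Sum>n\<in>N. h * jacobi_sqnorm \<nu> \<gamma> (pull n f))"
  proof (rule sum.cong[OF refl])
    fix n assume n: "n \<in> N"
    have "pull n f \<in> borel_measurable (lebesgue_on {-1<..<1})"
      using * f n by (simp add: square_integrable_def measurable_jacobi_measure)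
    then show "(LINT t:inner_cell n|lebesgue. w t * (f t)\<^sup>2) = h * jacobi_sqnorm \<nu> \<gamma> (pull n f)"
      unfolding weighted_integral_cell[OF n] pull2 by (simp add: sqnorm_jacobi_eq)
  qed
  finally show "(L2_norm w ?S f)\<^sup>2 = (\<Sum>n\<in>N. h * jacobi_sqnorm \<nu> \<gamma> (pull n f))" .
qed

lemmas set_integrable_inner_cells = set_integrable_negligible_diff[OF inner_cells_subset negligible_outside_cells]
  and set_integral_inner_cells = set_integral_negligible_diff[OF inner_cells_subset negligible_outside_cells]
  and set_borel_measurable_inner_cells =
    set_borel_measurable_negligible_diff[OF inner_cells_subset negligible_outside_cells]

lemma L2_space_inner_cells: "L2_space w {0<..<T} = L2_space w (cell_interiors T k)"
  and L2_norm_inner_cells: "L2_norm w {0<..<T} f = L2_norm w (cell_interiors T k) f"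
  unfolding cell_interiors_eq L2_space_def L2_norm_def set_integrable_inner_cells set_integral_inner_cells
    set_borel_measurable_inner_cells by (rule refl)+

text \<open>
  On a cell, \<open>\<bar>f\<bar> \<le> w f\<^sup>2 + 1 / w\<close>.  The reciprocal of the weight is a Jacobi weight with exponents \<open>-\<nu>\<close> and \<open>-\<gamma>\<close>,
  which are above \<open>-1\<close>; this is where \<open>\<nu>, \<gamma> < 1\<close> enters.
\<close>

lemma L2_space_imp_absolutely_integrable:
  assumes f: "f \<in> L2_space w {0<..<T}"
  shows "f absolutely_integrable_on {0..T}"
proof -
  have "set_integrable lebesgue (inner_cell n) f" if n: "n \<in> N" for n
  proof -
    have sq: "square_integrable (jacobi_measure \<nu> \<gamma>) (pull n f)"
      using f n unfolding L2_space_inner_cells cell_interiors_eq L2_space_cells by blast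
    then have m: "pull n f \<in> borel_measurable (lebesgue_on {-1<..<1})"
      and i: "integrable (lebesgue_on {-1<..<1}) (\<lambda>x. jacobi_weight \<nu> \<gamma> x * (pull n f x)\<^sup>2)"
      by (auto simp: square_integrable_jacobi_iff set_borel_measurable_lebesgue_on absolutely_integrable_iff_lebesgue_on)
    have j: "integrable (lebesgue_on {-1<..<1}) (jacobi_weight (- \<nu>) (- \<gamma>))"
      using \<nu> \<gamma> by (intro integral_lebesgue_on_Ioo absolutely_integrable_jacobi_weight) auto
    have "integrable (lebesgue_on {-1<..<1}) (pull n f)"
    proof (rule Bochner_Integration.integrable_bound)
      show "integrable (lebesgue_on {-1<..<1}) (\<lambda>x. jacobi_weight \<nu> \<gamma> x * (pull n f x)\<^sup>2 + jacobi_weight (- \<nu>) (- \<gamma>) x)"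
        using i j by simp
      have "\<bar>pull n f x\<bar> \<le> jacobi_weight \<nu> \<gamma> x * (pull n f x)\<^sup>2 + jacobi_weight (- \<nu>) (- \<gamma>) x"
        if x: "x \<in> {-1<..<1}" for x
      proof -
        define q where "q = sqrt (jacobi_weight \<nu> \<gamma> x)"
        have q: "q > 0" "q\<^sup>2 = jacobi_weight \<nu> \<gamma> x"
          using jacobi_weight_pos[OF x, of \<nu> \<gamma>] by (auto simp: q_def)
        have "jacobi_weight (- \<nu>) (- \<gamma>) x = 1 / q\<^sup>2"
          unfolding q(2) using x by (simp add: jacobi_weight_def powr_minus field_simps)
        moreover have "\<bar>(q * pull n f x) * (1 / q)\<bar> \<le> (q * pull n f x)\<^sup>2 + (1 / q)\<^sup>2"
          by (rule abs_mult_le_squares)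
        ultimately show ?thesis
          using q by (simp add: power_mult_distrib power_divide)
      qed
      then show "AE x in lebesgue_on {-1<..<1}. norm (pull n f x)
          \<le> norm (jacobi_weight \<nu> \<gamma> x * (pull n f x)\<^sup>2 + jacobi_weight (- \<nu>) (- \<gamma>) x)"
        by (intro AE_I2) (auto intro: order_trans[OF _ abs_ge_self])
    qed (rule m)
    then show ?thesis
      unfolding set_integrable_affine[OF h_pos] by (simp add: absolutely_integrable_iff_lebesgue_on pull_def[abs_def])
  qed
  then have "set_integrable lebesgue (\<Union>n\<in>N. inner_cell n) f"
    by (intro set_integrable_UN) auto
  then show ?thesis
    by (simp add: set_integrable_inner_cells absolutely_integrable_on_Icc_iff_Ioo)
qed

lemma jacobi_h_eq_sqnorm: "jacobi_h \<nu> \<gamma> m = jacobi_sqnorm \<nu> \<gamma> (poly (jacobi_poly \<nu> \<gamma> m))"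
proof -
  have i: "(\<lambda>t. (poly (jacobi_poly \<nu> \<gamma> m) t)\<^sup>2 * jacobi_weight \<nu> \<gamma> t) absolutely_integrable_on {-1..1}"
    using \<nu> \<gamma> by (intro absolutely_integrable_mult_continuous absolutely_integrable_jacobi_weight continuous_intros)
  have "jacobi_h \<nu> \<gamma> m = (LINT t:{-1..1}|lebesgue. (poly (jacobi_poly \<nu> \<gamma> m) t)\<^sup>2 * jacobi_weight \<nu> \<gamma> t)"
    by (simp add: jacobi_h_def poly_jacobi_poly mult.commute)
  also have "\<dots> = integral {-1..1} (\<lambda>t. (poly (jacobi_poly \<nu> \<gamma> m) t)\<^sup>2 * jacobi_weight \<nu> \<gamma> t)"
    by (rule set_lebesgue_integral_eq_integral(2)[OF i])
  also have "\<dots> = (LINT t:{-1<..<1}|lebesgue. (poly (jacobi_poly \<nu> \<gamma> m) t)\<^sup>2 * jacobi_weight \<nu> \<gamma> t)"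
    by (rule LINT_Ioo_eq_integral[OF i, symmetric])
  also have "\<dots> = jacobi_sqnorm \<nu> \<gamma> (poly (jacobi_poly \<nu> \<gamma> m))"
    by (subst sqnorm_jacobi_eq) (auto intro!: measurable_continuous_Icc continuous_intros simp: mult.commute)
  finally show ?thesis .
qed

text \<open>
  The factor \<open>h\<close> from the substitution and the square of the normalising constant of the wavelets multiply to the reciprocal of the
  squared norm of the Jacobi polynomial.
\<close>

lemma wavelet_term_on_cell:
  assumes n: "n \<in> N" and t: "t \<in> inner_cell n" and u: "u \<in> L2_space w {0<..<T}"
  shows "wavelet_coeff \<nu> \<gamma> T k u n m * wavelet \<nu> \<gamma> T k n m t
    = (\<integral>x. pull n u x * poly (jacobi_poly \<nu> \<gamma> m) x \<partial>jacobi_measure \<nu> \<gamma>) / jacobi_sqnorm \<nu> \<gamma> (poly (jacobi_poly \<nu> \<gamma> m))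
      * poly (jacobi_poly \<nu> \<gamma> m) (cell_coord T k n t)"
proof -
  interpret J: orthogonal_polynomials "jacobi_measure \<nu> \<gamma>" "jacobi_poly \<nu> \<gamma>"
    using \<nu> \<gamma> by (intro orthogonal_polynomials_jacobi) auto
  let ?p = "poly (jacobi_poly \<nu> \<gamma> m)"
  define H where "H = jacobi_sqnorm \<nu> \<gamma> ?p"
  define K where "K = 2 powr (real k / 2) * sqrt (1 / (H * T))"
  have H: "H > 0"
    unfolding H_def by (rule J.sqnorm_P_pos)
  have "K\<^sup>2 = (2 powr (real k / 2))\<^sup>2 * (1 / (H * T))"
    using H T_pos by (simp add: K_def power_mult_distrib)
  also have "(2 powr (real k / 2))\<^sup>2 = (2 :: real) ^ k"
    by (simp add: power2_eq_square powr_add[symmetric] powr_realpow)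
  finally have K: "h * K\<^sup>2 = 1 / H"
    using T_pos by (simp add: h_def)
  have wav: "wavelet \<nu> \<gamma> T k n m t = (if t \<in> cell T k n then K * ?p (cell_coord T k n t) else 0)" for t
    by (simp add: wavelet_def K_def H_def jacobi_h_eq_sqnorm poly_jacobi_poly)
  have sq: "square_integrable (jacobi_measure \<nu> \<gamma>) (pull n u)"
    using u n unfolding L2_space_inner_cells cell_interiors_eq L2_space_cells by blast
  have "wavelet_coeff \<nu> \<gamma> T k u n m = (LINT t:inner_cell n|lebesgue. w t * (u t * (K * ?p (cell_coord T k n t))))"
    unfolding wavelet_coeff_def set_lebesgue_integral_def
  proof (rule Bochner_Integration.integral_cong[OF refl])
    fix t
    \<comment> \<open>at the left endpoint of a cell the weight vanishes, since \<open>0 powr \<gamma> = 0\<close>\<close>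
    have "w t = 0" if "t = mid n - h"
    proof -
      have "t \<in> cell T k n"
        using that h_pos by (simp add: cell_eq)
      moreover have "cell_coord T k n t = -1"
        using cell_coord_mid[of n "-1"] that by simp
      ultimately show ?thesis
        using weight_on_cell[OF n] by (simp add: jacobi_weight_def)
    qed
    moreover have "t \<in> cell T k n \<longleftrightarrow> t \<in> inner_cell n \<or> t = mid n - h"
      using h_pos by (auto simp: cell_eq)
    moreover have "t \<in> {0<..<T}" if "t \<in> inner_cell n"
      using that inner_cells_subset n by blast
    ultimately show "indicat_real {0<..<T} t *\<^sub>R (w t * u t * wavelet \<nu> \<gamma> T k n m t)
        = indicat_real (inner_cell n) t *\<^sub>R (w t * (u t * (K * ?p (cell_coord T k n t))))"
      by (cases "t \<in> inner_cell n"; cases "t = mid n - h") (auto simp: wav)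
  qed
  also have "\<dots> = h * (LINT x:{-1<..<1}|lebesgue. jacobi_weight \<nu> \<gamma> x * (K * (pull n u x * ?p x)))"
  proof -
    have "pull n (\<lambda>t. u t * (K * ?p (cell_coord T k n t))) = (\<lambda>x. K * (pull n u x * ?p x))"
      by (auto simp: pull_def cell_coord_mid)
    then show ?thesis
      unfolding weighted_integral_cell[OF n] by simp
  qed
  also have "\<dots> = h * K * (LINT x:{-1<..<1}|lebesgue. jacobi_weight \<nu> \<gamma> x * (pull n u x * ?p x))"
    by (simp add: mult.left_commute[of _ K])
  also have "(LINT x:{-1<..<1}|lebesgue. jacobi_weight \<nu> \<gamma> x * (pull n u x * ?p x))
      = (\<integral>x. pull n u x * ?p x \<partial>jacobi_measure \<nu> \<gamma>)"
  proof (subst integral_jacobi_measure)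
    show "(\<lambda>x. pull n u x * ?p x) \<in> borel_measurable (lebesgue_on {-1<..<1})"
      using borel_measurable_integrable[OF J.integrable_mult_poly[OF sq]] by (simp add: measurable_jacobi_measure)
  qed (simp add: set_lebesgue_integral_def integral_restrict_space)
  finally have c: "wavelet_coeff \<nu> \<gamma> T k u n m = h * K * (\<integral>x. pull n u x * ?p x \<partial>jacobi_measure \<nu> \<gamma>)" .
  have "t \<in> cell T k n"
    using t inner_cell_subset_cell by blast
  then have "wavelet_coeff \<nu> \<gamma> T k u n m * wavelet \<nu> \<gamma> T k n m t
      = (h * K\<^sup>2) * (\<integral>x. pull n u x * ?p x \<partial>jacobi_measure \<nu> \<gamma>) * ?p (cell_coord T k n t)"
    by (simp add: c wav power2_eq_square mult_ac)
  then show ?thesis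
    unfolding K H_def by simp
qed

lemma wavelet_approx_on_cell:
  assumes n: "n \<in> N" and t: "t \<in> inner_cell n" and u: "u \<in> L2_space w {0<..<T}"
  shows "wavelet_approx \<nu> \<gamma> T k M u t = poly (jacobi_proj \<nu> \<gamma> (Suc M) (pull n u)) (cell_coord T k n t)"
proof -
  interpret J: orthogonal_polynomials "jacobi_measure \<nu> \<gamma>" "jacobi_poly \<nu> \<gamma>"
    using \<nu> \<gamma> by (intro orthogonal_polynomials_jacobi) auto
  have zero: "wavelet \<nu> \<gamma> T k i m t = 0" if "i \<noteq> n" for i m
  proof -
    have "t \<notin> cell T k i"
      using that cell_unique[of t n i] t inner_cell_subset_cell[of n] by blast
    then show ?thesis
      by (simp add: wavelet_def)
  qed
  have "wavelet_approx \<nu> \<gamma> T k M u t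
      = (\<Sum>i\<in>N. if i = n then \<Sum>m = 0..M. wavelet_coeff \<nu> \<gamma> T k u n m * wavelet \<nu> \<gamma> T k n m t else 0)"
    unfolding wavelet_approx_def by (intro sum.cong refl) (auto simp: zero)
  also have "\<dots> = (\<Sum>m = 0..M. wavelet_coeff \<nu> \<gamma> T k u n m * wavelet \<nu> \<gamma> T k n m t)"
    using n by simp
  also have "\<dots> = poly (J.proj (Suc M) (pull n u)) (cell_coord T k n t)"
    unfolding wavelet_term_on_cell[OF n t u] J.proj_def
    by (simp add: poly_sum atLeast0AtMost lessThan_Suc_atMost)
  finally show ?thesis .
qed

end

section \<open>The error estimate\<close>

text \<open>
  Passage from the degree bound \<open>M + 1\<close> and the smoothness \<open>s\<close> to \<open>M\<close> and \<open>\<mu>\<close>.  Either \<open>s = \<mu>\<close>, or \<open>M + 1 < \<mu>\<close> and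
  all powers of \<open>M\<close> involved are bounded in terms of \<open>\<mu>\<close>.
\<close>

lemma degree_rate_factor:
  assumes "1 \<le> M" "s = min \<mu> (Suc M)" "j \<le> r" "r \<le> \<mu>"
  shows "real (Suc M) ^ (4 * j - 1) / real (Suc M) ^ (2 * s)
       \<le> 2 ^ (4 * \<mu>) * (real \<mu> + 1) ^ (2 * \<mu>) * (real M ^ (4 * r - 1) / real M ^ (2 * \<mu>))"
proof -
  have M: "1 \<le> real M"
    using assms(1) by simp
  have "real (Suc M) ^ (4 * j - 1) \<le> (2 * real M) ^ (4 * j - 1)"
    using M by (intro power_mono) auto
  also have "\<dots> = 2 ^ (4 * j - 1) * real M ^ (4 * j - 1)"
    by (rule power_mult_distrib)
  also have "\<dots> \<le> 2 ^ (4 * \<mu>) * real M ^ (4 * r - 1)"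
    using M assms by (intro mult_mono power_increasing) auto
  finally have num: "real (Suc M) ^ (4 * j - 1) \<le> 2 ^ (4 * \<mu>) * real M ^ (4 * r - 1)" .
  have "real M ^ (2 * \<mu>) \<le> (real \<mu> + 1) ^ (2 * \<mu>) * real (Suc M) ^ (2 * s)"
  proof (cases "s = \<mu>")
    case True
    have "real M ^ (2 * \<mu>) \<le> 1 * real (Suc M) ^ (2 * \<mu>)"
      by (simp add: power_mono)
    also have "\<dots> \<le> (real \<mu> + 1) ^ (2 * \<mu>) * real (Suc M) ^ (2 * \<mu>)"
      by (intro mult_right_mono) auto
    finally show ?thesis
      using True by simp
  next
    case False
    then have "real M \<le> real \<mu> + 1"
      using assms(2) by auto
    then have "real M ^ (2 * \<mu>) \<le> (real \<mu> + 1) ^ (2 * \<mu>) * 1"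
      by (simp add: power_mono)
    also have "\<dots> \<le> (real \<mu> + 1) ^ (2 * \<mu>) * real (Suc M) ^ (2 * s)"
      by (intro mult_left_mono one_le_power) auto
    finally show ?thesis .
  qed
  then have den: "1 / real (Suc M) ^ (2 * s) \<le> (real \<mu> + 1) ^ (2 * \<mu>) / real M ^ (2 * \<mu>)"
    using M by (simp add: field_simps del: of_nat_Suc)
  have "real (Suc M) ^ (4 * j - 1) * (1 / real (Suc M) ^ (2 * s))
      \<le> (2 ^ (4 * \<mu>) * real M ^ (4 * r - 1)) * ((real \<mu> + 1) ^ (2 * \<mu>) / real M ^ (2 * \<mu>))"
    by (intro mult_mono num den) auto
  then show ?thesis
    by (simp add: mult_ac del: of_nat_Suc)
qed

context jacobi_wavelets
begin

text \<open>
  The factor that remains after scaling the derivative of order \<open>j\<close> of the error and of order \<open>s\<close> of \<open>u\<close> back to the cell.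
\<close>

lemma scale_factor:
  assumes "j \<le> s" "s \<le> \<mu>" "j \<le> r"
  shows "h ^ (2 * s) / h ^ (2 * j) \<le> (max 1 T) ^ (2 * \<mu>) * (2 ^ k) powi (2 * int r - 2 * int s)"
proof -
  define d where "d = 2 * s - 2 * j"
  have "T ^ d \<le> (max 1 T) ^ d"
    using T_pos by (intro power_mono) auto
  also have "\<dots> \<le> (max 1 T) ^ (2 * \<mu>)"
    using assms by (intro power_increasing) (auto simp: d_def)
  finally have 1: "T ^ d \<le> (max 1 T) ^ (2 * \<mu>)" .
  have "2 * int j - 2 * int s = - int d"
    using assms by (simp add: d_def of_nat_diff)
  then have "1 / (2 ^ k) ^ d = (2 ^ k :: real) powi (2 * int j - 2 * int s)"
    by (simp only: power_int_minus power_int_of_nat divide_inverse mult_1_left)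
  also have "\<dots> \<le> (2 ^ k) powi (2 * int r - 2 * int s)"
    using assms by (intro power_int_increasing) auto
  finally have 2: "1 / (2 ^ k) ^ d \<le> (2 ^ k :: real) powi (2 * int r - 2 * int s)" .
  have "h ^ (2 * s) / h ^ (2 * j) = h ^ d"
    using h_pos assms by (simp add: d_def power_diff)
  also have "\<dots> = T ^ d * (1 / (2 ^ k) ^ d)"
    by (simp add: h_def power_divide)
  also have "\<dots> \<le> (max 1 T) ^ (2 * \<mu>) * (2 ^ k) powi (2 * int r - 2 * int s)"
    using T_pos by (intro mult_mono 1 2) auto
  finally show ?thesis .
qed

lemma sobolev_chain:
  assumes u: "u \<in> sobolev_space w {0<..<T} \<mu>"
  shows "\<exists>f. (\<forall>j<\<mu>. ac_deriv 0 T (f j) (f (Suc j))) \<and>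
    (AE t in lebesgue. t \<in> {0<..<T} \<longrightarrow> u t = f 0 t) \<and>
    (\<forall>j\<le>\<mu>. f j \<in> L2_space w {0<..<T} \<and>
       L2_norm w {0<..<T} (weak_deriv {0<..<T} j u) = L2_norm w {0<..<T} (f j))"
proof -
  have uL: "u \<in> L2_space w {0<..<T}"
    and ex: "\<forall>j\<in>{1..\<mu>}. \<exists>v\<in>L2_space w {0<..<T}. has_weak_deriv {0<..<T} j u v"
    using u by (auto simp: sobolev_space_def)
  obtain v' where v': "\<And>j. j \<in> {1..\<mu>} \<Longrightarrow> v' j \<in> L2_space w {0<..<T} \<and> has_weak_deriv {0<..<T} j u (v' j)"
    using ex by metis
  \<comment> \<open>order \<open>0\<close> is not covered by the hypothesis and is \<open>u\<close> itself\<close>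
  define v where "v j = (if j = 0 then u else v' j)" for j
  have vL: "v j \<in> L2_space w {0<..<T}" if "j \<le> \<mu>" for j
    using uL v'[of j] that by (auto simp: v_def)
  have "u absolutely_integrable_on {0..T}"
    by (rule L2_space_imp_absolutely_integrable[OF uL])
  then have "locally_integrable {0<..<T} u"
    unfolding locally_integrable_def
  proof (intro allI impI)
    fix K assume u: "u absolutely_integrable_on {0..T}" and K: "compact K \<and> K \<subseteq> {0<..<T}"
    show "u absolutely_integrable_on K"
      by (rule set_integrable_subset[OF u]) (use K borel_compact[of K] in auto)
  qed
  then have "has_weak_deriv {0<..<T} 0 u u"
    by (simp add: has_weak_deriv_def)
  then have vw: "has_weak_deriv {0<..<T} j u (v j)" if "j \<le> \<mu>" for j
    using v'[of j] that by (auto simp: v_def)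
  obtain f where chain: "\<forall>j<\<mu>. ac_deriv 0 T (f j) (f (Suc j))"
    and ae: "\<And>j. j \<le> \<mu> \<Longrightarrow> AE t in lebesgue. t \<in> {0<..<T} \<longrightarrow> v j t = f j t"
    using weak_derivs_absolutely_continuous[OF T_pos vw L2_space_imp_absolutely_integrable[OF vL]] by blast
  have "f j \<in> L2_space w {0<..<T} \<and> L2_norm w {0<..<T} (weak_deriv {0<..<T} j u) = L2_norm w {0<..<T} (f j)"
    if j: "j \<le> \<mu>" for j
  proof -
    have ae': "AE t in lebesgue. t \<in> {0<..<T} \<longrightarrow> f j t = v j t"
      using ae[OF j] by eventually_elim auto
    have "L2_norm w {0<..<T} (weak_deriv {0<..<T} j u) = L2_norm w {0<..<T} (v j)"
      by (intro L2_norm_cong_AE vL j weak_deriv_AE_eq vw order_refl)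
    also have "\<dots> = L2_norm w {0<..<T} (f j)"
      by (rule L2_norm_cong_AE[OF vL[OF j] ae', symmetric])
    finally show ?thesis
      using L2_space_cong_AE[OF vL[OF j] ae'] by blast
  qed
  moreover have "AE t in lebesgue. t \<in> {0<..<T} \<longrightarrow> u t = f 0 t"
    using ae[of 0] by (simp add: v_def)
  ultimately show ?thesis
    using chain by blast
qed

text \<open>
  The function \<open>E j\<close> is the derivative of order \<open>j\<close> of the error, assembled from the cells.  For \<open>j \<le> s\<close>, where
  \<open>s = min \<mu> (M + 1)\<close>, the rate on \<open>(-1, 1)\<close> bounds it by the term of index \<open>s\<close> of the seminorm.  For \<open>j > s\<close> the
  polynomial parts have degree below \<open>j\<close>, so \<open>E j\<close> is the derivative of \<open>u\<close>, which is the term of index \<open>j\<close>.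
\<close>

lemma wavelet_error_bounds:
  fixes \<mu> M :: nat
  assumes C: "C \<ge> 1" "\<forall>s\<le>\<mu>. \<forall>j\<le>s. jacobi_rate \<nu> \<gamma> C j s"
    and u: "u \<in> sobolev_space w {0<..<T} \<mu>" and M: "1 \<le> M"
  defines "e \<equiv> \<lambda>t. u t - wavelet_approx \<nu> \<gamma> T k M u t"
  shows "\<exists>E. \<forall>j\<le>\<mu>. E j \<in> L2_space w (cell_interiors T k) \<and>
      has_weak_deriv (cell_interiors T k) j e (E j) \<and>
      (\<forall>r. j \<le> r \<longrightarrow> r \<le> \<mu> \<longrightarrow>
        (L2_norm w (cell_interiors T k) (E j))\<^sup>2 \<le>
          C * 2 ^ (4 * \<mu>) * (real \<mu> + 1) ^ (2 * \<mu>) * (max 1 T) ^ (2 * \<mu>)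
            * (real M ^ (4 * r - 1) / real M ^ (2 * \<mu>)) * (wavelet_seminorm \<nu> \<gamma> T r \<mu> M k u)\<^sup>2)"
proof -
  interpret J: orthogonal_polynomials "jacobi_measure \<nu> \<gamma>" "jacobi_poly \<nu> \<gamma>"
    using \<nu> \<gamma> by (intro orthogonal_polynomials_jacobi) auto
  let ?S = "\<Union>n\<in>N. inner_cell n"
  obtain f where chain: "\<And>j. j < \<mu> \<Longrightarrow> ac_deriv 0 T (f j) (f (Suc j))"
    and uf: "AE t in lebesgue. t \<in> {0<..<T} \<longrightarrow> u t = f 0 t"
    and fL: "\<And>j. j \<le> \<mu> \<Longrightarrow> f j \<in> L2_space w {0<..<T}"
    and fnorm: "\<And>j. j \<le> \<mu> \<Longrightarrow> L2_norm w {0<..<T} (weak_deriv {0<..<T} j u) = L2_norm w {0<..<T} (f j)"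
    using sobolev_chain[OF u] by blast
  have uL: "u \<in> L2_space w {0<..<T}"
    using u by (simp add: sobolev_space_def)
  have fpull: "square_integrable (jacobi_measure \<nu> \<gamma>) (pull n (f j))" if "j \<le> \<mu>" "n \<in> N" for n j
    using fL[OF that(1)] that(2) unfolding L2_space_inner_cells cell_interiors_eq L2_space_cells by blast
  have upull: "square_integrable (jacobi_measure \<nu> \<gamma>) (pull n u)" if "n \<in> N" for n
    using uL that unfolding L2_space_inner_cells cell_interiors_eq L2_space_cells by blast
  have fcells: "(L2_norm w {0<..<T} (f j))\<^sup>2 = (\<Sum>n\<in>N. h * jacobi_sqnorm \<nu> \<gamma> (pull n (f j)))" if "j \<le> \<mu>" for j
    using fL[OF that] L2_norm_cells unfolding L2_space_inner_cells L2_norm_inner_cells cell_interiors_eq by blast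
  define P where "P n = J.proj (Suc M) (pull n u)" for n
  \<comment> \<open>derivatives of the transported function, of its projection on cell \<open>n\<close>, and of the error\<close>
  define F where "F n j x = h ^ j * pull n (f j) x" for n j x
  define G where "G n j t = f j t - (1 / h) ^ j * poly ((pderiv ^^ j) (P n)) (cell_coord T k n t)" for n j t
  define E where "E j t = (\<Sum>n\<in>N. if t \<in> inner_cell n then G n j t else 0)" for j t
  have EG: "E j t = G n j t" if "n \<in> N" "t \<in> inner_cell n" for n j t
  proof -
    have "E j t = (\<Sum>m\<in>N. if m = n then G n j t else 0)"
      unfolding E_def
    proof (intro sum.cong refl)
      fix m
      have "t \<in> inner_cell m \<longleftrightarrow> m = n"
        using that(2) cell_unique[of t n m] inner_cell_subset_cell by blast
      then show "(if t \<in> inner_cell m then G m j t else 0) = (if m = n then G n j t else 0)"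
        by auto
    qed
    then show ?thesis
      using that(1) by simp
  qed
  have FP: "F n 0 = pull n (f 0)" for n
    by (simp add: F_def[abs_def])
  have Fchain: "ac_deriv (-1) 1 (F n j) (F n (Suc j))" if n: "n \<in> N" and j: "j < \<mu>" for n j
  proof -
    have "ac_deriv (-1) 1 (\<lambda>x. f j (mid n + h * x)) (\<lambda>x. h * f (Suc j) (mid n + h * x))"
      using cell_bounds[OF n] by (intro ac_deriv_affine[OF h_pos chain[OF j]]) auto
    from ac_deriv_cmult[OF this, of "h ^ j"] show ?thesis
      by (simp add: F_def[abs_def] pull_def mult_ac)
  qed
  have Fsq: "square_integrable (jacobi_measure \<nu> \<gamma>) (F n j)" if "n \<in> N" "j \<le> \<mu>" for n j
    unfolding F_def[abs_def] by (intro square_integrable_cmult fpull that)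
  have Fnorm: "jacobi_sqnorm \<nu> \<gamma> (F n j) = h ^ (2 * j) * jacobi_sqnorm \<nu> \<gamma> (pull n (f j))" for n j
    unfolding F_def[abs_def] sqnorm_cmult by (simp add: power_mult[symmetric] mult.commute)
  have PF: "P n = J.proj (Suc M) (F n 0)" if n: "n \<in> N" for n
    unfolding P_def FP
  proof (rule J.proj_cong_AE[OF upull[OF n] fpull[OF _ n]])
    show "AE x in jacobi_measure \<nu> \<gamma>. pull n u x = pull n (f 0) x"
    proof -
      have "AE x in lebesgue. mid n + h * x \<in> {0<..<T} \<longrightarrow> pull n u x = pull n (f 0) x"
        unfolding pull_def by (rule AE_lebesgue_affine[OF h_pos uf])
      then have "AE x in lebesgue. x \<in> {-1<..<1} \<longrightarrow> pull n u x = pull n (f 0) x"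
        by eventually_elim (use inner_cell_image[OF n] inner_cells_subset n in blast)
      then show ?thesis
        unfolding AE_jacobi_measure by (subst AE_restrict_space_iff) auto
    qed
  qed simp
  have Gchain: "ac_deriv (mid n - h) (mid n + h) (G n j) (G n (Suc j))" if n: "n \<in> N" and j: "j < \<mu>" for n j
  proof -
    let ?p = "(pderiv ^^ j) (P n)"
    have c: "continuous_on A (cell_coord T k n)" for A
      unfolding cell_coord_def by (intro continuous_intros)
    have d: "(cell_coord T k n has_real_derivative 1 / h) (at t)" for t
      unfolding cell_coord_def[abs_def] h_def using T_pos by (auto intro!: derivative_eq_intros)
    have "ac_deriv (mid n - h) (mid n + h) (\<lambda>t. (1 / h) ^ j * poly ?p (cell_coord T k n t))
        (\<lambda>t. (1 / h) ^ Suc j * poly (pderiv ?p) (cell_coord T k n t))"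
    proof (rule ac_derivI)
      show "((\<lambda>t. (1 / h) ^ j * poly ?p (cell_coord T k n t)) has_real_derivative
          (1 / h) ^ Suc j * poly (pderiv ?p) (cell_coord T k n t)) (at t)" for t
        using DERIV_cmult[OF DERIV_chain2[OF poly_DERIV d], of "(1 / h) ^ j" ?p t] by (simp add: mult_ac)
    qed (use h_pos in \<open>auto intro!: continuous_intros c absolutely_integrable_continuous_real\<close>)
    then show ?thesis
      unfolding G_def[abs_def] using cell_bounds[OF n]
      by (auto intro!: ac_deriv_diff ac_deriv_subinterval[OF chain[OF j]])
  qed
  have Gint: "G n j absolutely_integrable_on {mid n - h..mid n + h}" if n: "n \<in> N" and j: "j \<le> \<mu>" for n j
  proof -
    have "f j absolutely_integrable_on {mid n - h..mid n + h}"
      by (rule set_integrable_subset[OF L2_space_imp_absolutely_integrable[OF fL[OF j]]])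
        (use cell_bounds[OF n] in auto)
    moreover have "(\<lambda>t. (1 / h) ^ j * poly ((pderiv ^^ j) (P n)) (cell_coord T k n t)) absolutely_integrable_on {mid n - h..mid n + h}"
      unfolding cell_coord_def by (intro absolutely_integrable_continuous_real continuous_intros)
    ultimately show ?thesis
      unfolding G_def[abs_def] by (rule set_integral_diff(1))
  qed
  have eG: "AE t in lebesgue. t \<in> inner_cell n \<longrightarrow> e t = G n 0 t" if n: "n \<in> N" for n
  proof -
    have eq: "e t = G n 0 t" if "u t = f 0 t" "t \<in> inner_cell n" for t
      using that wavelet_approx_on_cell[OF n that(2) uL, of M] by (simp add: e_def G_def P_def)
    show ?thesis
      using uf by eventually_elim (use eq inner_cells_subset n in blast)
  qed
  have weak: "has_weak_deriv ?S j e (E j)" if j: "j \<le> \<mu>" for j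
  proof (rule has_weak_deriv_piecewise[where G = G])
    show "AE t in lebesgue. t \<in> inner_cell n \<longrightarrow> E j t = G n j t" if "n \<in> N" for n
      using EG[OF that] by simp
    show "ac_deriv (mid n - h) (mid n + h) (G n i) (G n (Suc i))" if "n \<in> N" "i < j" for n i
      using Gchain[of n i] that j by simp
    show "G n 0 absolutely_integrable_on {mid n - h..mid n + h}" if "n \<in> N" for n
      by (rule Gint[OF that]) simp
  qed (use h_pos disjoint_inner_cells eG Gint j in auto)
  have pullE: "pull n (E j) x = (1 / h) ^ j * (F n j x - poly ((pderiv ^^ j) (P n)) x)"
    if n: "n \<in> N" and x: "x \<in> {-1<..<1}" for n j x
  proof -
    have "pull n (E j) x = G n j (mid n + h * x)"
      unfolding pull_def by (rule EG[OF n inner_cell_image[OF n x]])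
    also have "\<dots> = (1 / h) ^ j * (F n j x - poly ((pderiv ^^ j) (P n)) x)"
      using h_pos by (simp add: G_def F_def pull_def cell_coord_mid right_diff_distrib power_divide)
    finally show ?thesis .
  qed
  let ?A = "\<lambda>n j. jacobi_sqnorm \<nu> \<gamma> (\<lambda>x. F n j x - poly ((pderiv ^^ j) (P n)) x)"
  have Epull: "square_integrable (jacobi_measure \<nu> \<gamma>) (pull n (E j))"
    and Enorm1: "jacobi_sqnorm \<nu> \<gamma> (pull n (E j)) = ?A n j / h ^ (2 * j)" if n: "n \<in> N" and j: "j \<le> \<mu>" for n j
  proof -
    have eq: "pull n (E j) x = (1 / h) ^ j * (F n j x - poly ((pderiv ^^ j) (P n)) x)"
      if "x \<in> space (jacobi_measure \<nu> \<gamma>)" for x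
      using pullE[OF n] that by (simp add: space_jacobi_measure)
    have "square_integrable (jacobi_measure \<nu> \<gamma>) (\<lambda>x. (1 / h) ^ j * (F n j x - poly ((pderiv ^^ j) (P n)) x))"
      by (intro square_integrable_cmult square_integrable_diff Fsq n j J.square_integrable_poly)
    then show "square_integrable (jacobi_measure \<nu> \<gamma>) (pull n (E j))"
      by (subst square_integrable_cong(1)) (auto simp: eq)
    have "jacobi_sqnorm \<nu> \<gamma> (pull n (E j)) = jacobi_sqnorm \<nu> \<gamma> (\<lambda>x. (1 / h) ^ j * (F n j x - poly ((pderiv ^^ j) (P n)) x))"
      by (rule square_integrable_cong(2)) (rule eq)
    also have "\<dots> = ?A n j / h ^ (2 * j)"
      unfolding sqnorm_cmult by (simp add: power_divide power_mult[symmetric] mult.commute)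
    finally show "jacobi_sqnorm \<nu> \<gamma> (pull n (E j)) = ?A n j / h ^ (2 * j)" .
  qed
  have EL: "E j \<in> L2_space w ?S" if "j \<le> \<mu>" for j
    unfolding L2_space_cells using Epull that by blast
  have Enorm: "(L2_norm w ?S (E j))\<^sup>2 = (\<Sum>n\<in>N. h * (?A n j / h ^ (2 * j)))" if "j \<le> \<mu>" for j
    unfolding L2_norm_cells[OF EL[OF that]] by (intro sum.cong refl) (simp only: Enorm1[OF _ that])
  define s where "s = min \<mu> (Suc M)"
  have s: "s \<le> \<mu>" "s \<le> Suc M"
    by (auto simp: s_def)
  let ?u = "\<lambda>i. (L2_norm w {0<..<T} (f i))\<^sup>2"
  have semi: "(wavelet_seminorm \<nu> \<gamma> T r \<mu> M k u)\<^sup>2 = (\<Sum>i=s..\<mu>. (2 ^ k) powi (2 * int r - 2 * int i) * ?u i)" for r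
  proof -
    have "(wavelet_seminorm \<nu> \<gamma> T r \<mu> M k u)\<^sup>2
        = (\<Sum>i=s..\<mu>. (2 ^ k) powi (2 * int r - 2 * int i) * (L2_norm w {0<..<T} (weak_deriv {0<..<T} i u))\<^sup>2)"
      unfolding wavelet_seminorm_def s_def by (subst real_sqrt_pow2) (auto intro!: sum_nonneg)
    also have "\<dots> = (\<Sum>i=s..\<mu>. (2 ^ k) powi (2 * int r - 2 * int i) * ?u i)"
      by (intro sum.cong refl) (simp add: fnorm)
    finally show ?thesis .
  qed
  define Kd where "Kd = (2 :: real) ^ (4 * \<mu>) * (real \<mu> + 1) ^ (2 * \<mu>)"
  define Ks where "Ks = (max 1 T) ^ (2 * \<mu>)"
  have Kd: "Kd \<ge> 0"
    by (simp add: Kd_def)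
  have Ks1: "Ks \<ge> 1"
    by (simp add: Ks_def one_le_power)
  have bound: "(L2_norm w ?S (E j))\<^sup>2 \<le>
      C * Kd * Ks * (real M ^ (4 * r - 1) / real M ^ (2 * \<mu>)) * (wavelet_seminorm \<nu> \<gamma> T r \<mu> M k u)\<^sup>2"
    if jr: "j \<le> r" and r: "r \<le> \<mu>" for j r
  proof -
    define R where "R = real M ^ (4 * r - 1) / real M ^ (2 * \<mu>)"
    have R: "R \<ge> 0"
      by (simp add: R_def)
    have j: "j \<le> \<mu>"
      using jr r by simp
    have factor: "real (Suc M) ^ (4 * i - 1) / real (Suc M) ^ (2 * s) \<le> Kd * R" if "i \<le> r" for i
      unfolding Kd_def R_def by (rule degree_rate_factor[OF M s_def that r])
    have summand: "(2 ^ k) powi (2 * int r - 2 * int i) * ?u i \<le> (wavelet_seminorm \<nu> \<gamma> T r \<mu> M k u)\<^sup>2"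
      if "s \<le> i" "i \<le> \<mu>" for i
      unfolding semi using that
      by (intro member_le_sum[of i "{s..\<mu>}" "\<lambda>i. (2 ^ k) powi (2 * int r - 2 * int i) * ?u i"]) auto
    show ?thesis
    proof (cases "j \<le> s")
      case True
      define A where "A = real (Suc M) ^ (4 * j - 1) / real (Suc M) ^ (2 * s)"
      have A: "A \<ge> 0" "A \<le> Kd * R"
        using factor[OF jr] by (auto simp: A_def)
      have An: "?A n j \<le> C * A * (h ^ (2 * s) * jacobi_sqnorm \<nu> \<gamma> (pull n (f s)))" if n: "n \<in> N" for n
      proof -
        have "real (Suc M) ^ (2 * s) * ?A n j \<le> C * real (Suc M) ^ (4 * j - 1) * jacobi_sqnorm \<nu> \<gamma> (F n s)"
          unfolding PF[OF n] using True s Fchain[OF n] Fsq[OF n] C(2) by (intro jacobi_rateD) auto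
        then have "?A n j \<le> C * A * jacobi_sqnorm \<nu> \<gamma> (F n s)"
          by (simp add: A_def field_simps del: of_nat_Suc)
        then show ?thesis
          by (simp only: Fnorm)
      qed
      have "(L2_norm w ?S (E j))\<^sup>2 \<le> (\<Sum>n\<in>N. h * (C * A * (h ^ (2 * s) * jacobi_sqnorm \<nu> \<gamma> (pull n (f s))) / h ^ (2 * j)))"
        unfolding Enorm[OF j] using h_pos An by (intro sum_mono mult_left_mono divide_right_mono) auto
      also have "\<dots> = (C * A * (h ^ (2 * s) / h ^ (2 * j))) * ?u s"
        unfolding fcells[OF s(1)] sum_distrib_left by (intro sum.cong refl) simp
      also have "\<dots> \<le> (C * (Kd * R) * (Ks * (2 ^ k) powi (2 * int r - 2 * int s))) * ?u s"
        unfolding Ks_def using C(1) A h_pos True s jr Kd R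
        by (intro mult_right_mono mult_mono scale_factor) auto
      also have "\<dots> = C * Kd * Ks * R * ((2 ^ k) powi (2 * int r - 2 * int s) * ?u s)"
        by (simp only: mult_ac)
      also have "\<dots> \<le> C * Kd * Ks * R * (wavelet_seminorm \<nu> \<gamma> T r \<mu> M k u)\<^sup>2"
        using C(1) Kd Ks1 R s by (intro mult_left_mono summand) auto
      finally show ?thesis
        by (simp only: R_def)
    next
      case False
      then have sM: "s = Suc M" and Mj: "Suc M < j"
        using j by (auto simp: s_def)
      have zero: "(pderiv ^^ j) (P n) = 0" for n
      proof -
        have "(pderiv ^^ i) (P n) \<in> polys_below (Suc M - i)" for i
          by (induction i) (use J.proj_in_polys_below polys_below_pderiv in \<open>force simp: P_def\<close>)+
        from this[of j] show ?thesis
          using Mj by (simp add: polys_below_0)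
      qed
      have "(L2_norm w ?S (E j))\<^sup>2 = ?u j"
        unfolding Enorm[OF j] fcells[OF j] using h_pos by (intro sum.cong refl) (simp add: zero Fnorm)
      also have "\<dots> \<le> (C * Kd * Ks * R * (2 ^ k) powi (2 * int r - 2 * int j)) * ?u j"
      proof -
        have "1 \<le> Kd * R"
        proof -
          have "real (Suc M) ^ (2 * s) \<le> real (Suc M) ^ (4 * j - 1)"
            using Mj unfolding sM by (intro power_increasing) auto
          then have "1 \<le> real (Suc M) ^ (4 * j - 1) / real (Suc M) ^ (2 * s)"
            by (subst le_divide_eq_1_pos) simp_all
          then show ?thesis
            using factor[OF jr] by linarith
        qed
        moreover have "1 \<le> (2 ^ k :: real) powi (2 * int r - 2 * int j)"
          using jr by (intro one_le_power_int) auto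
        ultimately have "1 * 1 * 1 * 1 \<le> C * (Kd * R) * Ks * (2 ^ k) powi (2 * int r - 2 * int j)"
          using C(1) Ks1 by (intro mult_mono) auto
        then show ?thesis
          using mult_right_mono[of 1 "C * Kd * Ks * R * (2 ^ k) powi (2 * int r - 2 * int j)" "?u j"]
          by (simp add: mult_ac)
      qed
      also have "\<dots> = C * Kd * Ks * R * ((2 ^ k) powi (2 * int r - 2 * int j) * ?u j)"
        by (simp only: mult_ac)
      also have "\<dots> \<le> C * Kd * Ks * R * (wavelet_seminorm \<nu> \<gamma> T r \<mu> M k u)\<^sup>2"
        using C(1) Kd Ks1 R False j by (intro mult_left_mono summand) auto
      finally show ?thesis
        by (simp only: R_def)
    qed
  qed
  show ?thesis
    unfolding cell_interiors_eq using EL weak bound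
    by (intro exI[of _ E] allI impI conjI) (auto simp: Kd_def Ks_def mult.assoc)
qed

lemma weak_deriv_cells_AE_eq:
  assumes "has_weak_deriv (cell_interiors T k) j e v"
  shows "AE t in lebesgue. t \<in> cell_interiors T k \<longrightarrow> weak_deriv (cell_interiors T k) j e t = v t"
proof -
  have "AE t in lebesgue. \<forall>n\<in>N. t \<in> inner_cell n \<longrightarrow> weak_deriv (cell_interiors T k) j e t = v t"
  proof (subst AE_ball_countable, simp, rule ballI)
    fix n assume "n \<in> N"
    then have "inner_cell n \<subseteq> cell_interiors T k"
      unfolding cell_interiors_eq by blast
    then show "AE t in lebesgue. t \<in> inner_cell n \<longrightarrow> weak_deriv (cell_interiors T k) j e t = v t"
      by (rule weak_deriv_AE_eq[OF assms])
  qed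
  then show ?thesis
    unfolding cell_interiors_eq by eventually_elim blast
qed

lemma weak_deriv_0_cells_AE_eq:
  assumes "has_weak_deriv (cell_interiors T k) 0 e v"
  shows "AE t in lebesgue. t \<in> cell_interiors T k \<longrightarrow> e t = v t"
proof -
  have "has_weak_deriv (cell_interiors T k) 0 e e"
    using assms by (simp add: has_weak_deriv_def)
  from weak_deriv_cells_AE_eq[OF this] weak_deriv_cells_AE_eq[OF assms] show ?thesis
    by eventually_elim auto
qed

end

lemma degree_power_powr:
  assumes "1 \<le> M" "1 \<le> r"
  shows "(real M powr (2 * real r - 1 / 2 - real \<mu>))\<^sup>2 = real M ^ (4 * r - 1) / real M ^ (2 * \<mu>)"
proof -
  have M: "real M > 0"
    using assms(1) by simp
  have "(real M powr (2 * real r - 1 / 2 - real \<mu>))\<^sup>2 = real M powr (real (4 * r - 1) - real (2 * \<mu>))"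
    using M assms(2) by (simp add: powr_power of_nat_diff algebra_simps)
  also have "\<dots> = real M ^ (4 * r - 1) / real M ^ (2 * \<mu>)"
    using M by (simp only: powr_diff powr_realpow)
  finally show ?thesis .
qed

lemma degree_power_powr_0:
  assumes "1 \<le> M"
  shows "(real M powr (- real \<mu>))\<^sup>2 = real M ^ (4 * 0 - 1) / real M ^ (2 * \<mu>)"
proof -
  have M: "real M > 0"
    using assms by simp
  have "(real M powr (- real \<mu>))\<^sup>2 = real M powr (real 0 - real (2 * \<mu>))"
    using M by (simp add: powr_power mult.commute)
  also have "\<dots> = real M ^ 0 / real M ^ (2 * \<mu>)"
    using M by (simp only: powr_diff powr_realpow)
  finally show ?thesis
    by simp
qed

theorem theorem1:
  fixes \<nu> \<gamma> T :: real and \<mu> :: nat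
  assumes "-1 < \<nu>" and "\<nu> < 1" and "-1 < \<gamma>" and "\<gamma> < 1" and "T > 0"
  shows "\<exists>C>0. \<forall>k\<ge>1. \<forall>M\<ge>1. \<forall>u\<in>sobolev_space (wavelet_weight \<nu> \<gamma> T k) {0<..<T} \<mu>.
           (let w = wavelet_weight \<nu> \<gamma> T k;
                e = (\<lambda>t. u t - wavelet_approx \<nu> \<gamma> T k M u t)
            in e \<in> L2_space w {0<..<T} \<and>
               L2_norm w {0<..<T} e
                 \<le> C * real M powr (- real \<mu>) * wavelet_seminorm \<nu> \<gamma> T 0 \<mu> M k u \<and>
               (\<forall>r. 1 \<le> r \<and> r \<le> \<mu> \<longrightarrow>
                  e \<in> sobolev_space w (cell_interiors T k) r \<and>
                  sobolev_norm w (cell_interiors T k) r e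
                    \<le> C * real M powr (2 * real r - 1 / 2 - real \<mu>)
                        * wavelet_seminorm \<nu> \<gamma> T r \<mu> M k u))"
proof -
  obtain C0 where C0: "C0 \<ge> 1" "\<forall>s\<le>\<mu>. \<forall>j\<le>s. jacobi_rate \<nu> \<gamma> C0 j s"
    using jacobi_derivative_rate_uniform[OF assms(1,3), of \<mu>] by blast
  define K where "K = C0 * 2 ^ (4 * \<mu>) * (real \<mu> + 1) ^ (2 * \<mu>) * (max 1 T) ^ (2 * \<mu>)"
  have K: "K > 0"
    using C0(1) by (simp add: K_def)
  define C where "C = sqrt ((real \<mu> + 1) * K)"
  have C: "C > 0" "C\<^sup>2 = (real \<mu> + 1) * K"
    using K by (auto simp: C_def)
  show ?thesis
  proof (intro exI[of _ C] conjI allI impI ballI)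
    fix k M :: nat and u
    assume k: "1 \<le> k" and M: "1 \<le> M" and u: "u \<in> sobolev_space (wavelet_weight \<nu> \<gamma> T k) {0<..<T} \<mu>"
    interpret jacobi_wavelets \<nu> \<gamma> T k
      using assms k by unfold_locales
    let ?S = "cell_interiors T k"
    define e where "e = (\<lambda>t. u t - wavelet_approx \<nu> \<gamma> T k M u t)"
    define \<rho> where "\<rho> r = real M ^ (4 * r - 1) / real M ^ (2 * \<mu>)" for r
    define semi where "semi r = wavelet_seminorm \<nu> \<gamma> T r \<mu> M k u" for r
    have semi0: "semi r \<ge> 0" for r
      unfolding semi_def wavelet_seminorm_def by (intro real_sqrt_ge_zero sum_nonneg) auto
    have "\<exists>E. \<forall>j\<le>\<mu>. E j \<in> L2_space w ?S \<and> has_weak_deriv ?S j e (E j) \<and>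
      (\<forall>r. j \<le> r \<longrightarrow> r \<le> \<mu> \<longrightarrow> (L2_norm w ?S (E j))\<^sup>2 \<le> K * \<rho> r * (semi r)\<^sup>2)"
      unfolding e_def K_def \<rho>_def semi_def by (rule wavelet_error_bounds[OF C0 u M])
    then obtain E where E0: "\<forall>j\<le>\<mu>. E j \<in> L2_space w ?S \<and> has_weak_deriv ?S j e (E j) \<and>
      (\<forall>r. j \<le> r \<longrightarrow> r \<le> \<mu> \<longrightarrow> (L2_norm w ?S (E j))\<^sup>2 \<le> K * \<rho> r * (semi r)\<^sup>2)"
      by (rule exE)
    have E: "\<And>j. j \<le> \<mu> \<Longrightarrow> E j \<in> L2_space w ?S" "\<And>j. j \<le> \<mu> \<Longrightarrow> has_weak_deriv ?S j e (E j)"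
      "\<And>j r. j \<le> r \<Longrightarrow> r \<le> \<mu> \<Longrightarrow> (L2_norm w ?S (E j))\<^sup>2 \<le> K * \<rho> r * (semi r)\<^sup>2"
      using E0 by auto
    have nonneg: "0 \<le> K * \<rho> r * (semi r)\<^sup>2" for r
      using K by (simp add: \<rho>_def)
    have final: "x \<le> C * p * semi r" if x: "x\<^sup>2 \<le> (real \<mu> + 1) * (K * \<rho> r * (semi r)\<^sup>2)" and p: "p \<ge> 0" "p\<^sup>2 = \<rho> r" for x p r
    proof (rule power2_le_imp_le)
      have "(C * p * semi r)\<^sup>2 = (real \<mu> + 1) * (K * \<rho> r * (semi r)\<^sup>2)"
        by (simp only: power_mult_distrib C(2) p(2) mult.assoc)
      then show "x\<^sup>2 \<le> (C * p * semi r)\<^sup>2"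
        using x by simp
      show "0 \<le> C * p * semi r"
        using C(1) p(1) semi0 by simp
    qed
    have e0: "AE t in lebesgue. t \<in> ?S \<longrightarrow> e t = E 0 t"
      by (intro weak_deriv_0_cells_AE_eq E) simp
    have eS: "e \<in> L2_space w ?S"
      by (rule L2_space_cong_AE[OF E(1) e0]) simp
    then have eL: "e \<in> L2_space w {0<..<T}"
      by (simp only: L2_space_inner_cells)
    have "(L2_norm w {0<..<T} e)\<^sup>2 = (L2_norm w ?S (E 0))\<^sup>2"
      unfolding L2_norm_inner_cells using L2_norm_cong_AE[OF E(1) e0] by simp
    also have "\<dots> \<le> K * \<rho> 0 * (semi 0)\<^sup>2"
      by (rule E(3)) auto
    also have "\<dots> \<le> (real \<mu> + 1) * (K * \<rho> 0 * (semi 0)\<^sup>2)"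
      using mult_right_mono[OF _ nonneg[of 0], of 1 "real \<mu> + 1"] by simp
    finally have L2: "L2_norm w {0<..<T} e \<le> C * real M powr (- real \<mu>) * semi 0"
      by (rule final) (use degree_power_powr_0[OF M] in \<open>auto simp: \<rho>_def\<close>)
    have sobolev: "e \<in> sobolev_space w ?S r \<and>
        sobolev_norm w ?S r e \<le> C * real M powr (2 * real r - 1 / 2 - real \<mu>) * semi r"
      if r: "1 \<le> r" "r \<le> \<mu>" for r
    proof
      show "e \<in> sobolev_space w ?S r"
        unfolding sobolev_space_def mem_Collect_eq
      proof (intro conjI eS ballI)
        fix j assume "j \<in> {1..r}"
        then have "j \<le> \<mu>"
          using r by simp
        then show "\<exists>v\<in>L2_space w ?S. has_weak_deriv ?S j e v"
          by (intro bexI[of _ "E j"] E)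
      qed
      have "(sobolev_norm w ?S r e)\<^sup>2 = (\<Sum>j = 0..r. (L2_norm w ?S (weak_deriv ?S j e))\<^sup>2)"
        unfolding sobolev_norm_def by (intro real_sqrt_pow2 sum_nonneg) auto
      also have "\<dots> \<le> (\<Sum>j = 0..r. K * \<rho> r * (semi r)\<^sup>2)"
      proof (rule sum_mono)
        fix j assume "j \<in> {0..r}"
        then have j: "j \<le> r" "j \<le> \<mu>"
          using r by auto
        have "L2_norm w ?S (weak_deriv ?S j e) = L2_norm w ?S (E j)"
          by (intro L2_norm_cong_AE E(1) weak_deriv_cells_AE_eq E(2) j)
        then show "(L2_norm w ?S (weak_deriv ?S j e))\<^sup>2 \<le> K * \<rho> r * (semi r)\<^sup>2"
          using E(3)[OF j(1) r(2)] by simp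
      qed
      also have "\<dots> = (real r + 1) * (K * \<rho> r * (semi r)\<^sup>2)"
        by simp
      also have "\<dots> \<le> (real \<mu> + 1) * (K * \<rho> r * (semi r)\<^sup>2)"
        using r by (intro mult_right_mono nonneg) auto
      finally show "sobolev_norm w ?S r e \<le> C * real M powr (2 * real r - 1 / 2 - real \<mu>) * semi r"
        by (rule final) (use degree_power_powr[OF M r(1)] in \<open>auto simp: \<rho>_def\<close>)
    qed
    show "let w = wavelet_weight \<nu> \<gamma> T k;
                e = (\<lambda>t. u t - wavelet_approx \<nu> \<gamma> T k M u t)
            in e \<in> L2_space w {0<..<T} \<and>
               L2_norm w {0<..<T} e
                 \<le> C * real M powr (- real \<mu>) * wavelet_seminorm \<nu> \<gamma> T 0 \<mu> M k u \<and>
               (\<forall>r. 1 \<le> r \<and> r \<le> \<mu> \<longrightarrow>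
                  e \<in> sobolev_space w (cell_interiors T k) r \<and>
                  sobolev_norm w (cell_interiors T k) r e
                    \<le> C * real M powr (2 * real r - 1 / 2 - real \<mu>)
                        * wavelet_seminorm \<nu> \<gamma> T r \<mu> M k u)"
      unfolding Let_def e_def[symmetric] semi_def[symmetric] using eL L2 sobolev by blast
  qed (rule C(1))
qed

end
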